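(* Suppose that the standing assumption (existence of a dual optimal solution and dual Slater condition, stated in the context) holds. Let $\{\bm{w}^k\}$ be a sequence generated by the semismooth Newton algorithm SSNCP described in the context. Then the residual $F(\bm{w}^k)$ converges to $0$, i.e. $$\lim_{k\to\infty} F(\bm{w}^k)=0 .$$
   Context: **Problem.** Let $\mathbb{S}^n$ be the real symmetric $n\times n$ matrices with the trace inner product and Frobenius norm, $\mathcal{K}=\mathbb{S}^n_+$ the positive semidefinite cone, $\bm{c}\in\mathbb{S}^n$, $\mathcal{A}:\mathbb{S}^n\to\mathbb{R}^m$ linear with adjoint $\mathcal{A}^*$, $\mathcal{Q}=\prod_{i=1}^m\mathcal{Q}_i\subset\mathbb{R}^m$ a box constraint set (each $\mathcal{Q}_i$ a nonempty closed interval, possibly a point), and $h(\bm{x})=\sum_{i,j}h_{i,j}(\bm{x}_{i,j})$ the elementwise indicator function of a nonempty polyhedral convex set. The primal problem is $\min\langle\bm{c},\bm{x}\rangle+h(\bm{x})$ s.t. $\mathcal{A}(\bm{x})\in\mathcal{Q}$, $\bm{x}\in\mathcal{K}$. The dual problem is $$\min_{\bm{y}\in\mathbb{R}^m,\,\bm{z},\bm{s}\in\mathbb{S}^n} h^*(-\bm{z})+\delta_{\mathcal{Q}}^*(-\bm{y})+\delta_{\mathcal{K}}^*(-\bm{s})\quad\text{s.t. } \mathcal{A}^*(\bm{y})+\bm{s}+\bm{z}=\bm{c},$$ where $\delta_C$ is the indicator function of $C$ and $^*$ on functions is the Fenchel conjugate. **Standing assumption.** The dual problem has an optimal solution, and there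 exist $-\bm{y}\in\mathrm{ri}(\mathrm{dom}\,\delta_{\mathcal{Q}}^* )$, $-\bm{s}\in\mathrm{ri}(\mathrm{dom}\,\delta_{\mathcal{K}}^* )$, $-\bm{z}\in\mathrm{ri}(\mathrm{dom}\,h^* )$ with $\mathcal{A}^*(\bm{y})+\bm{s}+\bm{z}=\bm{c}$. **The map $F$.** Fix $\sigma>0$. For $\bm{w}=(\bm{y},\bm{z},\bm{x},\bm{u},\bm{q})\in\mathbb{R}^m\times\mathbb{S}^n\times\mathbb{S}^n\times\mathbb{R}^m\times\mathbb{S}^n$ put $P_{\mathcal{K}}=\Pi_{\mathcal{K}}(\bm{x}+\sigma(\mathcal{A}^*(\bm{y})+\bm{z}-\bm{c}))$, $P_{\mathcal{Q}}=\Pi_{\mathcal{Q}}(\bm{u}-\sigma\bm{y})$, $P_h=\mathrm{prox}_{\sigma h}(\bm{q}-\sigma\bm{z})$ ($\Pi$: metric projection; $\mathrm{prox}_{tg}(\bm{x})=\arg\min_{\bm{y}}\{g(\bm{y})+\frac1{2t}\|\bm{y}-\bm{x}\|^2\}$), and $$F(\bm{w})=\Big(\mathcal{A}P_{\mathcal{K}}-P_{\mathcal{Q}},\; P_{\mathcal{K}}-P_h,\; \tfrac1\sigma(\bm{x}-P_{\mathcal{K}}),\; \tfrac1\sigma(\bm{u}-P_{\mathcal{Q}}),\;\tfrac1\sigma(\bm{q}-P_h)\Big).$$ **Generalized Jacobian.** $\hat\partial F(\bm{w})$ is the set of operators $\begin{pmatrix}\mathcal{H}_1&\mathcal{H}_2\\-\mathcal{H}_2^\top&\mathcal{H}_3\end{pmatrix}$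 with $$\mathcal{H}_1=\begin{pmatrix}\sigma(D_{\mathcal{Q}}+\mathcal{A}D_{\mathcal{K}}\mathcal{A}^* )&\sigma\mathcal{A}D_{\mathcal{K}}\\ \sigma D_{\mathcal{K}}\mathcal{A}^*&\sigma(D_h+D_{\mathcal{K}})\end{pmatrix},\quad \mathcal{H}_2=\begin{pmatrix}\mathcal{A}D_{\mathcal{K}}&-D_{\mathcal{Q}}&0\\ D_{\mathcal{K}}&0&-D_h\end{pmatrix},$$ $\mathcal{H}_3=\mathrm{blkdiag}\{\frac1\sigma(I-D_{\mathcal{K}}),\frac1\sigma(I-D_{\mathcal{Q}}),\frac1\sigma(I-D_h)\}$, where $D_{\mathcal{K}},D_{\mathcal{Q}},D_h$ range over the Clarke subdifferentials of $\Pi_{\mathcal{K}},\Pi_{\mathcal{Q}},\mathrm{prox}_{\sigma h}$ at $\bm{x}+\sigma(\mathcal{A}^*(\bm{y})+\bm{z}-\bm{c})$, $\bm{u}-\sigma\bm{y}$, $\bm{q}-\sigma\bm{z}$ respectively. **Correction step $\mathcal{P}_{\theta,l,\rho,\sigma}$** ($\theta,l,\rho\ge0$). Let $\mathcal{C}_{i,j}$ be the set of nondifferentiable points of $h_{i,j}$, $\mathcal{N}$ the normal cone, $\mathrm{bd}$ the boundary. Let $\hat{\bm{q}}_{i,j}$ be the projection of $\bm{q}_{i,j}$ on $\mathcal{C}_{i,j}$, $\hat{\bm{u}}_i$ that of $\bm{u}_i$ on $\mathrm{bd}(\mathcal{Q}_i)$, $\hat{\bm{z}}_{i,j}$ that of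 $\bm{z}_{i,j}$ on $-\mathrm{bd}(\partial h_{i,j}(\hat{\bm{q}}_{i,j}))$, $\hat{\bm{y}}_i$ that of $\bm{y}_i$ on $-\mathrm{bd}(\mathcal{N}_{\mathcal{Q}_i}(\hat{\bm{u}}_i))$. Let $\bm{x}+\sigma(\mathcal{A}^*(\bm{y})+\bm{z}-\bm{c})$ have eigenvalues $\lambda_i$ with orthonormal eigenvectors $Q_i$; $\bm{\upsilon}=\bm{q}-\hat{\bm{q}}-\sigma(\bm{z}+\hat{\bm{z}})$, $\bm{\vartheta}=\bm{u}-\hat{\bm{u}}-\sigma(\bm{y}+\hat{\bm{y}})$. Then $\mathcal{P}_{\theta,l,\rho,\sigma}(\bm{w})$ is obtained from $\bm{w}$ by replacing $\bm{x}$ with $\bm{x}-\sum_{|\lambda_i|<\theta/2}\lambda_iQ_iQ_i^*$, subtracting $\bm{\vartheta}_i$ from $\bm{u}_i$ for those $i$ with $|\bm{y}_i-\hat{\bm{y}}_i|\le\frac{\rho}{2\sigma}$ and $|\bm{u}_i-\hat{\bm{u}}_i|<\frac{\rho}{2}$, and subtracting $\bm{\upsilon}_{i,j}$ from $\bm{q}_{i,j}$ for those $(i,j)$ with $|\bm{z}_{i,j}-\hat{\bm{z}}_{i,j}|<\frac{l}{2\sigma}$ and $|\bm{q}_{i,j}-\hat{\bm{q}}_{i,j}|<\frac l2$. (Indices for which one of the sets projected onto is empty are not modified.) **Algorithm SSNCP.** Parameters: $\kappa_1\ge1$, $\gamma>1$, $\nu\in(0,1)$, $\beta\in(1/3,1]$,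 $\kappa>0$, a positive integer $\zeta$, an integer $i_{\max}\ge0$, nonnegative sequences $\{\varsigma_k\},\{\theta^k\},\{l^k\},\{\rho^k\}$ with $\sum_k\varsigma_k^2<\infty$, a constant $C_\eta>0$, and an initial point. For $k=1,2,\dots$ (the stopping test is assumed never to be triggered, so an infinite sequence is generated): choose $J^k\in\hat\partial F(\bm{w}^k)$. For $i=0,1,\dots,i_{\max}$ set $\tau_{k,i}=\kappa\gamma^i\|F(\bm{w}^k)\|$, let $\bm{d}^{k,i}$ solve $(J^k+\tau_{k,i}I)\bm{d}^{k,i}=-F(\bm{w}^k)+\bm{\eta}^k$ with inexactness residual $\|\bm{\eta}^k\|\le C_\eta k^{-\beta}$, and set $\bar{\bm{w}}^{k,i}=\bm{w}^k+\bm{d}^{k,i}$, $\tilde{\bm{w}}^{k,i}=\mathcal{P}_{\theta^k,l^k,\rho^k,\sigma}(\bar{\bm{w}}^{k,i})$. If for some $i$ $$\|F(\tilde{\bm{w}}^{k,i})\|\le\nu\max_{\max(1,k-\zeta+1)\le j\le k}\|F(\bm{w}^j)\|+\varsigma_k,\qquad(\mathrm{D1})$$ stop the search over $i$ at the first such $i$ and set $\bm{w}^{k+1}=\tilde{\bm{w}}^{k,i}$. If (D1) fails for all $i\le i_{\max}$, set $\tau_{k,i}=\kappa_1k^\beta$ (D2), solve the same linear system with this value, and set $\bm{w}^{k+1}=\bar{\bm{w}}^{k,i}=\bm{w}^k+\bm{d}^{k,i}$. *)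

theory Defs
  imports "HOL-Analysis.Analysis"
begin

typedef ('n::finite) symmat = "{X :: real^'n^'n. transpose X = X}"
  morphisms mat_of_sym Abs_symmat
  by (rule exI[of _ 0]) (simp add: transpose_def vec_eq_iff)

setup_lifting type_definition_symmat

instantiation symmat :: (finite) real_inner
begin

lift_definition zero_symmat :: "'a symmat" is 0
  by (simp add: transpose_def vec_eq_iff)
lift_definition plus_symmat :: "'a symmat \<Rightarrow> 'a symmat \<Rightarrow> 'a symmat" is "(+)"
  by (simp add: transpose_def vec_eq_iff)
lift_definition minus_symmat :: "'a symmat \<Rightarrow> 'a symmat \<Rightarrow> 'a symmat" is "(-)"
  by (simp add: transpose_def vec_eq_iff)
lift_definition uminus_symmat :: "'a symmat \<Rightarrow> 'a symmat" is "uminus"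
  by (simp add: transpose_def vec_eq_iff)
lift_definition scaleR_symmat :: "real \<Rightarrow> 'a symmat \<Rightarrow> 'a symmat" is "(*\<^sub>R)"
  by (simp add: transpose_def vec_eq_iff)
lift_definition inner_symmat :: "'a symmat \<Rightarrow> 'a symmat \<Rightarrow> real" is "(\<bullet>)" .
lift_definition norm_symmat :: "'a symmat \<Rightarrow> real" is norm .
definition dist_symmat :: "'a symmat \<Rightarrow> 'a symmat \<Rightarrow> real" where
  "dist_symmat X Y = norm (X - Y)"
definition sgn_symmat :: "'a symmat \<Rightarrow> 'a symmat" where
  "sgn_symmat X = inverse (norm X) *\<^sub>R X"
definition uniformity_symmat :: "('a symmat \<times> 'a symmat) filter" where
  "uniformity_symmat = (INF e\<in>{0 <..}. principal {(X, Y). dist X Y < e})"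
definition open_symmat :: "'a symmat set \<Rightarrow> bool" where
  "open_symmat U \<longleftrightarrow> (\<forall>X\<in>U. eventually (\<lambda>(X', Y). X' = X \<longrightarrow> Y \<in> U) uniformity)"

instance
proof
  fix X Y Z :: "'a symmat" and a b :: real
  show "X + Y + Z = X + (Y + Z)" by transfer (rule add.assoc)
  show "X + Y = Y + X" by transfer (rule add.commute)
  show "0 + X = X" by transfer simp
  show "- X + X = 0" by transfer simp
  show "X - Y = X + - Y" by transfer simp
  show "a *\<^sub>R (X + Y) = a *\<^sub>R X + a *\<^sub>R Y" by transfer (rule scaleR_add_right)
  show "(a + b) *\<^sub>R X = a *\<^sub>R X + b *\<^sub>R X" by transfer (rule scaleR_add_left)
  show "a *\<^sub>R b *\<^sub>R X = (a * b) *\<^sub>R X" by transfer simp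
  show "1 *\<^sub>R X = X" by transfer simp
  show "dist X Y = norm (X - Y)" by (rule dist_symmat_def)
  show "sgn X = inverse (norm X) *\<^sub>R X" by (rule sgn_symmat_def)
  show "(uniformity :: ('a symmat \<times> 'a symmat) filter)
      = (INF e\<in>{0 <..}. principal {(X, Y). dist X Y < e})"
    by (rule uniformity_symmat_def)
  show "open U \<longleftrightarrow> (\<forall>X\<in>U. eventually (\<lambda>(X', Y). X' = X \<longrightarrow> Y \<in> U) uniformity)"
    for U :: "'a symmat set"
    by (rule open_symmat_def)
  show "X \<bullet> Y = Y \<bullet> X" by transfer (rule inner_commute)
  show "(X + Y) \<bullet> Z = X \<bullet> Z + Y \<bullet> Z" by transfer (rule inner_add_left)
  show "(a *\<^sub>R X) \<bullet> Y = a * (X \<bullet> Y)" by transfer simp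
  show "0 \<le> X \<bullet> X" by transfer simp
  show "X \<bullet> X = 0 \<longleftrightarrow> X = 0" by transfer simp
  show "norm X = sqrt (X \<bullet> X)" by transfer (rule norm_eq_sqrt_inner)
qed

end

lemma inner_symmat_eq_trace: "X \<bullet> Y = trace (mat_of_sym X ** mat_of_sym Y)"
proof -
  have sym: "mat_of_sym Y $ i $ j = mat_of_sym Y $ j $ i" for i j
  proof -
    have "transpose (mat_of_sym Y) $ i $ j = mat_of_sym Y $ i $ j"
      using mat_of_sym[of Y] by simp
    then show ?thesis
      by (simp only: transpose_def vec_lambda_beta)
  qed
  have "X \<bullet> Y = (\<Sum>i\<in>UNIV. \<Sum>j\<in>UNIV. mat_of_sym X $ i $ j * mat_of_sym Y $ i $ j)"
    by (simp only: inner_symmat.rep_eq inner_vec_def inner_real_def)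
  also have "\<dots> = (\<Sum>i\<in>UNIV. \<Sum>j\<in>UNIV. mat_of_sym X $ i $ j * mat_of_sym Y $ j $ i)"
    by (intro sum.cong refl arg_cong2[where f = "(*)"] sym)
  also have "\<dots> = trace (mat_of_sym X ** mat_of_sym Y)"
    by (simp only: trace_def matrix_matrix_mult_def vec_lambda_beta)
  finally show ?thesis .
qed

lemma ex_symmat_basis:
  "\<exists>B :: 'n::finite symmat set. finite B \<and> B \<noteq> {} \<and>
     (\<forall>X\<in>B. \<forall>Y\<in>B. X \<bullet> Y = (if X = Y then 1 else 0)) \<and>
     (\<forall>X. (\<forall>Y\<in>B. X \<bullet> Y = 0) \<longleftrightarrow> X = 0)"
proof -
  let ?S = "{X :: real^'n^'n. transpose X = X}"
  have "subspace ?S"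
    by (auto simp: subspace_def transpose_def vec_eq_iff)
  then obtain B where B: "B \<subseteq> ?S" "pairwise orthogonal B" "\<And>X. X \<in> B \<Longrightarrow> norm X = 1"
      "independent B" "span B = ?S"
    by (rule orthonormal_basis_subspace) blast
  let ?C = "Abs_symmat ` B"
  have rep: "mat_of_sym (Abs_symmat X) = X" if "X \<in> B" for X
    using B(1) that by (intro Abs_symmat_inverse) auto
  have fin: "finite ?C"
    using B(4) by (simp add: independent_imp_finite)
  have "mat 1 \<in> ?S"
    by (simp add: transpose_mat)
  moreover have "(mat 1 :: real^'n^'n) \<noteq> 0"
    by (auto simp: mat_def vec_eq_iff)
  ultimately have "B \<noteq> {}"
    using B(5) by (metis empty_iff insert_iff span_empty)
  then have ne: "?C \<noteq> {}" by simp
  have orth: "X \<bullet> Y = (if X = Y then 1 else 0)" if "X \<in> ?C" "Y \<in> ?C" for X Y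
  proof -
    from that obtain X' Y' where XY: "X' \<in> B" "Y' \<in> B" "X = Abs_symmat X'" "Y = Abs_symmat Y'"
      by auto
    have "X = Y \<longleftrightarrow> X' = Y'"
      using XY rep by metis
    moreover have "X' \<bullet> X' = 1"
      using B(3)[OF XY(1)] by (simp add: norm_eq_1)
    moreover have "X' \<bullet> Y' = 0" if "X' \<noteq> Y'"
      using B(2) XY that by (auto simp: pairwise_def orthogonal_def)
    ultimately show ?thesis
      using XY rep by (auto simp: inner_symmat.rep_eq)
  qed
  have zero: "(\<forall>Y\<in>?C. X \<bullet> Y = 0) \<longleftrightarrow> X = 0" for X
  proof
    assume "\<forall>Y\<in>?C. X \<bullet> Y = 0"
    then have "\<And>Y. Y \<in> B \<Longrightarrow> orthogonal (mat_of_sym X) Y"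
      by (auto simp: inner_symmat.rep_eq rep orthogonal_def)
    moreover have "mat_of_sym X \<in> span B"
      using B(5) mat_of_sym by auto
    ultimately have "orthogonal (mat_of_sym X) (mat_of_sym X)"
      using orthogonal_to_span by blast
    then show "X = 0"
      by (simp add: orthogonal_def inner_symmat.rep_eq[symmetric])
  qed simp
  show ?thesis
    using fin ne orth zero by (intro exI[of _ ?C]) auto
qed

instantiation symmat :: (finite) euclidean_space
begin

definition Basis_symmat :: "'a symmat set" where
  "Basis_symmat = (SOME B. finite B \<and> B \<noteq> {} \<and>
     (\<forall>X\<in>B. \<forall>Y\<in>B. X \<bullet> Y = (if X = Y then 1 else 0)) \<and>
     (\<forall>X. (\<forall>Y\<in>B. X \<bullet> Y = 0) \<longleftrightarrow> X = 0))"

instance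
proof -
  have *: "finite (Basis :: 'a symmat set) \<and> (Basis :: 'a symmat set) \<noteq> {} \<and>
     (\<forall>X\<in>Basis. \<forall>Y\<in>(Basis :: 'a symmat set). X \<bullet> Y = (if X = Y then 1 else 0)) \<and>
     (\<forall>X :: 'a symmat. (\<forall>Y\<in>Basis. X \<bullet> Y = 0) \<longleftrightarrow> X = 0)"
    unfolding Basis_symmat_def by (rule someI_ex[OF ex_symmat_basis])
  show "OFCLASS('a symmat, euclidean_space_class)"
    by standard (use * in auto)
qed

end

definition entry :: "'n::finite symmat \<Rightarrow> 'n \<Rightarrow> 'n \<Rightarrow> real" where
  "entry X i j = mat_of_sym X $ i $ j"

definition psd_cone :: "'n::finite symmat set" where
  "psd_cone = {X. \<forall>v. 0 \<le> v \<bullet> (mat_of_sym X *v v)}"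

definition delta :: "'a set \<Rightarrow> 'a \<Rightarrow> ereal" where
  "delta S x = (if x \<in> S then 0 else \<infinity>)"

definition fenchel_conjugate :: "('a::real_inner \<Rightarrow> ereal) \<Rightarrow> 'a \<Rightarrow> ereal" where
  "fenchel_conjugate f y = (SUP x. ereal (y \<bullet> x) - f x)"

definition effective_domain :: "('a \<Rightarrow> ereal) \<Rightarrow> 'a set" where
  "effective_domain f = {x. f x < \<infinity>}"

definition prox :: "real \<Rightarrow> ('a::real_normed_vector \<Rightarrow> ereal) \<Rightarrow> 'a \<Rightarrow> 'a" where
  "prox t g x = arg_min (\<lambda>y. g y + ereal (1 / (2 * t) * (norm (y - x))\<^sup>2)) (\<lambda>_. True)"

definition subdifferential :: "('a::real_inner \<Rightarrow> ereal) \<Rightarrow> 'a \<Rightarrow> 'a set" where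
  "subdifferential f x = {v. \<bar>f x\<bar> \<noteq> \<infinity> \<and> (\<forall>y. f x + ereal (v \<bullet> (y - x)) \<le> f y)}"

definition normal_cone :: "'a::real_inner set \<Rightarrow> 'a \<Rightarrow> 'a set" where
  "normal_cone S x = {v. x \<in> S \<and> (\<forall>y\<in>S. v \<bullet> (y - x) \<le> 0)}"

text \<open>Nondifferentiability is only considered at points of the effective domain: for the
  indicator of a closed interval it is the set of finite endpoints, not the exterior where
  the function is identically infinite.\<close>

definition nondiff_points :: "(real \<Rightarrow> ereal) \<Rightarrow> real set" where
  "nondiff_points f = {t \<in> effective_domain f.
     \<not> (\<exists>g. (\<forall>\<^sub>F s in nhds t. f s = ereal (g s)) \<and> g differentiable (at t))}"

text \<open>Clarke's generalized Jacobian: the convex hull of all limits of derivatives taken at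
  points of differentiability that approach the given point.\<close>

definition clarke_subdifferential ::
    "('a::real_normed_vector \<Rightarrow> 'b::real_normed_vector) \<Rightarrow> 'a \<Rightarrow> ('a \<Rightarrow>\<^sub>L 'b) set" where
  "clarke_subdifferential f x = convex hull
     {V. \<exists>X D. X \<longlonglongrightarrow> x \<and> (\<forall>k. (f has_derivative blinfun_apply (D k)) (at (X k))) \<and> D \<longlonglongrightarrow> V}"

text \<open>The nearest points need not be unique when the set is not convex (two endpoints).\<close>

definition is_projection :: "'a::metric_space set \<Rightarrow> 'a \<Rightarrow> 'a \<Rightarrow> bool" where
  "is_projection S a p \<longleftrightarrow> p \<in> S \<and> (\<forall>y\<in>S. dist a p \<le> dist a y)"

definition box :: "('m::finite \<Rightarrow> real set) \<Rightarrow> (real^'m) set" where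
  "box Q = {u. \<forall>i. u $ i \<in> Q i}"

text \<open>The function h is given by the family C of sets whose indicators are its entries.
  Neither C i j = C j i nor boundedness is imposed.\<close>

definition hfun :: "('n::finite \<Rightarrow> 'n \<Rightarrow> real set) \<Rightarrow> 'n symmat \<Rightarrow> ereal" where
  "hfun C x = (\<Sum>i\<in>UNIV. \<Sum>j\<in>UNIV. delta (C i j) (entry x i j))"

definition dual_feasible ::
    "('n::finite symmat \<Rightarrow> real^'m::finite) \<Rightarrow> 'n symmat \<Rightarrow> real^'m \<Rightarrow> 'n symmat \<Rightarrow> 'n symmat \<Rightarrow> bool" where
  "dual_feasible A c y z s \<longleftrightarrow> adjoint A y + s + z = c"

definition dual_objective ::
    "('m::finite \<Rightarrow> real set) \<Rightarrow> ('n::finite \<Rightarrow> 'n \<Rightarrow> real set) \<Rightarrow>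
     real^'m \<Rightarrow> 'n symmat \<Rightarrow> 'n symmat \<Rightarrow> ereal" where
  "dual_objective Q C y z s =
     fenchel_conjugate (hfun C) (- z) + fenchel_conjugate (delta (box Q)) (- y)
       + fenchel_conjugate (delta psd_cone) (- s)"

definition dual_optimal ::
    "('n::finite symmat \<Rightarrow> real^'m::finite) \<Rightarrow> 'n symmat \<Rightarrow> ('m \<Rightarrow> real set) \<Rightarrow>
     ('n \<Rightarrow> 'n \<Rightarrow> real set) \<Rightarrow> real^'m \<Rightarrow> 'n symmat \<Rightarrow> 'n symmat \<Rightarrow> bool" where
  "dual_optimal A c Q C y z s \<longleftrightarrow> dual_feasible A c y z s \<and>
     (\<forall>y' z' s'. dual_feasible A c y' z' s' \<longrightarrow>
        dual_objective Q C y z s \<le> dual_objective Q C y' z' s')"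

definition dual_slater ::
    "('n::finite symmat \<Rightarrow> real^'m::finite) \<Rightarrow> 'n symmat \<Rightarrow> ('m \<Rightarrow> real set) \<Rightarrow>
     ('n \<Rightarrow> 'n \<Rightarrow> real set) \<Rightarrow> bool" where
  "dual_slater A c Q C \<longleftrightarrow> (\<exists>y z s. dual_feasible A c y z s \<and>
     - y \<in> rel_interior (effective_domain (fenchel_conjugate (delta (box Q)))) \<and>
     - s \<in> rel_interior (effective_domain (fenchel_conjugate (delta (psd_cone :: 'n symmat set)))) \<and>
     - z \<in> rel_interior (effective_domain (fenchel_conjugate (hfun C))))"

text \<open>A state is a tuple (y, z, x, u, q).\<close>

type_synonym ('m, 'n) state =
  "(real^'m) \<times> 'n symmat \<times> 'n symmat \<times> (real^'m) \<times> 'n symmat"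

definition residual ::
    "('n::finite symmat \<Rightarrow> real^'m::finite) \<Rightarrow> 'n symmat \<Rightarrow> ('m \<Rightarrow> real set) \<Rightarrow>
     ('n \<Rightarrow> 'n \<Rightarrow> real set) \<Rightarrow> real \<Rightarrow> ('m, 'n) state \<Rightarrow> ('m, 'n) state" where
  "residual A c Q C \<sigma> = (\<lambda>(y, z, x, u, q).
     let PK = closest_point psd_cone (x + \<sigma> *\<^sub>R (adjoint A y + z - c));
         PQ = closest_point (box Q) (u - \<sigma> *\<^sub>R y);
         Ph = prox \<sigma> (hfun C) (q - \<sigma> *\<^sub>R z)
     in (A PK - PQ, PK - Ph,
         (1 / \<sigma>) *\<^sub>R (x - PK), (1 / \<sigma>) *\<^sub>R (u - PQ), (1 / \<sigma>) *\<^sub>R (q - Ph)))"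

definition H1 ::
    "('n::finite symmat \<Rightarrow> real^'m::finite) \<Rightarrow> real \<Rightarrow>
     ('n symmat \<Rightarrow>\<^sub>L 'n symmat) \<Rightarrow> ((real^'m) \<Rightarrow>\<^sub>L (real^'m)) \<Rightarrow> ('n symmat \<Rightarrow>\<^sub>L 'n symmat) \<Rightarrow>
     (real^'m) \<times> 'n symmat \<Rightarrow> (real^'m) \<times> 'n symmat" where
  "H1 A \<sigma> DK DQ Dh = (\<lambda>(y, z).
     (\<sigma> *\<^sub>R (DQ y + A (DK (adjoint A y))) + \<sigma> *\<^sub>R A (DK z),
      \<sigma> *\<^sub>R DK (adjoint A y) + \<sigma> *\<^sub>R (Dh z + DK z)))"

definition H2 ::
    "('n::finite symmat \<Rightarrow> real^'m::finite) \<Rightarrow>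
     ('n symmat \<Rightarrow>\<^sub>L 'n symmat) \<Rightarrow> ((real^'m) \<Rightarrow>\<^sub>L (real^'m)) \<Rightarrow> ('n symmat \<Rightarrow>\<^sub>L 'n symmat) \<Rightarrow>
     'n symmat \<times> (real^'m) \<times> 'n symmat \<Rightarrow> (real^'m) \<times> 'n symmat" where
  "H2 A DK DQ Dh = (\<lambda>(x, u, q). (A (DK x) - DQ u, DK x - Dh q))"

definition H3 ::
    "real \<Rightarrow> ('n::finite symmat \<Rightarrow>\<^sub>L 'n symmat) \<Rightarrow> ((real^'m::finite) \<Rightarrow>\<^sub>L (real^'m)) \<Rightarrow>
     ('n symmat \<Rightarrow>\<^sub>L 'n symmat) \<Rightarrow>
     'n symmat \<times> (real^'m) \<times> 'n symmat \<Rightarrow> 'n symmat \<times> (real^'m) \<times> 'n symmat" where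
  "H3 \<sigma> DK DQ Dh = (\<lambda>(x, u, q).
     ((1 / \<sigma>) *\<^sub>R (x - DK x), (1 / \<sigma>) *\<^sub>R (u - DQ u), (1 / \<sigma>) *\<^sub>R (q - Dh q)))"

definition jacobian_operator ::
    "('n::finite symmat \<Rightarrow> real^'m::finite) \<Rightarrow> real \<Rightarrow>
     ('n symmat \<Rightarrow>\<^sub>L 'n symmat) \<Rightarrow> ((real^'m) \<Rightarrow>\<^sub>L (real^'m)) \<Rightarrow> ('n symmat \<Rightarrow>\<^sub>L 'n symmat) \<Rightarrow>
     ('m, 'n) state \<Rightarrow> ('m, 'n) state" where
  "jacobian_operator A \<sigma> DK DQ Dh = (\<lambda>(y, z, x, u, q).
     let (y', z') = H1 A \<sigma> DK DQ Dh (y, z) + H2 A DK DQ Dh (x, u, q);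
         (x', u', q') = - adjoint (H2 A DK DQ Dh) (y, z) + H3 \<sigma> DK DQ Dh (x, u, q)
     in (y', z', x', u', q'))"

definition generalized_jacobian ::
    "('n::finite symmat \<Rightarrow> real^'m::finite) \<Rightarrow> 'n symmat \<Rightarrow> ('m \<Rightarrow> real set) \<Rightarrow>
     ('n \<Rightarrow> 'n \<Rightarrow> real set) \<Rightarrow> real \<Rightarrow> ('m, 'n) state \<Rightarrow>
     (('m, 'n) state \<Rightarrow> ('m, 'n) state) set" where
  "generalized_jacobian A c Q C \<sigma> = (\<lambda>(y, z, x, u, q).
     {jacobian_operator A \<sigma> DK DQ Dh | DK DQ Dh.
        DK \<in> clarke_subdifferential (closest_point psd_cone)
               (x + \<sigma> *\<^sub>R (adjoint A y + z - c)) \<and>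
        DQ \<in> clarke_subdifferential (closest_point (box Q)) (u - \<sigma> *\<^sub>R y) \<and>
        Dh \<in> clarke_subdifferential (prox \<sigma> (hfun C)) (q - \<sigma> *\<^sub>R z)})"

text \<open>The argument a is the matrix whose small eigenvalues are removed from x.\<close>

definition correct_x :: "real \<Rightarrow> 'n::finite symmat \<Rightarrow> 'n symmat \<Rightarrow> 'n symmat \<Rightarrow> bool" where
  "correct_x \<theta> a x x' \<longleftrightarrow> (\<exists>(lam :: 'n \<Rightarrow> real) (V :: 'n \<Rightarrow> real^'n).
     (\<forall>i j. V i \<bullet> V j = (if i = j then 1 else 0)) \<and>
     (\<forall>i. mat_of_sym a *v V i = lam i *\<^sub>R V i) \<and>
     mat_of_sym x' = mat_of_sym x
       - (\<Sum>i | \<bar>lam i\<bar> < \<theta> / 2. lam i *\<^sub>R (\<chi> r s. V i $ r * V i $ s)))"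

definition correct_u ::
    "('m::finite \<Rightarrow> real set) \<Rightarrow> real \<Rightarrow> real \<Rightarrow> real^'m \<Rightarrow> real^'m \<Rightarrow> real^'m \<Rightarrow> bool" where
  "correct_u Q \<sigma> \<rho> y u u' \<longleftrightarrow> (\<exists>uh yh :: real^'m. \<forall>i.
     let B = frontier (Q i); N = frontier (normal_cone (Q i) (uh $ i)) in
     if B = {} then u' $ i = u $ i
     else is_projection B (u $ i) (uh $ i) \<and>
       (if N = {} then u' $ i = u $ i
        else is_projection (uminus ` N) (y $ i) (yh $ i) \<and>
          (if \<bar>y $ i - yh $ i\<bar> \<le> \<rho> / (2 * \<sigma>) \<and> \<bar>u $ i - uh $ i\<bar> < \<rho> / 2
           then u' $ i = u $ i - (u $ i - uh $ i - \<sigma> * (y $ i + yh $ i))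
           else u' $ i = u $ i)))"

definition correct_q ::
    "('n::finite \<Rightarrow> 'n \<Rightarrow> real set) \<Rightarrow> real \<Rightarrow> real \<Rightarrow> 'n symmat \<Rightarrow> 'n symmat \<Rightarrow> 'n symmat \<Rightarrow> bool" where
  "correct_q C \<sigma> l z q q' \<longleftrightarrow> (\<exists>qh zh :: 'n symmat. \<forall>i j.
     let B = nondiff_points (delta (C i j));
         N = frontier (subdifferential (delta (C i j)) (entry qh i j)) in
     if B = {} then entry q' i j = entry q i j
     else is_projection B (entry q i j) (entry qh i j) \<and>
       (if N = {} then entry q' i j = entry q i j
        else is_projection (uminus ` N) (entry z i j) (entry zh i j) \<and>
          (if \<bar>entry z i j - entry zh i j\<bar> < l / (2 * \<sigma>) \<and> \<bar>entry q i j - entry qh i j\<bar> < l / 2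
           then entry q' i j = entry q i j
             - (entry q i j - entry qh i j - \<sigma> * (entry z i j + entry zh i j))
           else entry q' i j = entry q i j)))"

text \<open>The correction is a relation, so that every choice of nearest points is admitted where
  there is a tie. It does not depend on the choice of the eigenbasis.\<close>

definition correction_step ::
    "('n::finite symmat \<Rightarrow> real^'m::finite) \<Rightarrow> 'n symmat \<Rightarrow> ('m \<Rightarrow> real set) \<Rightarrow>
     ('n \<Rightarrow> 'n \<Rightarrow> real set) \<Rightarrow> real \<Rightarrow> real \<Rightarrow> real \<Rightarrow> real \<Rightarrow>
     ('m, 'n) state \<Rightarrow> ('m, 'n) state \<Rightarrow> bool" where
  "correction_step A c Q C \<theta> l \<rho> \<sigma> = (\<lambda>(y, z, x, u, q) w'. \<exists>x' u' q'.
     w' = (y, z, x', u', q') \<and>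
     correct_x \<theta> (x + \<sigma> *\<^sub>R (adjoint A y + z - c)) x x' \<and>
     correct_u Q \<sigma> \<rho> y u u' \<and>
     correct_q C \<sigma> l z q q')"

definition inexact_solution ::
    "('a::real_normed_vector \<Rightarrow> 'a) \<Rightarrow> real \<Rightarrow> 'a \<Rightarrow> real \<Rightarrow> 'a \<Rightarrow> bool" where
  "inexact_solution J \<tau> r \<epsilon> d \<longleftrightarrow> (\<exists>\<eta>. norm \<eta> \<le> \<epsilon> \<and> J d + \<tau> *\<^sub>R d = - r + \<eta>)"

text \<open>The iterates are w 1, w 2, ...; the value w 0 is not used. Trial points v j are only
  computed up to the first accepted one.\<close>

definition ssncp_sequence ::
    "('n::finite symmat \<Rightarrow> real^'m::finite) \<Rightarrow> 'n symmat \<Rightarrow> ('m \<Rightarrow> real set) \<Rightarrow>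
     ('n \<Rightarrow> 'n \<Rightarrow> real set) \<Rightarrow> real \<Rightarrow>
     real \<Rightarrow> real \<Rightarrow> real \<Rightarrow> real \<Rightarrow> real \<Rightarrow> nat \<Rightarrow> nat \<Rightarrow>
     (nat \<Rightarrow> real) \<Rightarrow> (nat \<Rightarrow> real) \<Rightarrow> (nat \<Rightarrow> real) \<Rightarrow> (nat \<Rightarrow> real) \<Rightarrow> real \<Rightarrow>
     (nat \<Rightarrow> ('m, 'n) state) \<Rightarrow> bool" where
  "ssncp_sequence A c Q C \<sigma> \<kappa>\<^sub>1 \<gamma> \<nu> \<beta> \<kappa> \<zeta> imax vs \<theta> l \<rho> C\<^sub>\<eta> w \<longleftrightarrow>
     (\<forall>k\<ge>1. \<exists>J \<in> generalized_jacobian A c Q C \<sigma> (w k).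
        let F = residual A c Q C \<sigma>;
            solves = (\<lambda>\<tau> d. inexact_solution J \<tau> (F (w k)) (C\<^sub>\<eta> * real k powr (- \<beta>)) d);
            trial = (\<lambda>i v. \<exists>d. solves (\<kappa> * \<gamma> ^ i * norm (F (w k))) d \<and>
                       correction_step A c Q C (\<theta> k) (l k) (\<rho> k) \<sigma> (w k + d) v);
            D1 = (\<lambda>v. norm (F v) \<le>
                    \<nu> * (MAX j\<in>{max 1 (k + 1 - \<zeta>)..k}. norm (F (w j))) + vs k)
        in (\<exists>v. \<exists>i\<le>imax. (\<forall>j\<le>i. trial j (v j)) \<and> (\<forall>j<i. \<not> D1 (v j)) \<and> D1 (v i) \<and>
              w (Suc k) = v i) \<or>
           (\<exists>v d. (\<forall>i\<le>imax. trial i (v i) \<and> \<not> D1 (v i)) \<and>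
              solves (\<kappa>\<^sub>1 * real k powr \<beta>) d \<and> w (Suc k) = w k + d))"

end

theory Submission
  imports Defs
begin

text \<open>
  Put \<open>S = psd_cone \<times> box Q \<times> {x. h(x) = 0}\<close>, \<open>Y = (y, z)\<close>, \<open>X = (x, u, q)\<close>,
  \<open>B (x, u, q) = (A x - u, x - q)\<close> and \<open>P = \<Pi>\<^sub>S (X + \<sigma> (B\<^sup>* Y - b))\<close> with \<open>b = (c, 0, 0)\<close>.
  Then \<open>F = (B P, (X - P) / \<sigma>)\<close>, which is monotone, and the standing assumption yields a zero of
  \<open>F\<close>.  Since elements of the generalized Jacobian are uniformly bounded, a step of type (D2) with
  \<open>t = 1 / (\<kappa>\<^sub>1 k\<^sup>\<beta>)\<close> is a forward Euler step for \<open>-F\<close> of length \<open>t\<close> with a perturbation of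
  size \<open>O(t (1 + \<bar>F\<bar>))\<close>; no other property of the Jacobian is needed.

  As \<open>\<beta>\<close> may be below 1/2, only \<open>\<Sum> t\<^sup>3 < \<infinity>\<close> is available, so \<open>\<bar>F\<bar>\<^sup>2\<close> may only grow by
  multiples of \<open>t N\<^sup>2\<close>, with \<open>N\<close> the size of the perturbation.  Monotonicity bounds the growth by
  \<open>t N \<bar>B (X - P)\<bar>\<close> up to such terms, and a Lyapunov function shows that \<open>\<Sum> t \<bar>B (X - P)\<bar>\<^sup>2\<close> is
  at most a multiple of \<open>1 + \<bar>F\<bar>\<^sup>2\<close> at the start of a run of (D2) steps, independently of where
  the run starts.  Hence \<open>\<bar>F\<bar>\<close> is nonincreasing along such runs up to a factor and a summand that
  tend to 1 and 0.  If (D1) happens infinitely often, its contraction factor \<open>\<nu>\<close> then forces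
  \<open>F \<longlongrightarrow> 0\<close>.  Otherwise all steps are eventually of type (D2); the distance to a zero of
  \<open>F\<close> is \<open>o(\<surd>T)\<close> after total time \<open>T = \<Sum> t\<close>, which makes the time averages of
  \<open>\<bar>X - P\<bar>\<^sup>2\<close> and then of \<open>\<bar>B P\<bar>\<^sup>2\<close> tend to 0.
\<close>

section \<open>Multipliers of the dual problem\<close>

text \<open>For a merely monotone Lipschitz field an Euler step can multiply |F|^2 by 1 + O(t^2), as
  a rotation shows, and sum t^2 may diverge here; so the form of F has to be used. In one step the
  change of P is minus the change dR of R = X - P, up to O(t), and monotonicity of the normal cone
  turns this into a gain of order |dR|^2 / t in the energy |F|^2 / 2. The gain absorbs all
  second-order terms in dR. Terms with B R survive, and their sum is not controlled by the energy.
  Their decay is found in the inner product of B P with B (Xt - P), where Xt is a point of S that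
  trails X: its other first-order changes are cancelled by a term with the normal vector and by the
  energy itself. If (D2) prevails, the bound o(sqrt T) for the distance comes from (sum t^2)^2 <=
  (sum t) (sum t^3) with a small last factor. Monotonicity yields no square of B P; its average is
  obtained by summation by parts, since t B P is the decrease of Y up to the perturbation, and since
  the total variation of B P is O(sqrt T).\<close>

definition barrier_cone :: "'a::real_inner set \<Rightarrow> 'a set" where
  "barrier_cone S = {\<xi>. \<exists>r. \<forall>p\<in>S. \<xi> \<bullet> p \<le> r}"

lemma convex_barrier_cone: "convex (barrier_cone S)"
proof (rule convexI)
  fix x y :: 'a and u v :: real
  assume "x \<in> barrier_cone S" "y \<in> barrier_cone S" and uv: "0 \<le> u" "0 \<le> v"
  then obtain r s where "\<And>p. p \<in> S \<Longrightarrow> x \<bullet> p \<le> r" "\<And>p. p \<in> S \<Longrightarrow> y \<bullet> p \<le> s"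
    unfolding barrier_cone_def by blast
  then have "(u *\<^sub>R x + v *\<^sub>R y) \<bullet> p \<le> u * r + v * s" if "p \<in> S" for p
    using uv that by (simp add: inner_add_left add_mono mult_left_mono)
  then show "u *\<^sub>R x + v *\<^sub>R y \<in> barrier_cone S"
    unfolding barrier_cone_def by blast
qed

lemma rel_interior_prolong:
  fixes S :: "'a::euclidean_space set"
  assumes "convex S" "z \<in> rel_interior S" "x \<in> S"
  obtains e where "e > 1" "(1 - e) *\<^sub>R x + e *\<^sub>R z \<in> S"
  using convex_rel_interior_iff[of S z] assms by blast

text \<open>Bipolar argument: a point outside is cut off by a hyperplane. The real bounds
  \<open>r\<close> stand in for the support function, which may be infinite. This is how the
  multiplier is recognized as a point of \<open>S\<close>.\<close>

lemma mem_closed_convex_of_support: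
  fixes S :: "'a::euclidean_space set"
  assumes "closed S" "convex S" and supp: "\<And>\<xi> r. (\<And>p. p \<in> S \<Longrightarrow> \<xi> \<bullet> p \<le> r) \<Longrightarrow> \<xi> \<bullet> x \<le> r"
  shows "x \<in> S"
proof (rule ccontr)
  assume "x \<notin> S"
  then obtain a \<beta> where "a \<bullet> x < \<beta>" "\<And>p. p \<in> S \<Longrightarrow> a \<bullet> p > \<beta>"
    using separating_hyperplane_closed_point[OF assms(2,1)] by blast
  then have "(- a) \<bullet> x \<le> - \<beta>"
    by (intro supp) (simp add: less_imp_le)
  with \<open>a \<bullet> x < \<beta>\<close> show False by simp
qed

text \<open>The multiplier is the non-vertical supporting hyperplane, at the optimal value, of the
  epigraph of the value function that perturbs the affine constraint.\<close>

lemma dual_optimum_multiplier: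
  fixes S :: "'e::euclidean_space set" and B :: "'e \<Rightarrow> 'g::euclidean_space"
  assumes S: "closed S" "convex S" "S \<noteq> {}" and B: "linear B"
    and slater: "adjoint B Y0 - b \<in> rel_interior (barrier_cone S)"
    and opt: "\<And>Y r. (\<And>p. p \<in> S \<Longrightarrow> (adjoint B Y - b) \<bullet> p \<le> r) \<Longrightarrow>
                (\<And>p. p \<in> S \<Longrightarrow> (adjoint B Y' - b) \<bullet> p \<le> r)"
  obtains P where "P \<in> S" "B P = 0" "\<And>p. p \<in> S \<Longrightarrow> (adjoint B Y' - b) \<bullet> (p - P) \<le> 0"
proof -
  define \<xi> where "\<xi> Y = adjoint B Y - b" for Y
  \<comment> \<open>The first component is the deviation of the argument of the support function
    from the affine family \<open>\<xi> Y\<close>; as \<open>Y\<close> is free, it is minimized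
    out.\<close>
  define W where "W = {(\<eta> - \<xi> Y, r) | \<eta> Y r. \<forall>p\<in>S. \<eta> \<bullet> p \<le> r}"
  have lin: "linear (adjoint B)"
    by (rule adjoint_linear[OF B])
  have \<xi>_comb: "\<xi> (u *\<^sub>R Y1 + v *\<^sub>R Y2) = u *\<^sub>R \<xi> Y1 + v *\<^sub>R \<xi> Y2" if "u + v = 1" for u v Y1 Y2
  proof -
    have "v = 1 - u" using that by simp
    show ?thesis
      unfolding \<open>v = 1 - u\<close>
      by (simp add: \<xi>_def linear_add[OF lin] linear_diff[OF lin] linear_cmul[OF lin] scaleR_diff_left scaleR_diff_right)
  qed
  have "convex W"
  proof (rule convexI)
    fix x y and u v :: real assume "x \<in> W" "y \<in> W" and uv: "0 \<le> u" "0 \<le> v" "u + v = 1"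
    then obtain \<eta>1 Y1 r1 \<eta>2 Y2 r2 where
      x: "x = (\<eta>1 - \<xi> Y1, r1)" "\<And>p. p \<in> S \<Longrightarrow> \<eta>1 \<bullet> p \<le> r1" and
      y: "y = (\<eta>2 - \<xi> Y2, r2)" "\<And>p. p \<in> S \<Longrightarrow> \<eta>2 \<bullet> p \<le> r2"
      unfolding W_def by blast
    have "(u *\<^sub>R \<eta>1 + v *\<^sub>R \<eta>2) \<bullet> p \<le> u * r1 + v * r2" if "p \<in> S" for p
      using uv x(2) y(2) that by (simp add: inner_add_left add_mono mult_left_mono)
    moreover have "u *\<^sub>R x + v *\<^sub>R y =
        ((u *\<^sub>R \<eta>1 + v *\<^sub>R \<eta>2) - \<xi> (u *\<^sub>R Y1 + v *\<^sub>R Y2), u * r1 + v * r2)"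
      by (simp add: x y \<xi>_comb[OF uv(3)] algebra_simps)
    ultimately show "u *\<^sub>R x + v *\<^sub>R y \<in> W"
      unfolding W_def by blast
  qed
  obtain r0 where r0: "\<And>p. p \<in> S \<Longrightarrow> \<xi> Y0 \<bullet> p \<le> r0"
    using slater rel_interior_subset unfolding \<xi>_def barrier_cone_def by fastforce
  have r0': "\<xi> Y' \<bullet> p \<le> r0" if "p \<in> S" for p
    using opt[of Y0 r0 p] r0 that unfolding \<xi>_def by blast
  define \<alpha> where "\<alpha> = (SUP p\<in>S. \<xi> Y' \<bullet> p)"
  have bdd: "bdd_above ((\<lambda>p. \<xi> Y' \<bullet> p) ` S)"
    using r0' by (intro bdd_aboveI[of _ r0]) auto
  have \<alpha>_ub: "\<xi> Y' \<bullet> p \<le> \<alpha>" if "p \<in> S" for p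
    unfolding \<alpha>_def using bdd that by (rule cSUP_upper2) simp
  have \<alpha>_opt: "\<alpha> \<le> r" if "\<And>p. p \<in> S \<Longrightarrow> \<xi> Y \<bullet> p \<le> r" for Y r
    unfolding \<alpha>_def using S(3) opt[of Y r] that unfolding \<xi>_def by (intro cSUP_least) auto
  have in_W: "(0, r) \<in> W" if "\<alpha> \<le> r" for r
  proof -
    have "\<forall>p\<in>S. \<xi> Y' \<bullet> p \<le> r"
      using \<alpha>_ub that by force
    then have "(\<xi> Y' - \<xi> Y', r) \<in> W"
      unfolding W_def by blast
    then show ?thesis by simp
  qed
  \<comment> \<open>Otherwise the segment from \<open>(0, \<alpha> + 1)\<close> could be prolonged
    beyond \<open>(0, \<alpha>)\<close> inside \<open>W\<close>, giving a dual value below the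
    optimum.\<close>
  have "(0, \<alpha>) \<notin> rel_interior W"
  proof
    assume "(0, \<alpha>) \<in> rel_interior W"
    moreover have "(0, \<alpha> + 1) \<in> W" by (rule in_W) simp
    ultimately obtain e where e: "e > 1" "(1 - e) *\<^sub>R (0, \<alpha> + 1) + e *\<^sub>R (0, \<alpha>) \<in> W"
      using rel_interior_prolong[OF \<open>convex W\<close>] by metis
    then have "(0, \<alpha> + 1 - e) \<in> W" by (simp add: algebra_simps)
    then obtain Y where "\<forall>p\<in>S. \<xi> Y \<bullet> p \<le> \<alpha> + 1 - e"
      unfolding W_def by auto
    then have "\<alpha> \<le> \<alpha> + 1 - e" by (intro \<alpha>_opt) auto
    with e show False by simp
  qed
  moreover have "(0, \<alpha>) \<in> W" by (rule in_W) simp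
  ultimately obtain h where
    h: "\<And>y. y \<in> W \<Longrightarrow> h \<bullet> (0, \<alpha>) \<le> h \<bullet> y" "\<And>y. y \<in> rel_interior W \<Longrightarrow> h \<bullet> (0, \<alpha>) < h \<bullet> y"
    using supporting_hyperplane_rel_boundary[OF \<open>convex W\<close>] by metis
  obtain a \<mu> where h_eq: "h = (a, \<mu>)" by (cases h)
  have "\<mu> \<ge> 0"
    using h(1)[OF in_W[of "\<alpha> + 1"]] by (simp add: h_eq algebra_simps)
  \<comment> \<open>The Slater point excludes a vertical hyperplane. Such a hyperplane would be
    positive on the deviation of a relative interior point of \<open>W\<close>; prolonging the
    segment from \<open>\<eta>\<close> through \<open>\<xi> Y0\<close> in the barrier cone gives
    this deviation times \<open>1 - e < 0\<close>, on the wrong side.\<close>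
  moreover have "\<mu> \<noteq> 0"
  proof
    assume "\<mu> = 0"
    obtain y where y: "y \<in> rel_interior W"
      using rel_interior_eq_empty[OF \<open>convex W\<close>] \<open>(0, \<alpha>) \<in> W\<close> by auto
    then have "y \<in> W" using rel_interior_subset by blast
    then obtain \<eta> Y r where y_eq: "y = (\<eta> - \<xi> Y, r)" and \<eta>: "\<forall>p\<in>S. \<eta> \<bullet> p \<le> r"
      unfolding W_def by blast
    have pos: "a \<bullet> (\<eta> - \<xi> Y) > 0"
      using h(2)[OF y] by (simp add: h_eq y_eq \<open>\<mu> = 0\<close>)
    have "\<eta> \<in> barrier_cone S"
      using \<eta> unfolding barrier_cone_def by blast
    then obtain e where e: "e > 1" "(1 - e) *\<^sub>R \<eta> + e *\<^sub>R \<xi> Y0 \<in> barrier_cone S"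
      using rel_interior_prolong[OF convex_barrier_cone slater] unfolding \<xi>_def by metis
    then obtain s where "\<forall>p\<in>S. ((1 - e) *\<^sub>R \<eta> + e *\<^sub>R \<xi> Y0) \<bullet> p \<le> s"
      unfolding barrier_cone_def by blast
    then have "((1 - e) *\<^sub>R \<eta> + e *\<^sub>R \<xi> Y0 - \<xi> ((1 - e) *\<^sub>R Y + e *\<^sub>R Y0), s) \<in> W"
      unfolding W_def by blast
    moreover have "\<xi> ((1 - e) *\<^sub>R Y + e *\<^sub>R Y0) = (1 - e) *\<^sub>R \<xi> Y + e *\<^sub>R \<xi> Y0"
      by (rule \<xi>_comb) simp
    ultimately have "((1 - e) *\<^sub>R (\<eta> - \<xi> Y), s) \<in> W"
      by (simp add: scaleR_diff_right)
    from h(1)[OF this] have "0 \<le> (1 - e) * (a \<bullet> (\<eta> - \<xi> Y))"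
      by (simp add: h_eq \<open>\<mu> = 0\<close>)
    with pos e(1) show False
      by (simp add: zero_le_mult_iff)
  qed
  ultimately have "\<mu> > 0" by simp
  \<comment> \<open>A subgradient of the value function at 0, as \<open>key\<close>
    expresses.\<close>
  define P where "P = - (a /\<^sub>R \<mu>)"
  have key: "P \<bullet> (\<eta> - \<xi> Y) \<le> r - \<alpha>" if "\<And>p. p \<in> S \<Longrightarrow> \<eta> \<bullet> p \<le> r" for \<eta> Y r
  proof -
    have "(\<eta> - \<xi> Y, r) \<in> W"
      unfolding W_def using that by blast
    from h(1)[OF this] have "\<mu> * \<alpha> \<le> a \<bullet> (\<eta> - \<xi> Y) + \<mu> * r"
      by (simp add: h_eq)
    then have "(- (a \<bullet> (\<eta> - \<xi> Y))) / \<mu> \<le> r - \<alpha>"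
      using \<open>\<mu> > 0\<close> by (simp add: field_simps)
    then show ?thesis by (simp add: P_def field_simps)
  qed
  have adj: "P \<bullet> adjoint B Y = B P \<bullet> Y" for Y
    by (simp add: adjoint_clauses[OF B])
  \<comment> \<open>A linear function of the unrestricted \<open>Y\<close> that is bounded on one
    side vanishes; \<open>?Y\<close> exceeds the bound by 1.\<close>
  have "B P = 0"
  proof (rule ccontr)
    assume "B P \<noteq> 0"
    have le: "- (B P \<bullet> Y) \<le> P \<bullet> (- b - \<xi> Y')" for Y
      using key[of "\<xi> Y'" \<alpha> Y] \<alpha>_ub by (auto simp: \<xi>_def inner_diff_right adj)
    let ?Y = "- (((P \<bullet> (- b - \<xi> Y') + 1) / (B P \<bullet> B P)) *\<^sub>R B P)"
    have "- (B P \<bullet> ?Y) = P \<bullet> (- b - \<xi> Y') + 1"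
      using \<open>B P \<noteq> 0\<close> by simp
    with le[of ?Y] show False by simp
  qed
  have P\<xi>: "P \<bullet> \<xi> Y = P \<bullet> \<xi> Y'" for Y
    using \<open>B P = 0\<close> by (simp add: \<xi>_def inner_diff_right adj)
  have "\<alpha> \<le> P \<bullet> \<xi> Y'"
    using key[of 0 0 Y'] by (simp add: inner_diff_right)
  \<comment> \<open>A bound on \<open>S\<close> may be multiplied by any \<open>s \<ge> 0\<close>;
    for large \<open>s\<close> the fixed terms of \<open>key\<close> lose their weight.\<close>
  have supp: "\<eta> \<bullet> P \<le> r" if \<eta>: "\<And>p. p \<in> S \<Longrightarrow> \<eta> \<bullet> p \<le> r" for \<eta> r
  proof (rule ccontr)
    assume "\<not> \<eta> \<bullet> P \<le> r"
    then have pos: "P \<bullet> \<eta> - r > 0" by (simp add: inner_commute)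
    have "s * (P \<bullet> \<eta> - r) \<le> P \<bullet> \<xi> Y' - \<alpha>" if "s \<ge> 0" for s
    proof -
      have "P \<bullet> (s *\<^sub>R \<eta> - \<xi> Y') \<le> s * r - \<alpha>"
        using \<eta> that by (intro key) (simp add: mult_left_mono)
      then show ?thesis by (simp add: inner_diff_right algebra_simps)
    qed
    from this[of "(P \<bullet> \<xi> Y' - \<alpha> + 1) / (P \<bullet> \<eta> - r)"] show False
      using pos \<open>\<alpha> \<le> P \<bullet> \<xi> Y'\<close> by (simp add: divide_nonneg_pos)
  qed
  have "P \<in> S"
    by (rule mem_closed_convex_of_support[OF S(1,2) supp])
  moreover have "(adjoint B Y' - b) \<bullet> (p - P) \<le> 0" if "p \<in> S" for p
    using \<alpha>_ub[OF that] \<open>\<alpha> \<le> P \<bullet> \<xi> Y'\<close> by (simp add: \<xi>_def inner_diff_left inner_diff_right inner_commute)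
  ultimately show ?thesis
    using \<open>B P = 0\<close> that by blast
qed

section \<open>Perturbed Euler steps\<close>

lemma young: "x * y \<le> a * x\<^sup>2 + y\<^sup>2 / (4 * a)" if "a > 0" for x y a :: real
proof -
  have "0 \<le> (2 * a * x - y)\<^sup>2 / (4 * a)"
    using that by simp
  also have "\<dots> = a * x\<^sup>2 + y\<^sup>2 / (4 * a) - x * y"
    using that by (simp add: power2_eq_square field_simps)
  finally show ?thesis by simp
qed

lemma norm_power2_diff:
  "(norm y)\<^sup>2 - (norm x)\<^sup>2 = 2 * (x \<bullet> (y - x)) + (norm (y - x))\<^sup>2" for x y :: "'a::real_inner"
  unfolding power2_norm_eq_inner by (simp add: inner_diff_left inner_diff_right inner_commute)

lemma power2_sum3_le: "(x + y + z)\<^sup>2 \<le> 3 * (x\<^sup>2 + y\<^sup>2 + z\<^sup>2)" for x y z :: real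
  using zero_le_power2[of "x - y"] zero_le_power2[of "y - z"] zero_le_power2[of "x - z"]
  by (simp add: power2_eq_square algebra_simps)

text \<open>One \<open>K\<close> dominates the norm of \<open>B\<close>, \<open>\<sigma>\<close> and
  \<open>1 / \<sigma>\<close>, so that the constants below are polynomials in
  \<open>K\<close>.\<close>

locale projected_saddle =
  fixes S :: "'e::euclidean_space set" and B :: "'e \<Rightarrow> 'g::euclidean_space" and b :: 'e
    and \<sigma> K :: real
  assumes closed_S: "closed S" and convex_S: "convex S" and S_ne: "S \<noteq> {}"
    and lin: "linear B" and \<sigma>_pos: "\<sigma> > 0"
    and K1: "1 \<le> K" and \<sigma>_le: "\<sigma> \<le> K" and inv_\<sigma>_le: "1 / \<sigma> \<le> K"
    and B_le: "norm (B x) \<le> K * norm x"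
begin

definition P :: "'g \<Rightarrow> 'e \<Rightarrow> 'e" where
  "P Y X = closest_point S (X + \<sigma> *\<^sub>R (adjoint B Y - b))"

definition R :: "'g \<Rightarrow> 'e \<Rightarrow> 'e" where
  "R Y X = X - P Y X"

text \<open>The argument of the projection minus its value, hence an element of the normal cone of
  \<open>S\<close> at \<open>P Y X\<close>.\<close>

definition nrm :: "'g \<Rightarrow> 'e \<Rightarrow> 'e" where
  "nrm Y X = R Y X + \<sigma> *\<^sub>R (adjoint B Y - b)"

text \<open>Half of |F|^2, since the last three components of F form
  \<open>(1 / \<sigma>) *\<^sub>R R Y X\<close>; so \<open>sqrt (2 * energy Y X)\<close> is
  |F|.\<close>

definition energy :: "'g \<Rightarrow> 'e \<Rightarrow> real" where
  "energy Y X = ((norm (B (P Y X)))\<^sup>2 + (norm (R Y X))\<^sup>2 / \<sigma>\<^sup>2) / 2"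

lemma P_in: "P Y X \<in> S"
  unfolding P_def using closed_S S_ne by (rule closest_point_in_set)

lemma nrm_normal: "s \<in> S \<Longrightarrow> nrm Y X \<bullet> (s - P Y X) \<le> 0"
  using closest_point_dot[OF convex_S closed_S, of s "X + \<sigma> *\<^sub>R (adjoint B Y - b)"]
  by (simp add: P_def nrm_def R_def algebra_simps)

lemma adj: "adjoint B v \<bullet> x = v \<bullet> B x" "x \<bullet> adjoint B v = B x \<bullet> v"
  by (simp_all add: adjoint_clauses[OF lin])

text \<open>Each normal vector is tested with the other projection. The energy estimate and the
  estimate of the distance to a zero both rest on this.\<close>

lemma nrm_mono: "(nrm Y' X' - nrm Y X) \<bullet> (P Y' X' - P Y X) \<ge> 0"
  using nrm_normal[OF P_in, of Y X Y' X'] nrm_normal[OF P_in, of Y' X' Y X]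
  by (simp add: inner_diff_left inner_diff_right)

lemma energy_nonneg: "energy Y X \<ge> 0"
  by (simp add: energy_def)

end

text \<open>\<open>N\<close> bounds both the perturbation \<open>(e1, e2)\<close> and the second-order terms of the step.\<close>

locale euler_step = projected_saddle S B b \<sigma> K
  for S :: "'e::euclidean_space set" and B :: "'e \<Rightarrow> 'g::euclidean_space" and b \<sigma> K +
  fixes Y Y' e1 :: 'g and X X' e2 :: 'e and t N :: real
  assumes t_pos: "t > 0" and t_le: "t \<le> 1 / (8 * K ^ 3)"
    and Y': "Y' = Y + t *\<^sub>R (e1 - B (P Y X))"
    and X': "X' = X + t *\<^sub>R (e2 - (1 / \<sigma>) *\<^sub>R R Y X)"
    and e1: "norm e1 \<le> N" and e2: "norm e2 \<le> N"
    and f_N: "t * norm (B (P Y X)) \<le> N" and R_N: "t * norm (R Y X) \<le> N"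
begin

abbreviation "f \<equiv> B (P Y X)"
abbreviation "f' \<equiv> B (P Y' X')"
abbreviation "r \<equiv> R Y X"
abbreviation "dR \<equiv> R Y' X' - R Y X"

lemma dP: "P Y' X' - P Y X = t *\<^sub>R e2 - (t / \<sigma>) *\<^sub>R r - dR"
  by (simp add: R_def X' algebra_simps)

lemma df: "f' - f = t *\<^sub>R B e2 - (t / \<sigma>) *\<^sub>R B r - B dR"
proof -
  have "f' - f = B (P Y' X' - P Y X)"
    by (simp add: linear_diff[OF lin])
  then show ?thesis
    unfolding dP by (simp add: linear_diff[OF lin] linear_cmul[OF lin])
qed

lemma dn: "nrm Y' X' - nrm Y X = dR + (\<sigma> * t) *\<^sub>R adjoint B (e1 - f)"
  using adjoint_linear[OF lin]
  by (simp add: nrm_def Y' linear_add linear_cmul linear_diff algebra_simps)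

lemma N_nonneg: "N \<ge> 0"
  using e1 norm_ge_zero order_trans by blast

lemma t_le': "t \<le> 1" "t * K ^ 3 \<le> 1 / 8" "t / \<sigma> \<le> 1"
proof -
  have K3: "K ^ 3 \<ge> 1" "K ^ 3 \<ge> K" using K1 self_le_power[of K 3] by (auto simp: one_le_power)
  show *: "t * K ^ 3 \<le> 1 / 8" using t_le K1 by (simp add: field_simps)
  moreover have "t * 1 \<le> t * K ^ 3" using K3 t_pos by (intro mult_left_mono) auto
  ultimately show "t \<le> 1" by simp
  have "t / \<sigma> \<le> t * K" using mult_left_mono[OF inv_\<sigma>_le, of t] t_pos by simp
  also have "\<dots> \<le> t * K ^ 3" using K3 t_pos by (intro mult_left_mono) auto
  finally show "t / \<sigma> \<le> 1" using * by simp
qed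

lemma norm_df: "norm (f' - f) \<le> K * (t * norm (B r) + t * N + norm dR)"
proof -
  have "norm (f' - f) \<le> norm (t *\<^sub>R B e2) + norm ((t / \<sigma>) *\<^sub>R B r) + norm (B dR)"
    unfolding df by (rule order_trans[OF norm_triangle_ineq4 add_right_mono[OF norm_triangle_ineq4]])
  also have "\<dots> \<le> t * (K * N) + t * K * norm (B r) + K * norm dR"
  proof (intro add_mono B_le)
    show "norm (t *\<^sub>R B e2) \<le> t * (K * N)"
      using t_pos order_trans[OF B_le, of e2 "K * N"] e2 K1 by simp
    have "(t / \<sigma>) * norm (B r) \<le> (t * K) * norm (B r)"
      using mult_left_mono[OF inv_\<sigma>_le, of t] t_pos by (intro mult_right_mono) auto
    then show "norm ((t / \<sigma>) *\<^sub>R B r) \<le> t * K * norm (B r)"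
      using t_pos \<sigma>_pos by simp
  qed
  finally show ?thesis by (simp add: algebra_simps)
qed

text \<open>\<open>dP\<close> and \<open>dn\<close> inserted into \<open>nrm_mono\<close>. After
  division by \<open>\<sigma> * t\<close> the first two terms are the first-order change of the
  energy, compare \<open>energy_diff\<close>, and the third becomes the gain of order
  \<open>(norm dR)\<^sup>2 / t\<close>.\<close>

lemma monotone_step:
  "\<sigma> * t * (f \<bullet> (f' - f)) + (t / \<sigma>) * (r \<bullet> dR) + (norm dR)\<^sup>2
     \<le> t * (e2 \<bullet> dR) + \<sigma> * t * (e1 \<bullet> (f' - f))"
proof -
  have "(nrm Y' X' - nrm Y X) \<bullet> (P Y' X' - P Y X)
      = dR \<bullet> (P Y' X' - P Y X) + (\<sigma> * t) * ((e1 - f) \<bullet> (f' - f))"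
    unfolding dn by (simp add: inner_add_left adj linear_diff[OF lin])
  also have "dR \<bullet> (P Y' X' - P Y X) = t * (e2 \<bullet> dR) - (t / \<sigma>) * (r \<bullet> dR) - (norm dR)\<^sup>2"
  proof -
    have "d \<bullet> (t *\<^sub>R e2 - (t / \<sigma>) *\<^sub>R r - d) = t * (e2 \<bullet> d) - (t / \<sigma>) * (r \<bullet> d) - (norm d)\<^sup>2" for d
      by (simp add: inner_diff_right inner_commute power2_norm_eq_inner)
    then show ?thesis unfolding dP .
  qed
  finally show ?thesis
    using nrm_mono[of Y' X' Y X] by (simp add: inner_diff_left algebra_simps)
qed

lemma energy_diff:
  "energy Y' X' - energy Y X = f \<bullet> (f' - f) + (norm (f' - f))\<^sup>2 / 2
     + (r \<bullet> dR) / \<sigma>\<^sup>2 + (norm dR)\<^sup>2 / (2 * \<sigma>\<^sup>2)"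
proof -
  have "energy Y' X' - energy Y X = (((norm f')\<^sup>2 - (norm f)\<^sup>2)
      + ((norm (R Y' X'))\<^sup>2 - (norm r)\<^sup>2) / \<sigma>\<^sup>2) / 2"
    by (simp add: energy_def diff_divide_distrib add_divide_distrib)
  then show ?thesis
    unfolding norm_power2_diff by (simp add: add_divide_distrib)
qed

lemma tBr: "t * norm (B r) \<le> K * N"
proof -
  have "t * norm (B r) \<le> t * (K * norm r)"
    using B_le t_pos by (intro mult_left_mono) auto
  also have "\<dots> \<le> K * N" using R_N K1 by (simp add: mult.left_commute)
  finally show ?thesis .
qed

text \<open>In the square of \<open>t * norm (B r)\<close> one factor is traded for
  \<open>K * N\<close> by \<open>tBr\<close>. This leaves an error linear in
  \<open>norm (B r)\<close>, which can later be weighed against the decay of that quantity.\<close>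

lemma df_norm_sq:
  "(norm (f' - f))\<^sup>2 \<le> 3 * K ^ 3 * (t * norm (B r) * N + t * N\<^sup>2) + 3 * K\<^sup>2 * (norm dR)\<^sup>2"
proof -
  define \<beta> \<rho> where "\<beta> = norm (B r)" and "\<rho> = norm dR"
  define D where "D = norm (f' - f)"
  have nn: "\<beta> \<ge> 0" "\<rho> \<ge> 0" "N \<ge> 0" "D \<ge> 0" "t \<ge> 0" "K \<ge> 0"
    using N_nonneg t_pos K1 by (auto simp: \<beta>_def \<rho>_def D_def)
  have D: "D \<le> K * (t * \<beta> + t * N + \<rho>)"
    using norm_df by (simp add: D_def \<beta>_def \<rho>_def)
  have t\<beta>: "t * \<beta> \<le> K * N" using tBr by (simp add: \<beta>_def)
  define T where "T = t * \<beta> * N + t * N\<^sup>2"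
  have "D\<^sup>2 \<le> (K * (t * \<beta> + t * N + \<rho>))\<^sup>2"
    using D nn by (intro power_mono) auto
  also have "\<dots> \<le> K\<^sup>2 * (3 * ((t * \<beta>)\<^sup>2 + (t * N)\<^sup>2 + \<rho>\<^sup>2))"
    unfolding power_mult_distrib[of K] by (intro mult_left_mono power2_sum3_le) auto
  also have "\<dots> \<le> K\<^sup>2 * (3 * (K * T + \<rho>\<^sup>2))"
  proof -
    have "(t * \<beta>)\<^sup>2 \<le> K * (t * \<beta> * N)"
      using mult_left_mono[OF t\<beta>, of "t * \<beta>"] nn by (simp add: power2_eq_square algebra_simps)
    moreover have "(t * N)\<^sup>2 \<le> K * (t * N\<^sup>2)"
    proof -
      have "t * (t * N\<^sup>2) \<le> K * (t * N\<^sup>2)"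
        using t_le'(1) K1 nn by (intro mult_right_mono) auto
      then show ?thesis by (simp add: power2_eq_square algebra_simps)
    qed
    ultimately show ?thesis
      by (intro mult_left_mono) (auto simp: T_def algebra_simps)
  qed
  finally have "D\<^sup>2 \<le> 3 * K ^ 3 * T + 3 * K\<^sup>2 * \<rho>\<^sup>2"
    by (simp add: algebra_simps power2_eq_square power3_eq_cube)
  then show ?thesis by (simp add: D_def \<beta>_def \<rho>_def T_def)
qed

text \<open>\<open>monotone_step\<close> bounds the first-order change and \<open>df_norm_sq\<close>
  the rest. With \<open>N\<close> of order \<open>t\<close> the last term is summable;
  \<open>t * norm (B r) * N\<close> is the critical one.\<close>

lemma energy_step:
  "energy Y' X' \<le> energy Y X - (norm dR)\<^sup>2 / (2 * K * t)
     + 11 * K ^ 3 * (t * norm (B r) * N + t * N\<^sup>2)"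
proof -
  define \<beta> \<rho> where "\<beta> = norm (B r)" and "\<rho> = norm dR"
  define D where "D = norm (f' - f)"
  have nn: "\<beta> \<ge> 0" "\<rho> \<ge> 0" "N \<ge> 0" "D \<ge> 0" "t \<ge> 0" "K \<ge> 0"
    using N_nonneg t_pos K1 by (auto simp: \<beta>_def \<rho>_def D_def)
  have D: "D \<le> K * (t * \<beta> + t * N + \<rho>)"
    using norm_df by (simp add: D_def \<beta>_def \<rho>_def)
  have t\<beta>: "t * \<beta> \<le> K * N" using tBr by (simp add: \<beta>_def)
  define T where "T = t * \<beta> * N + t * N\<^sup>2"
  have T0: "T \<ge> 0" unfolding T_def using nn by simp
  have "f \<bullet> (f' - f) + (r \<bullet> dR) / \<sigma>\<^sup>2 \<le> - (\<rho>\<^sup>2 / (\<sigma> * t)) + (e2 \<bullet> dR) / \<sigma> + e1 \<bullet> (f' - f)"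
  proof -
    have "(\<sigma> * t * (f \<bullet> (f' - f)) + (t / \<sigma>) * (r \<bullet> dR) + \<rho>\<^sup>2) / (\<sigma> * t)
        \<le> (t * (e2 \<bullet> dR) + \<sigma> * t * (e1 \<bullet> (f' - f))) / (\<sigma> * t)"
      using monotone_step t_pos \<sigma>_pos by (intro divide_right_mono) (auto simp: \<rho>_def)
    then show ?thesis
      using t_pos \<sigma>_pos by (simp add: add_divide_distrib power2_eq_square)
  qed
  also have "(e2 \<bullet> dR) / \<sigma> \<le> K * (\<rho> * N)"
  proof -
    have "e2 \<bullet> dR \<le> N * \<rho>"
      using order_trans[OF norm_cauchy_schwarz[of e2 dR] mult_right_mono[OF e2, of "norm dR"]]
      by (simp add: \<rho>_def)
    then have "(e2 \<bullet> dR) / \<sigma> \<le> (N * \<rho>) / \<sigma>" using \<sigma>_pos by (simp add: divide_right_mono)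
    also have "\<dots> \<le> K * (\<rho> * N)"
      using mult_right_mono[OF inv_\<sigma>_le, of "N * \<rho>"] nn by (simp add: algebra_simps)
    finally show ?thesis .
  qed
  also have "e1 \<bullet> (f' - f) \<le> N * D"
    using order_trans[OF norm_cauchy_schwarz[of e1 "f' - f"] mult_right_mono[OF e1, of "norm (f' - f)"]]
    by (simp add: D_def)
  also have "- (\<rho>\<^sup>2 / (\<sigma> * t)) \<le> - (\<rho>\<^sup>2 / (K * t))"
    using \<sigma>_le \<sigma>_pos t_pos by (simp add: frac_le)
  finally have 1: "f \<bullet> (f' - f) + (r \<bullet> dR) / \<sigma>\<^sup>2 \<le> - (\<rho>\<^sup>2 / (K * t)) + K * (\<rho> * N) + N * D"
    by simp
  have "N * D \<le> N * (K * (t * \<beta> + t * N + \<rho>))"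
    using D nn by (intro mult_left_mono) auto
  also have "\<dots> = K * T + K * (\<rho> * N)"
    by (simp add: T_def algebra_simps power2_eq_square)
  finally have 2: "N * D \<le> K * T + K * (\<rho> * N)" .
  have 3: "D\<^sup>2 \<le> 3 * (K ^ 3 * T) + 3 * (K\<^sup>2 * \<rho>\<^sup>2)"
    using df_norm_sq by (simp add: D_def \<beta>_def \<rho>_def T_def)
  have 4: "\<rho>\<^sup>2 / (2 * \<sigma>\<^sup>2) \<le> (K\<^sup>2 * \<rho>\<^sup>2) / 2"
  proof -
    have "(1 / \<sigma>)\<^sup>2 \<le> K\<^sup>2" using inv_\<sigma>_le \<sigma>_pos by (intro power_mono) auto
    from mult_right_mono[OF this, of "\<rho>\<^sup>2 / 2"] show ?thesis by (simp add: power_divide)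
  qed
  have 5: "2 * (K * (\<rho> * N)) \<le> \<rho>\<^sup>2 / (4 * K * t) + 4 * (K ^ 3 * (t * N\<^sup>2))"
    using young[of "1 / (4 * K * t)" \<rho> "2 * K * N"] K1 t_pos
    by (simp add: power2_eq_square power3_eq_cube algebra_simps)
  \<comment> \<open>This is exactly the bound \<open>t_le\<close> on the step length.\<close>
  have 6: "2 * (K\<^sup>2 * \<rho>\<^sup>2) \<le> \<rho>\<^sup>2 / (4 * K * t)"
  proof -
    have "2 * K\<^sup>2 \<le> 1 / (4 * K * t)"
      using t_le'(2) K1 t_pos by (simp add: field_simps power2_eq_square power3_eq_cube)
    from mult_right_mono[OF this, of "\<rho>\<^sup>2"] show ?thesis by simp
  qed
  \<comment> \<open>Half of the gain survives; the two quarters pay for \<open>5\<close> and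
    \<open>6\<close>.\<close>
  have 7: "\<rho>\<^sup>2 / (K * t) = \<rho>\<^sup>2 / (2 * K * t) + \<rho>\<^sup>2 / (4 * K * t) + \<rho>\<^sup>2 / (4 * K * t)"
    by simp
  have 8: "K ^ 3 * (t * N\<^sup>2) \<le> K ^ 3 * T" "K * T \<le> K ^ 3 * T" 
    using nn K1 self_le_power[of K 3] T0 by (auto simp: T_def intro!: mult_left_mono mult_right_mono)
  have "energy Y' X' - energy Y X
      \<le> - (\<rho>\<^sup>2 / (K * t)) + K * (\<rho> * N) + N * D + D\<^sup>2 / 2 + \<rho>\<^sup>2 / (2 * \<sigma>\<^sup>2)"
    using 1 energy_diff by (simp add: D_def \<rho>_def)
  also have "\<dots> \<le> - (\<rho>\<^sup>2 / (2 * K * t)) + 11 * (K ^ 3 * T)"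
    using 2 3 4 5 6 7 8 mult_nonneg_nonneg[OF zero_le_power[OF nn(6)] T0, of 3] by linarith
  finally show ?thesis by (simp add: \<rho>_def T_def \<beta>_def algebra_simps)
qed

text \<open>All first-order changes but one cancel. With \<open>s = t / \<sigma>\<close>, the change
  of \<open>f \<bullet> B Z\<close> contains
  \<open>- s * (f \<bullet> B Z) - f \<bullet> (f' - f)\<close>. The normal vector moves by
  \<open>- (\<sigma> * t)\<close> times \<open>adjoint B f\<close>, so the second term returns
  \<open>s * (f \<bullet> B Z)\<close>; the energy returns \<open>f \<bullet> (f' - f)\<close>, and
  the terms with \<open>r \<bullet> dR\<close> cancel too. What remains is the product of
  \<open>f' - f\<close> with the new \<open>B Z\<close>. It has the leading part
  \<open>- s * (norm (B r))\<^sup>2\<close>, because \<open>f' - f\<close> contains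
  \<open>- s\<close> times \<open>B r\<close> and \<open>Z\<close> differs from \<open>r\<close> by
  \<open>X - Xt\<close>.\<close>

lemma lyapunov_step:
  fixes Xt :: 'e
  defines "Z \<equiv> Xt - P Y X" and "Xt' \<equiv> Xt - (t / \<sigma>) *\<^sub>R (Xt - P Y X)"
  assumes Xt: "Xt \<in> S"
  shows "f' \<bullet> B (Xt' - P Y' X') - nrm Y' X' \<bullet> (Xt' - P Y' X') / \<sigma>\<^sup>2 + energy Y' X'
    \<le> f \<bullet> B Z - nrm Y X \<bullet> Z / \<sigma>\<^sup>2 + energy Y X - t * (norm (B r))\<^sup>2 / (2 * K)
      + 1000 * K ^ 7 * ((norm dR)\<^sup>2 / t + t * N\<^sup>2 + t * (norm (X - Xt))\<^sup>2)"
proof -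
  define \<beta> \<rho> D \<gamma> where "\<beta> = norm (B r)" and "\<rho> = norm dR" and "D = norm (f' - f)"
    and "\<gamma> = norm (X - Xt)"
  define dp where "dp = P Y' X' - P Y X"
  define n where "n = nrm Y X"
  define dn where "dn = nrm Y' X' - nrm Y X"
  define Z' where "Z' = Xt' - P Y' X'"
  define s where "s = t / \<sigma>"
  have nn: "\<beta> \<ge> 0" "\<rho> \<ge> 0" "N \<ge> 0" "D \<ge> 0" "\<gamma> \<ge> 0" "t \<ge> 0" "K \<ge> 0" "s \<ge> 0"
    using N_nonneg t_pos K1 \<sigma>_pos by (auto simp: \<beta>_def \<rho>_def D_def \<gamma>_def s_def)
  have s: "s \<le> 1" "s \<le> K * t" "s \<ge> t / K"
    using t_le'(3) mult_left_mono[OF inv_\<sigma>_le, of t] t_pos \<sigma>_le \<sigma>_pos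
    by (auto simp: s_def mult.commute intro!: frac_le)
  have i2: "1 / \<sigma>\<^sup>2 \<le> K\<^sup>2"
    using power_mono[OF inv_\<sigma>_le, of 2] \<sigma>_pos by (simp add: power_divide)
  have i1: "0 \<le> 1 / \<sigma>\<^sup>2" by simp
  have Z'_eq: "Z' = (1 - s) *\<^sub>R Z - dp"
    by (simp add: Z'_def Z_def Xt'_def dp_def s_def algebra_simps)
  have Z_eq: "Z = r - (X - Xt)"
    by (simp add: Z_def R_def)
  have Bdp: "B dp = f' - f"
    by (simp add: dp_def linear_diff[OF lin])
  have dn_eq: "dn = dR + (\<sigma> * t) *\<^sub>R adjoint B (e1 - f)"
    using dn by (simp add: dn_def)
  have dn_inner: "dn \<bullet> x = dR \<bullet> x + \<sigma> * t * ((e1 - f) \<bullet> B x)" for x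
    unfolding dn_eq by (simp add: inner_add_left adj)
  \<comment> \<open>\<open>Xt\<close> and the new projection are points of \<open>S\<close>; the
    sign allows these terms to be dropped in \<open>M\<close>.\<close>
  have nZ: "n \<bullet> Z \<le> 0" "n \<bullet> dp \<le> 0"
    using nrm_normal[OF Xt] nrm_normal[OF P_in] by (auto simp: n_def Z_def dp_def)
  have M: "f' \<bullet> B Z' - (n + dn) \<bullet> Z' / \<sigma>\<^sup>2 - (f \<bullet> B Z - n \<bullet> Z / \<sigma>\<^sup>2)
    \<le> (f' - f) \<bullet> B Z' - f \<bullet> (f' - f) - dR \<bullet> Z / \<sigma>\<^sup>2 - s * (e1 \<bullet> B Z) + dn \<bullet> dp / \<sigma>\<^sup>2
       + s * (dn \<bullet> Z) / \<sigma>\<^sup>2"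
  proof -
    have 1: "f' \<bullet> B Z' - f \<bullet> B Z = (f' - f) \<bullet> B Z' - s * (f \<bullet> B Z) - f \<bullet> (f' - f)"
    proof -
      have "B Z' = B Z - s *\<^sub>R B Z - (f' - f)"
        by (simp add: Z'_eq Bdp[symmetric] linear_diff[OF lin] linear_cmul[OF lin] scaleR_diff_left)
      then have "f \<bullet> B Z' = f \<bullet> B Z - s * (f \<bullet> B Z) - f \<bullet> (f' - f)"
        by (simp add: inner_diff_right)
      then show ?thesis by (simp add: inner_diff_left)
    qed
    have "n \<bullet> Z - (n + dn) \<bullet> Z'
        = - (dn \<bullet> Z) + s * (dn \<bullet> Z) + dn \<bullet> dp + n \<bullet> dp + s * (n \<bullet> Z)"
      by (simp add: Z'_eq inner_add_left inner_diff_right algebra_simps)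
    also have "\<dots> \<le> - (dn \<bullet> Z) + s * (dn \<bullet> Z) + dn \<bullet> dp"
      using nZ nn mult_nonneg_nonpos[of s "n \<bullet> Z"] by simp
    finally have "(n \<bullet> Z - (n + dn) \<bullet> Z') / \<sigma>\<^sup>2 \<le> (- (dn \<bullet> Z) + s * (dn \<bullet> Z) + dn \<bullet> dp) / \<sigma>\<^sup>2"
      by (rule divide_right_mono) simp
    moreover have "(dn \<bullet> Z) / \<sigma>\<^sup>2 = dR \<bullet> Z / \<sigma>\<^sup>2 + s * (e1 \<bullet> B Z) - s * (f \<bullet> B Z)"
      unfolding dn_inner s_def using \<sigma>_pos
      by (simp add: inner_diff_left field_simps power2_eq_square)
    ultimately show ?thesis
      using 1 by (simp add: add_divide_distrib diff_divide_distrib)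
  qed
  have dRZ: "dR \<bullet> Z = r \<bullet> dR - dR \<bullet> (X - Xt)"
    unfolding Z_eq by (simp only: inner_diff_right inner_commute)
  have total: "f' \<bullet> B Z' - (n + dn) \<bullet> Z' / \<sigma>\<^sup>2 + energy Y' X' - (f \<bullet> B Z - n \<bullet> Z / \<sigma>\<^sup>2 + energy Y X)
    \<le> (f' - f) \<bullet> B Z' + D\<^sup>2 / 2 + \<rho>\<^sup>2 / (2 * \<sigma>\<^sup>2) + dR \<bullet> (X - Xt) / \<sigma>\<^sup>2 - s * (e1 \<bullet> B Z)
       + dn \<bullet> dp / \<sigma>\<^sup>2 + s * (dn \<bullet> Z) / \<sigma>\<^sup>2"
    using M energy_diff unfolding dRZ by (simp add: D_def \<rho>_def diff_divide_distrib)
  have D: "D \<le> K * (t * \<beta> + t * N + \<rho>)"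
    using norm_df by (simp add: D_def \<beta>_def \<rho>_def)
  have D2: "D\<^sup>2 \<le> 3 * K ^ 3 * (t * \<beta> * N + t * N\<^sup>2) + 3 * K\<^sup>2 * \<rho>\<^sup>2"
    using df_norm_sq by (simp add: D_def \<beta>_def \<rho>_def)
  have t\<beta>: "t * \<beta> \<le> K * N" using tBr by (simp add: \<beta>_def)
  have tN: "t * N \<le> N" using t_le'(1) nn mult_right_mono[of t 1 N] by simp
  have BZ: "norm (B Z) \<le> \<beta> + K * \<gamma>"
  proof -
    have "norm (B Z) \<le> norm (B r) + norm (B (X - Xt))"
      unfolding Z_eq linear_diff[OF lin] by (rule norm_triangle_ineq4)
    then show ?thesis using B_le[of "X - Xt"] by (simp add: \<beta>_def \<gamma>_def)
  qed
  have norm_dp: "norm dp \<le> 2 * K * N + \<rho>"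
  proof -
    have "norm dp \<le> norm (t *\<^sub>R e2) + norm (s *\<^sub>R r) + \<rho>"
      unfolding dp_def dP s_def \<rho>_def
      by (rule order_trans[OF norm_triangle_ineq4 add_right_mono[OF norm_triangle_ineq4]])
    also have "norm (t *\<^sub>R e2) \<le> K * N"
    proof -
      have "t * norm e2 \<le> t * N" using e2 nn by (intro mult_left_mono)
      also have "\<dots> \<le> K * N" using tN K1 nn mult_right_mono[of 1 K N] by simp
      finally show ?thesis using t_pos by simp
    qed
    also have "norm (s *\<^sub>R r) \<le> K * N"
    proof -
      have "s * norm r \<le> K * t * norm r" using s(2) by (rule mult_right_mono) simp
      also have "\<dots> \<le> K * N" using mult_left_mono[OF R_N nn(7)] by simp
      finally show ?thesis using nn by simp
    qed
    finally show ?thesis by simp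
  qed
  have e1f: "norm (t *\<^sub>R (e1 - f)) \<le> 2 * N"
  proof -
    have "norm (t *\<^sub>R (e1 - f)) \<le> t * norm e1 + t * norm f"
      using norm_triangle_ineq4[of "t *\<^sub>R e1" "t *\<^sub>R f"] t_pos by (simp add: scaleR_diff_right)
    also have "t * norm e1 \<le> N" using mult_left_mono[OF e1 nn(6)] tN by simp
    finally show ?thesis using f_N by simp
  qed
  \<comment> \<open>\<open>B Z'\<close> is replaced by \<open>B r\<close>: the pairing with
    \<open>B r\<close> supplies the decay, and the difference of the two is paired with
    \<open>f' - f\<close> as an error.\<close>
  have a1: "(f' - f) \<bullet> B Z' \<le> - (s * \<beta>\<^sup>2) + K * (t * \<beta> * N) + K * (\<rho> * \<beta>)
      + D * (K * (t * \<beta>) + K * \<gamma> + D)"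
  proof -
    have "B Z' - B r = - (s *\<^sub>R B r) - (1 - s) *\<^sub>R B (X - Xt) - (f' - f)"
    proof -
      have "B Z' = (1 - s) *\<^sub>R B Z - (f' - f)"
        by (simp add: Z'_eq Bdp linear_diff[OF lin, of _ dp] linear_cmul[OF lin])
      moreover have "B Z = B r - B (X - Xt)"
        unfolding Z_eq by (rule linear_diff[OF lin])
      ultimately show ?thesis by (simp add: algebra_simps)
    qed
    then have "norm (B Z' - B r) \<le> norm (s *\<^sub>R B r) + norm ((1 - s) *\<^sub>R B (X - Xt)) + D"
      unfolding D_def
      by (simp only:) (rule order_trans[OF norm_triangle_ineq4 add_right_mono[OF
            order_trans[OF norm_triangle_ineq4]]], simp)
    also have "norm (s *\<^sub>R B r) \<le> K * (t * \<beta>)"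
      using mult_right_mono[OF s(2), of \<beta>] nn by (simp add: \<beta>_def mult.assoc)
    also have "norm ((1 - s) *\<^sub>R B (X - Xt)) \<le> K * \<gamma>"
      using s nn B_le[of "X - Xt"] mult_mono[of "1 - s" 1 "norm (B (X - Xt))" "K * \<gamma>"]
      by (simp add: \<gamma>_def)
    finally have "(f' - f) \<bullet> (B Z' - B r) \<le> D * (K * (t * \<beta>) + K * \<gamma> + D)"
      using nn by (intro order_trans[OF norm_cauchy_schwarz]) (auto simp: D_def intro!: mult_left_mono)
    moreover have "(f' - f) \<bullet> B r \<le> - (s * \<beta>\<^sup>2) + K * (t * \<beta> * N) + K * (\<rho> * \<beta>)"
    proof -
      have "(f' - f) \<bullet> B r = t * (B e2 \<bullet> B r) - s * \<beta>\<^sup>2 + - (B dR \<bullet> B r)"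
        unfolding df s_def \<beta>_def by (simp add: inner_diff_left power2_norm_eq_inner)
      also have "t * (B e2 \<bullet> B r) \<le> K * (t * \<beta> * N)"
      proof -
        have "B e2 \<bullet> B r \<le> (K * N) * \<beta>"
          using order_trans[OF B_le mult_left_mono[OF e2 nn(7)]] unfolding \<beta>_def
          by (intro order_trans[OF norm_cauchy_schwarz] mult_right_mono) auto
        from mult_left_mono[OF this nn(6)] show ?thesis by (simp add: algebra_simps)
      qed
      also have "- (B dR \<bullet> B r) \<le> K * (\<rho> * \<beta>)"
      proof -
        have "- (B dR \<bullet> B r) \<le> norm (B dR) * norm (B r)"
          using norm_cauchy_schwarz[of "- B dR" "B r"] by simp
        also have "\<dots> \<le> (K * \<rho>) * \<beta>"
          unfolding \<rho>_def \<beta>_def by (intro mult_right_mono B_le) auto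
        finally show ?thesis by simp
      qed
      finally show ?thesis by simp
    qed
    ultimately show ?thesis by (simp add: inner_diff_right)
  qed
  have a3: "\<rho>\<^sup>2 / (2 * \<sigma>\<^sup>2) \<le> K\<^sup>2 * \<rho>\<^sup>2"
  proof -
    have "\<rho>\<^sup>2 / (2 * \<sigma>\<^sup>2) \<le> \<rho>\<^sup>2 / \<sigma>\<^sup>2"
      using \<sigma>_pos by (intro divide_left_mono) auto
    then show ?thesis
      using mult_right_mono[OF i2, of "\<rho>\<^sup>2"] by simp
  qed
  have a4: "dR \<bullet> (X - Xt) / \<sigma>\<^sup>2 \<le> K\<^sup>2 * (\<rho> * \<gamma>)"
  proof -
    have "1 / \<sigma>\<^sup>2 * (dR \<bullet> (X - Xt)) \<le> 1 / \<sigma>\<^sup>2 * (\<rho> * \<gamma>)"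
      unfolding \<rho>_def \<gamma>_def by (intro mult_left_mono norm_cauchy_schwarz i1)
    also have "\<dots> \<le> K\<^sup>2 * (\<rho> * \<gamma>)" using i2 nn by (intro mult_right_mono) auto
    finally show ?thesis by simp
  qed
  have a5: "- (s * (e1 \<bullet> B Z)) \<le> K * (t * \<beta> * N) + K\<^sup>2 * (t * N * \<gamma>)"
  proof -
    have "- (e1 \<bullet> B Z) \<le> norm e1 * norm (B Z)"
      using norm_cauchy_schwarz[of "- e1" "B Z"] by simp
    also have "\<dots> \<le> N * (\<beta> + K * \<gamma>)" using e1 BZ nn by (intro mult_mono) auto
    finally have "s * - (e1 \<bullet> B Z) \<le> s * (N * (\<beta> + K * \<gamma>))"
      using nn by (intro mult_left_mono)
    also have "\<dots> \<le> K * t * (N * (\<beta> + K * \<gamma>))"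
      using s nn by (intro mult_right_mono) auto
    finally have "s * - (e1 \<bullet> B Z) \<le> K * t * (N * (\<beta> + K * \<gamma>))" .
    then show ?thesis by (simp add: algebra_simps power2_eq_square)
  qed
  have a6: "dn \<bullet> dp / \<sigma>\<^sup>2 \<le> K\<^sup>2 * (2 * K * (\<rho> * N) + \<rho>\<^sup>2) + 2 * K * (N * D)"
  proof -
    have "dn \<bullet> dp / \<sigma>\<^sup>2 = 1 / \<sigma>\<^sup>2 * (dR \<bullet> dp) + 1 / \<sigma> * (t * ((e1 - f) \<bullet> (f' - f)))"
      unfolding dn_inner Bdp using \<sigma>_pos by (simp add: field_simps power2_eq_square)
    also have "t * ((e1 - f) \<bullet> (f' - f)) = t *\<^sub>R (e1 - f) \<bullet> (f' - f)"
      by (rule inner_scaleR_left[symmetric])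
    also have "1 / \<sigma>\<^sup>2 * (dR \<bullet> dp) \<le> K\<^sup>2 * (\<rho> * (2 * K * N + \<rho>))"
    proof -
      have "dR \<bullet> dp \<le> \<rho> * (2 * K * N + \<rho>)"
        using norm_dp nn by (intro order_trans[OF norm_cauchy_schwarz]) (auto simp: \<rho>_def intro: mult_left_mono)
      then have "1 / \<sigma>\<^sup>2 * (dR \<bullet> dp) \<le> 1 / \<sigma>\<^sup>2 * (\<rho> * (2 * K * N + \<rho>))"
        by (rule mult_left_mono) simp
      also have "\<dots> \<le> K\<^sup>2 * (\<rho> * (2 * K * N + \<rho>))" using i2 nn by (intro mult_right_mono) auto
      finally show ?thesis .
    qed
    also have "1 / \<sigma> * (t *\<^sub>R (e1 - f) \<bullet> (f' - f)) \<le> K * (2 * N * D)"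
    proof -
      have "t *\<^sub>R (e1 - f) \<bullet> (f' - f) \<le> 2 * N * D"
        using e1f unfolding D_def by (intro order_trans[OF norm_cauchy_schwarz] mult_right_mono) auto
      then have "1 / \<sigma> * (t *\<^sub>R (e1 - f) \<bullet> (f' - f)) \<le> 1 / \<sigma> * (2 * N * D)"
        using \<sigma>_pos by (intro mult_left_mono) auto
      also have "\<dots> \<le> K * (2 * N * D)" using inv_\<sigma>_le nn by (intro mult_right_mono) auto
      finally show ?thesis .
    qed
    finally show ?thesis by (simp add: algebra_simps power2_eq_square)
  qed
  have a7: "s * (dn \<bullet> Z) / \<sigma>\<^sup>2 \<le> K ^ 3 * (\<rho> * N + \<rho> * \<gamma>) + 2 * K\<^sup>2 * (t * \<beta> * N + K * (t * N * \<gamma>))"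
  proof -
    have "s * (dn \<bullet> Z) / \<sigma>\<^sup>2 = (1 / \<sigma>) ^ 3 * (t * (dR \<bullet> Z)) + (1 / \<sigma>)\<^sup>2 * (t * (t * ((e1 - f) \<bullet> B Z)))"
      unfolding dn_inner s_def using \<sigma>_pos by (simp add: field_simps power2_eq_square power3_eq_cube)
    also have "t * ((e1 - f) \<bullet> B Z) = t *\<^sub>R (e1 - f) \<bullet> B Z"
      by (rule inner_scaleR_left[symmetric])
    also have "(1 / \<sigma>) ^ 3 * (t * (dR \<bullet> Z)) \<le> K ^ 3 * (\<rho> * (N + \<gamma>))"
    proof -
      have "t * norm Z \<le> N + \<gamma>"
      proof -
        have "t * norm Z \<le> t * (norm r + \<gamma>)"
          unfolding Z_eq \<gamma>_def using nn by (intro mult_left_mono norm_triangle_ineq4)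
        also have "\<dots> \<le> N + \<gamma>" using R_N t_le'(1) nn mult_right_mono[of t 1 \<gamma>] by (simp add: algebra_simps)
        finally show ?thesis .
      qed
      then have "t * (dR \<bullet> Z) \<le> \<rho> * (N + \<gamma>)"
        using mult_left_mono[OF norm_cauchy_schwarz[of dR Z] nn(6)] mult_left_mono[of "t * norm Z" "N + \<gamma>" \<rho>] nn
        by (simp add: \<rho>_def mult.left_commute)
      moreover have "(1 / \<sigma>) ^ 3 \<le> K ^ 3" using inv_\<sigma>_le \<sigma>_pos by (intro power_mono) auto
      moreover have "0 \<le> (1 / \<sigma>) ^ 3" using \<sigma>_pos by simp
      ultimately show ?thesis
        using nn mult_left_mono[of "t * (dR \<bullet> Z)" "\<rho> * (N + \<gamma>)" "(1 / \<sigma>) ^ 3"]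
          mult_right_mono[of "(1 / \<sigma>) ^ 3" "K ^ 3" "\<rho> * (N + \<gamma>)"] by simp
    qed
    also have "(1 / \<sigma>)\<^sup>2 * (t * (t *\<^sub>R (e1 - f) \<bullet> B Z)) \<le> K\<^sup>2 * (t * (2 * N * (\<beta> + K * \<gamma>)))"
    proof -
      have "t *\<^sub>R (e1 - f) \<bullet> B Z \<le> 2 * N * (\<beta> + K * \<gamma>)"
        using e1f BZ nn by (intro order_trans[OF norm_cauchy_schwarz] mult_mono) auto
      then have "t * (t *\<^sub>R (e1 - f) \<bullet> B Z) \<le> t * (2 * N * (\<beta> + K * \<gamma>))"
        using nn by (intro mult_left_mono)
      then have "(1 / \<sigma>)\<^sup>2 * (t * (t *\<^sub>R (e1 - f) \<bullet> B Z)) \<le> (1 / \<sigma>)\<^sup>2 * (t * (2 * N * (\<beta> + K * \<gamma>)))"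
        by (rule mult_left_mono) simp
      also have "\<dots> \<le> K\<^sup>2 * (t * (2 * N * (\<beta> + K * \<gamma>)))"
        using i2 nn by (intro mult_right_mono) (auto simp: power_divide)
      finally show ?thesis .
    qed
    finally show ?thesis by (simp add: algebra_simps)
  qed
  \<comment> \<open>Every error is a multiple of one of the eight products in \<open>G\<close>. The
    largest total coefficient is that of \<open>t * \<beta> * N\<close>, at most
    \<open>25 / 2\<close> times \<open>K ^ 3\<close>.\<close>
  define L where "L = 14 * K ^ 3"
  define G where "G = t * \<beta> * N + \<rho> * \<beta> + t * \<beta> * \<gamma> + t * N * \<gamma> + \<rho> * \<gamma> + \<rho> * N + \<rho>\<^sup>2 + t * N\<^sup>2"
  have bound: "(f' - f) \<bullet> B Z' + D\<^sup>2 / 2 + \<rho>\<^sup>2 / (2 * \<sigma>\<^sup>2) + dR \<bullet> (X - Xt) / \<sigma>\<^sup>2 - s * (e1 \<bullet> B Z)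
       + dn \<bullet> dp / \<sigma>\<^sup>2 + s * (dn \<bullet> Z) / \<sigma>\<^sup>2 \<le> - (s * \<beta>\<^sup>2) + L * G"
  proof -
    have Ds: "D * (t * \<beta>) \<le> K * (K * (t * \<beta> * N) + t * \<beta> * N + K * (\<rho> * N))"
    proof -
      have "D * (t * \<beta>) \<le> K * (t * \<beta> + t * N + \<rho>) * (t * \<beta>)"
        using D nn by (intro mult_right_mono) auto
      also have "\<dots> = K * ((t * \<beta>) * (t * \<beta>) + (t * N) * (t * \<beta>) + \<rho> * (t * \<beta>))"
        by (simp add: algebra_simps)
      also have "\<dots> \<le> K * ((K * N) * (t * \<beta>) + N * (t * \<beta>) + \<rho> * (K * N))"
        using t\<beta> tN nn by (intro mult_left_mono add_mono mult_right_mono) auto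
      finally show ?thesis by (simp add: algebra_simps)
    qed
    have D\<gamma>: "D * \<gamma> \<le> K * (t * \<beta> * \<gamma> + t * N * \<gamma> + \<rho> * \<gamma>)"
      using mult_right_mono[OF D nn(5)] by (simp add: algebra_simps)
    have ND: "N * D \<le> K * (t * \<beta> * N + t * N\<^sup>2 + \<rho> * N)"
      using mult_left_mono[OF D nn(3)] by (simp add: algebra_simps power2_eq_square)
    have k: "K * p \<le> K ^ 3 * p" "K\<^sup>2 * p \<le> K ^ 3 * p" "0 \<le> K ^ 3 * p" if "p \<ge> 0" for p
      using that K1 self_le_power[of K 3] power_increasing[of 2 3 K] by (auto intro: mult_right_mono)
    define p1 p2 p3 p4 p5 p6 p7 p8 where p: "p1 = t * \<beta> * N" "p2 = \<rho> * \<beta>" "p3 = t * \<beta> * \<gamma>"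
      "p4 = t * N * \<gamma>" "p5 = \<rho> * \<gamma>" "p6 = \<rho> * N" "p7 = \<rho>\<^sup>2" "p8 = t * N\<^sup>2"
    have pn: "p1 \<ge> 0" "p2 \<ge> 0" "p3 \<ge> 0" "p4 \<ge> 0" "p5 \<ge> 0" "p6 \<ge> 0" "p7 \<ge> 0" "p8 \<ge> 0"
      using nn by (auto simp: p)
    have c: "K\<^sup>2 * (K * x) = K ^ 3 * x" "K * (K * x) = K\<^sup>2 * x" "K * (K\<^sup>2 * x) = K ^ 3 * x" for x
      by (simp_all add: power2_eq_square power3_eq_cube)
    have h1: "D * (K * (t * \<beta>) + K * \<gamma> + D)
        \<le> K ^ 3 * p1 + K\<^sup>2 * p1 + K ^ 3 * p6 + (K\<^sup>2 * p3 + K\<^sup>2 * p4 + K\<^sup>2 * p5) + D\<^sup>2"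
    proof -
      have "D * (K * (t * \<beta>) + K * \<gamma> + D) = K * (D * (t * \<beta>)) + K * (D * \<gamma>) + D\<^sup>2"
        by (simp add: algebra_simps power2_eq_square)
      also have "K * (D * (t * \<beta>)) \<le> K * (K * (K * p1 + p1 + K * p6))"
        using mult_left_mono[OF Ds nn(7)] by (simp only: p)
      also have "K * (D * \<gamma>) \<le> K * (K * (p3 + p4 + p5))"
        using mult_left_mono[OF D\<gamma> nn(7)] by (simp only: p)
      finally show ?thesis by (simp only: distrib_left c)
    qed
    have h2: "2 * K * (N * D) \<le> 2 * (K\<^sup>2 * p1) + 2 * (K\<^sup>2 * p8) + 2 * (K\<^sup>2 * p6)"
      using mult_left_mono[OF ND, of "2 * K"] nn
      by (simp add: distrib_left c p mult.assoc[of 2])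
    have h3: "D\<^sup>2 \<le> 3 * (K ^ 3 * p1) + 3 * (K ^ 3 * p8) + 3 * (K\<^sup>2 * p7)"
      using D2 by (simp add: distrib_left p)
    have h4: "dn \<bullet> dp / \<sigma>\<^sup>2 \<le> 2 * (K ^ 3 * p6) + K\<^sup>2 * p7 + 2 * K * (N * D)"
      using a6 by (simp add: distrib_left c p mult.left_commute[of _ 2] mult.assoc[of 2])
    have h5: "s * (dn \<bullet> Z) / \<sigma>\<^sup>2 \<le> K ^ 3 * p6 + K ^ 3 * p5 + 2 * (K\<^sup>2 * p1) + 2 * (K ^ 3 * p4)"
      using a7 by (simp add: distrib_left c p mult.assoc)
    have h6: "L * G = 14 * (K ^ 3 * p1) + 14 * (K ^ 3 * p2) + 14 * (K ^ 3 * p3)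
        + 14 * (K ^ 3 * p4) + 14 * (K ^ 3 * p5) + 14 * (K ^ 3 * p6) + 14 * (K ^ 3 * p7)
        + 14 * (K ^ 3 * p8)"
      unfolding L_def G_def p[symmetric] by (simp add: distrib_left)
    have g1: "(f' - f) \<bullet> B Z' + D\<^sup>2 / 2 \<le> - (s * \<beta>\<^sup>2) + K * p1 + K * p2
        + (K ^ 3 * p1 + K\<^sup>2 * p1 + K ^ 3 * p6 + (K\<^sup>2 * p3 + K\<^sup>2 * p4 + K\<^sup>2 * p5))
        + (9 / 2 * (K ^ 3 * p1) + 9 / 2 * (K ^ 3 * p8) + 9 / 2 * (K\<^sup>2 * p7))"
      using order_trans[OF a1[folded p] add_left_mono[OF h1]] h3 by linarith
    have g2: "dn \<bullet> dp / \<sigma>\<^sup>2 \<le> 2 * (K ^ 3 * p6) + K\<^sup>2 * p7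
        + (2 * (K\<^sup>2 * p1) + 2 * (K\<^sup>2 * p8) + 2 * (K\<^sup>2 * p6))"
      using order_trans[OF h4 add_left_mono[OF h2]] .
    have g3: "\<rho>\<^sup>2 / (2 * \<sigma>\<^sup>2) \<le> K\<^sup>2 * p7" "dR \<bullet> (X - Xt) / \<sigma>\<^sup>2 \<le> K\<^sup>2 * p5"
        "- (s * (e1 \<bullet> B Z)) \<le> K * p1 + K\<^sup>2 * p4"
      using a3 a4 a5 by (simp_all only: p)
    note kp = k[OF pn(1)] k[OF pn(2)] k[OF pn(3)] k[OF pn(4)] k[OF pn(5)] k[OF pn(6)] k[OF pn(7)]
      k[OF pn(8)]
    have "(f' - f) \<bullet> B Z' + D\<^sup>2 / 2 + \<rho>\<^sup>2 / (2 * \<sigma>\<^sup>2) + dR \<bullet> (X - Xt) / \<sigma>\<^sup>2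
        + - (s * (e1 \<bullet> B Z)) + dn \<bullet> dp / \<sigma>\<^sup>2 + s * (dn \<bullet> Z) / \<sigma>\<^sup>2
      \<le> (- (s * \<beta>\<^sup>2) + K * p1 + K * p2
        + (K ^ 3 * p1 + K\<^sup>2 * p1 + K ^ 3 * p6 + (K\<^sup>2 * p3 + K\<^sup>2 * p4 + K\<^sup>2 * p5))
        + (9 / 2 * (K ^ 3 * p1) + 9 / 2 * (K ^ 3 * p8) + 9 / 2 * (K\<^sup>2 * p7)))
        + K\<^sup>2 * p7 + K\<^sup>2 * p5 + (K * p1 + K\<^sup>2 * p4)
        + (2 * (K ^ 3 * p6) + K\<^sup>2 * p7 + (2 * (K\<^sup>2 * p1) + 2 * (K\<^sup>2 * p8) + 2 * (K\<^sup>2 * p6)))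
        + (K ^ 3 * p6 + K ^ 3 * p5 + 2 * (K\<^sup>2 * p1) + 2 * (K ^ 3 * p4))"
      by (intro add_mono g1 g2 g3 h5)
    also have "\<dots> \<le> - (s * \<beta>\<^sup>2) + (14 * (K ^ 3 * p1) + 14 * (K ^ 3 * p2) + 14 * (K ^ 3 * p3)
        + 14 * (K ^ 3 * p4) + 14 * (K ^ 3 * p5) + 14 * (K ^ 3 * p6) + 14 * (K ^ 3 * p7)
        + 14 * (K ^ 3 * p8))"
      using kp by linarith
    also have "\<dots> = - (s * \<beta>\<^sup>2) + L * G"
      by (simp only: h6)
    finally show ?thesis by simp
  qed
  \<comment> \<open>Each of the three products with \<open>\<beta>\<close> uses
    \<open>t * \<beta>\<^sup>2 / (8 * K)\<close>, together less than half of the available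
    \<open>t * \<beta>\<^sup>2 / K\<close>. Their price \<open>2 * K * L\<^sup>2\<close> is the
    origin of the power \<open>K ^ 7\<close>.\<close>
  have "L * G \<le> t * \<beta>\<^sup>2 / (2 * K) + 1000 * K ^ 7 * (\<rho>\<^sup>2 / t + t * N\<^sup>2 + t * \<gamma>\<^sup>2)"
  proof -
    define q where "q = \<rho>\<^sup>2 / t + t * N\<^sup>2 + t * \<gamma>\<^sup>2"
    have q: "\<rho>\<^sup>2 / t \<ge> 0" "t * N\<^sup>2 \<ge> 0" "t * \<gamma>\<^sup>2 \<ge> 0" using nn by auto
    have K0: "K > 0" and L0: "L \<ge> 0" using K1 by (auto simp: L_def)
    have y1: "L * (t * \<beta> * x) \<le> t * \<beta>\<^sup>2 / (8 * K) + 2 * K * L\<^sup>2 * (t * x\<^sup>2)" for x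
      using mult_left_mono[OF young[of "1 / (8 * K)" \<beta> "L * x"] nn(6)] K0
      by (simp add: power_mult_distrib algebra_simps)
    have y2: "L * (\<rho> * \<beta>) \<le> t * \<beta>\<^sup>2 / (8 * K) + 2 * K * L\<^sup>2 * (\<rho>\<^sup>2 / t)"
      using young[of "t / (8 * K)" \<beta> "L * \<rho>"] K0 t_pos
      by (simp add: power_mult_distrib algebra_simps)
    have y3: "\<rho> * x \<le> \<rho>\<^sup>2 / t + t * x\<^sup>2" for x
    proof -
      have "\<rho> * x \<le> \<rho>\<^sup>2 / t + (t * x\<^sup>2) / 4"
        using young[of "1 / t" \<rho> x] t_pos by (simp add: algebra_simps)
      moreover have "0 \<le> t * x\<^sup>2" using nn by simp
      ultimately show ?thesis by linarith
    qed
    have y4: "t * N * \<gamma> \<le> t * N\<^sup>2 + t * \<gamma>\<^sup>2"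
    proof -
      have "t * (N * \<gamma>) \<le> t * N\<^sup>2 + (t * \<gamma>\<^sup>2) / 4"
        using mult_left_mono[OF young[of 1 N \<gamma>] nn(6)] by (simp add: distrib_left)
      then show ?thesis using q(3) by simp
    qed
    have y5: "\<rho>\<^sup>2 \<le> \<rho>\<^sup>2 / t"
      using t_le'(1) t_pos by (simp add: field_simps mult_left_le_one_le)
    have "L * G \<le> L * (t * \<beta> * N) + L * (\<rho> * \<beta>) + L * (t * \<beta> * \<gamma>) + L * (3 * q)"
    proof -
      have "G \<le> t * \<beta> * N + \<rho> * \<beta> + t * \<beta> * \<gamma> + 3 * q"
        using y3[of \<gamma>] y3[of N] y4 y5 q unfolding G_def q_def by simp
      from mult_left_mono[OF this L0] show ?thesis by (simp only: distrib_left)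
    qed
    also have "\<dots> \<le> 3 * (t * \<beta>\<^sup>2 / (8 * K)) + (2 * K * L\<^sup>2 + 3 * L) * q"
      using y1[of N] y1[of \<gamma>] y2 unfolding q_def by (simp add: algebra_simps)
    also have "(2 * K * L\<^sup>2 + 3 * L) * q \<le> (1000 * K ^ 7) * q"
    proof (rule mult_right_mono)
      have "K ^ 3 \<le> K ^ 7" "0 \<le> K ^ 7" using K1 by (auto intro: power_increasing)
      moreover have "2 * K * L\<^sup>2 = 392 * K ^ 7"
        unfolding L_def by (simp add: power_mult_distrib flip: power_mult power_Suc)
      ultimately show "2 * K * L\<^sup>2 + 3 * L \<le> 1000 * K ^ 7"
        unfolding L_def by linarith
    qed (use q in \<open>simp add: q_def\<close>)
    also have "3 * (t * \<beta>\<^sup>2 / (8 * K)) \<le> t * \<beta>\<^sup>2 / (2 * K)"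
      using K0 nn by (simp add: field_simps)
    finally show ?thesis by (simp add: q_def)
  qed
  moreover have "t * \<beta>\<^sup>2 / K \<le> s * \<beta>\<^sup>2"
    using mult_right_mono[OF s(3), of "\<beta>\<^sup>2"] by simp
  ultimately show ?thesis
    using total bound by (simp add: Z'_def n_def dn_def \<beta>_def \<rho>_def \<gamma>_def)
qed

end

section \<open>The Lyapunov function along a run of Euler steps\<close>

context projected_saddle
begin

text \<open>The constants are chosen such that \<open>c0\<close> times the dissipation in \<open>energy_step\<close> and \<open>c1\<close>
  times the decay in \<open>shadow_step\<close> absorb the error terms of \<open>lyapunov_step\<close>.\<close>

definition c0 :: real where "c0 = 2 * K * (1000 * K ^ 7 + 1)"
definition c1 :: real where "c1 = 2 * K * (1000 * K ^ 7)"
text \<open>\<open>c2\<close> collects the coefficients of \<open>t * N\<^sup>2\<close> in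
  \<open>lyap_descent\<close>; its squared summand comes from Young's inequality for the error of
  the energy.\<close>

definition c2 :: real where "c2 = 1000 * K ^ 7 + c0 * (11 * K ^ 3) + K * (c0 * (11 * K ^ 3))\<^sup>2 + 3 * K * c1"
definition c3 :: real where "c3 = 1 + c0 + 2 * K\<^sup>2 * c1"

text \<open>\<open>Xt\<close> is the exponential average of the past projections since the start of the run.  It lies
  in \<open>S\<close> by convexity, so its inner product with the normal vector has a sign; this is what
  controls the term \<open>B (P Y X) \<bullet> B (R Y X)\<close>, which has no sign of its own.\<close>

definition lyap :: "'e \<Rightarrow> 'g \<Rightarrow> 'e \<Rightarrow> real" where
  "lyap Xt Y X = B (P Y X) \<bullet> B (Xt - P Y X) - nrm Y X \<bullet> (Xt - P Y X) / \<sigma>\<^sup>2 + energy Y X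
     + c0 * energy Y X + c1 * (norm (X - Xt))\<^sup>2"

lemma const_nonneg: "c0 \<ge> 3 * K\<^sup>2" "c1 \<ge> 1" "c2 \<ge> 0" "c3 \<ge> 0"
proof -
  have K: "K ^ 7 \<ge> 1" "K ^ 8 \<ge> K\<^sup>2" "0 \<le> K" "K ^ 8 \<ge> 1"
    using K1 power_increasing[of 2 8 K] by (auto intro: one_le_power)
  have "c0 = 2000 * K ^ 8 + 2 * K" "c1 = 2000 * K ^ 8"
    by (simp_all add: c0_def c1_def algebra_simps flip: power_Suc)
  then show c: "c0 \<ge> 3 * K\<^sup>2" "c1 \<ge> 1"
    using K zero_le_power2[of K] by linarith+
  have "c0 \<ge> 0" using c(1) zero_le_power2[of K] by linarith
  then show "c2 \<ge> 0" "c3 \<ge> 0"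
    using c K by (auto simp: c2_def c3_def)
qed

lemma norm_le_energy: "(norm (B (P Y X)))\<^sup>2 \<le> 2 * energy Y X" "(norm (R Y X))\<^sup>2 \<le> 2 * K\<^sup>2 * energy Y X"
proof -
  show "(norm (B (P Y X)))\<^sup>2 \<le> 2 * energy Y X"
    by (simp add: energy_def)
  have "(norm (R Y X))\<^sup>2 = \<sigma>\<^sup>2 * ((norm (R Y X))\<^sup>2 / \<sigma>\<^sup>2)"
    using \<sigma>_pos by simp
  also have "\<dots> \<le> K\<^sup>2 * (2 * energy Y X)"
  proof (intro mult_mono power_mono)
    show "(norm (R Y X))\<^sup>2 / \<sigma>\<^sup>2 \<le> 2 * energy Y X"
    proof -
      have "2 * (x / 2) = x" for x :: real by simp
      then show ?thesis by (simp only: energy_def) simp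
    qed
  qed (use \<sigma>_le \<sigma>_pos in auto)
  finally show "(norm (R Y X))\<^sup>2 \<le> 2 * K\<^sup>2 * energy Y X" by simp
qed

text \<open>The normal vector term is nonnegative since \<open>Xt \<in> S\<close>. The indefinite
  first term costs at most \<open>3 * K\<^sup>2\<close> times the energy plus
  \<open>(norm (X - Xt))\<^sup>2\<close>, which \<open>c0\<close> and \<open>c1\<close>
  cover.\<close>

lemma energy_le_lyap:
  assumes "Xt \<in> S" shows "energy Y X \<le> lyap Xt Y X"
proof -
  let ?f = "B (P Y X)" and ?E = "energy Y X" and ?\<gamma> = "norm (X - Xt)"
  have E0: "?E \<ge> 0" by (rule energy_nonneg)
  have "nrm Y X \<bullet> (Xt - P Y X) / \<sigma>\<^sup>2 \<le> 0"
    using nrm_normal[OF assms] by (simp add: divide_nonpos_nonneg)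
  moreover have "- (?f \<bullet> B (Xt - P Y X)) \<le> 3 * K\<^sup>2 * ?E + ?\<gamma>\<^sup>2"
  proof -
    have "Xt - P Y X = R Y X - (X - Xt)" by (simp add: R_def)
    then have "norm (B (Xt - P Y X)) \<le> K * norm (R Y X - (X - Xt))"
      using B_le[of "Xt - P Y X"] by (simp only:)
    also have "\<dots> \<le> K * (norm (R Y X) + ?\<gamma>)"
      using K1 by (intro mult_left_mono norm_triangle_ineq4) auto
    finally have *: "norm (B (Xt - P Y X)) \<le> K * (norm (R Y X) + ?\<gamma>)" .
    have "- (?f \<bullet> B (Xt - P Y X)) \<le> norm ?f * norm (B (Xt - P Y X))"
      using norm_cauchy_schwarz[of "- ?f"] by simp
    also have "\<dots> \<le> norm ?f * (K * (norm (R Y X) + ?\<gamma>))"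
      using * by (intro mult_left_mono) auto
    also have "\<dots> = norm (R Y X) * (K * norm ?f) + ?\<gamma> * (K * norm ?f)"
      by (simp add: algebra_simps)
    also have "norm (R Y X) * (K * norm ?f) \<le> (norm (R Y X))\<^sup>2 / 2 + K\<^sup>2 * (norm ?f)\<^sup>2 / 2"
      using young[of "1/2" "norm (R Y X)" "K * norm ?f"] by (simp add: power_mult_distrib)
    also have "?\<gamma> * (K * norm ?f) \<le> ?\<gamma>\<^sup>2 + K\<^sup>2 * (norm ?f)\<^sup>2 / 4"
      using young[of 1 ?\<gamma> "K * norm ?f"] by (simp add: power_mult_distrib)
    finally have "- (?f \<bullet> B (Xt - P Y X)) \<le> (norm (R Y X))\<^sup>2 / 2 + 3 / 4 * (K\<^sup>2 * (norm ?f)\<^sup>2) + ?\<gamma>\<^sup>2"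
      by simp
    moreover have "(norm (R Y X))\<^sup>2 \<le> 2 * (K\<^sup>2 * ?E)" using norm_le_energy(2)[of Y X] by (simp only: mult.assoc)
    moreover have "K\<^sup>2 * (norm ?f)\<^sup>2 \<le> 2 * (K\<^sup>2 * ?E)"
      using mult_left_mono[OF norm_le_energy(1)[of Y X], of "K\<^sup>2"] by (simp add: mult.left_commute)
    moreover have "0 \<le> K\<^sup>2 * ?E" using E0 by simp
    ultimately show ?thesis by linarith
  qed
  moreover have "3 * K\<^sup>2 * ?E \<le> c0 * ?E" "?\<gamma>\<^sup>2 \<le> c1 * ?\<gamma>\<^sup>2"
    using const_nonneg E0 mult_right_mono[of 1 c1 "?\<gamma>\<^sup>2"] by (auto intro: mult_right_mono)
  ultimately show ?thesis unfolding lyap_def by linarith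
qed

text \<open>A run starts with \<open>Xt = P Y X\<close>, where both inner products with
  \<open>Xt - P Y X\<close> vanish.\<close>

lemma lyap_init: "lyap (P Y X) Y X \<le> c3 * energy Y X"
proof -
  have "c1 * (norm (R Y X))\<^sup>2 \<le> c1 * (2 * K\<^sup>2 * energy Y X)"
    using norm_le_energy(2) const_nonneg by (intro mult_left_mono) auto
  then show ?thesis
    by (simp add: lyap_def c3_def R_def linear_0[OF lin] algebra_simps)
qed

end

context euler_step
begin

text \<open>\<open>Xt\<close> follows the same relaxation towards \<open>P Y X\<close> as
  \<open>X\<close>, but unperturbed; so the difference contracts by \<open>1 - t / \<sigma>\<close>
  up to \<open>t *\<^sub>R e2\<close>. As \<open>t / \<sigma> \<le> 1\<close>, the new point is a
  convex combination of points of \<open>S\<close>.\<close>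

lemma shadow_step:
  assumes Xt: "Xt \<in> S"
  defines "Xt' \<equiv> Xt - (t / \<sigma>) *\<^sub>R (Xt - P Y X)"
  shows "Xt' \<in> S"
    and "(norm (X' - Xt'))\<^sup>2 \<le> (norm (X - Xt))\<^sup>2 - t * (norm (X - Xt))\<^sup>2 / (2 * K) + 3 * K * (t * N\<^sup>2)"
proof -
  define s where "s = t / \<sigma>"
  have s: "0 \<le> s" "s \<le> 1" "t / K \<le> s"
    using t_le'(3) t_pos \<sigma>_pos \<sigma>_le by (auto simp: s_def intro!: frac_le)
  have "Xt' = (1 - s) *\<^sub>R Xt + s *\<^sub>R P Y X"
    by (simp add: Xt'_def s_def algebra_simps)
  then show "Xt' \<in> S"
    using convexD[OF convex_S Xt P_in, of "1 - s" s] s by simp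
  define \<gamma> where "\<gamma> = norm (X - Xt)"
  have \<gamma>0: "\<gamma> \<ge> 0" by (simp add: \<gamma>_def)
  have "X' - Xt' = (1 - s) *\<^sub>R (X - Xt) + t *\<^sub>R e2"
    by (simp add: X' Xt'_def s_def R_def algebra_simps)
  then have "norm (X' - Xt') \<le> norm ((1 - s) *\<^sub>R (X - Xt)) + norm (t *\<^sub>R e2)"
    by (simp only: norm_triangle_ineq)
  also have "\<dots> \<le> (1 - s) * \<gamma> + t * N"
    using s e2 t_pos by (simp add: \<gamma>_def)
  finally have "(norm (X' - Xt'))\<^sup>2 \<le> ((1 - s) * \<gamma> + t * N)\<^sup>2"
    by (rule power_mono) simp
  also have "\<dots> = (1 - s) * (1 - s) * \<gamma>\<^sup>2 + (1 - s) * (2 * (t * (\<gamma> * N))) + t * (t * N\<^sup>2)"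
    by (simp add: power2_eq_square algebra_simps)
  also have "\<dots> \<le> (1 - s) * \<gamma>\<^sup>2 + 2 * (t * (\<gamma> * N)) + t * N\<^sup>2"
  proof (intro add_mono)
    show "(1 - s) * (1 - s) * \<gamma>\<^sup>2 \<le> (1 - s) * \<gamma>\<^sup>2"
      using s mult_right_mono[of "(1 - s) * (1 - s)" "1 - s" "\<gamma>\<^sup>2"] by (simp add: mult_left_le)
    show "(1 - s) * (2 * (t * (\<gamma> * N))) \<le> 2 * (t * (\<gamma> * N))"
      using s t_pos \<gamma>0 N_nonneg by (intro mult_left_le_one_le) auto
    show "t * (t * N\<^sup>2) \<le> t * N\<^sup>2"
      using t_le'(1) t_pos by (intro mult_left_le_one_le) auto
  qed
  finally have "(norm (X' - Xt'))\<^sup>2 \<le> (1 - s) * \<gamma>\<^sup>2 + 2 * (t * (\<gamma> * N)) + t * N\<^sup>2" .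
  moreover have "2 * (t * (\<gamma> * N)) \<le> t * \<gamma>\<^sup>2 / (2 * K) + 2 * K * (t * N\<^sup>2)"
    using mult_left_mono[OF young[of "1 / (2 * K)" \<gamma> "2 * N"], of t] t_pos K1
    by (simp add: distrib_left algebra_simps)
  moreover have "(1 - s) * \<gamma>\<^sup>2 \<le> \<gamma>\<^sup>2 - t * \<gamma>\<^sup>2 / (2 * K) - t * \<gamma>\<^sup>2 / (2 * K)"
    using mult_right_mono[OF s(3), of "\<gamma>\<^sup>2"] by (simp add: algebra_simps)
  moreover have "t * N\<^sup>2 \<le> K * (t * N\<^sup>2)"
    using K1 t_pos mult_right_mono[of 1 K "t * N\<^sup>2"] by simp
  ultimately show "(norm (X' - Xt'))\<^sup>2 \<le> (norm (X - Xt))\<^sup>2 - t * (norm (X - Xt))\<^sup>2 / (2 * K) + 3 * K * (t * N\<^sup>2)"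
    unfolding \<gamma>_def[symmetric] by linarith
qed

lemma lyap_descent:
  assumes Xt: "Xt \<in> S"
  shows "lyap (Xt - (t / \<sigma>) *\<^sub>R (Xt - P Y X)) Y' X'
    \<le> lyap Xt Y X - (t * (norm (B r))\<^sup>2 / (4 * K) + (norm dR)\<^sup>2 / t) + c2 * (t * N\<^sup>2)"
proof -
  define \<beta> \<rho> \<gamma> where "\<beta> = norm (B r)" and "\<rho> = norm dR" and "\<gamma> = norm (X - Xt)"
  have K0: "K > 0" using K1 by simp
  have c0: "c0 \<ge> 0" using const_nonneg(1) zero_le_power2[of K] by linarith
  define C where "C = 1000 * K ^ 7"
  define c where "c = c0 * (11 * K ^ 3)"
  have c0K: "c0 * (\<rho>\<^sup>2 / (2 * K * t)) = C * (\<rho>\<^sup>2 / t) + \<rho>\<^sup>2 / t"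
  proof -
    have "2 * K * (C + 1) * (x / (2 * K)) = C * x + x" for x
      using K0 by (simp add: distrib_right)
    from this[of "\<rho>\<^sup>2 / t"] show ?thesis
      by (simp add: c0_def C_def mult.commute)
  qed
  have c1K: "c1 * (t * \<gamma>\<^sup>2 / (2 * K)) = C * (t * \<gamma>\<^sup>2)"
    using K0 by (simp add: c1_def C_def field_simps)
  have e: "c0 * energy Y' X' \<le> c0 * energy Y X - (C * (\<rho>\<^sup>2 / t) + \<rho>\<^sup>2 / t) + c * (t * \<beta> * N) + c * (t * N\<^sup>2)"
  proof -
    have "c0 * energy Y' X' \<le> c0 * (energy Y X - \<rho>\<^sup>2 / (2 * K * t) + 11 * K ^ 3 * (t * \<beta> * N + t * N\<^sup>2))"
      using energy_step c0 unfolding \<beta>_def \<rho>_def by (rule mult_left_mono)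
    also have "\<dots> = c0 * energy Y X - c0 * (\<rho>\<^sup>2 / (2 * K * t)) + c * (t * \<beta> * N) + c * (t * N\<^sup>2)"
      unfolding c_def by (simp only: distrib_left right_diff_distrib mult.assoc)
    finally show ?thesis unfolding c0K .
  qed
  have d: "c1 * (norm (X' - (Xt - (t / \<sigma>) *\<^sub>R (Xt - P Y X))))\<^sup>2
      \<le> c1 * \<gamma>\<^sup>2 - C * (t * \<gamma>\<^sup>2) + 3 * K * c1 * (t * N\<^sup>2)"
  proof -
    have "c1 * (norm (X' - (Xt - (t / \<sigma>) *\<^sub>R (Xt - P Y X))))\<^sup>2
        \<le> c1 * (\<gamma>\<^sup>2 - t * \<gamma>\<^sup>2 / (2 * K) + 3 * K * (t * N\<^sup>2))"
      using shadow_step(2)[OF Xt] const_nonneg(2) unfolding \<gamma>_def by (intro mult_left_mono) auto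
    also have "\<dots> = c1 * \<gamma>\<^sup>2 - c1 * (t * \<gamma>\<^sup>2 / (2 * K)) + 3 * K * c1 * (t * N\<^sup>2)"
      by (simp add: algebra_simps)
    finally show ?thesis unfolding c1K .
  qed
  \<comment> \<open>Half of the decay \<open>t * \<beta>\<^sup>2 / (2 * K)\<close> is spent on the
    linear error of the energy, which was multiplied by \<open>c0\<close>.\<close>
  have y: "c * (t * \<beta> * N) \<le> t * \<beta>\<^sup>2 / (4 * K) + K * c\<^sup>2 * (t * N\<^sup>2)"
    using mult_left_mono[OF young[of "1 / (4 * K)" \<beta> "c * N"], of t] t_pos K0
    by (simp add: power_mult_distrib algebra_simps)
  have "C * (\<rho>\<^sup>2 / t + t * N\<^sup>2 + t * \<gamma>\<^sup>2) = C * (\<rho>\<^sup>2 / t) + C * (t * N\<^sup>2) + C * (t * \<gamma>\<^sup>2)"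
    by (simp only: distrib_left)
  moreover have "c2 * (t * N\<^sup>2) = C * (t * N\<^sup>2) + c * (t * N\<^sup>2) + K * c\<^sup>2 * (t * N\<^sup>2) + 3 * K * c1 * (t * N\<^sup>2)"
    by (simp only: c2_def C_def c_def distrib_right)
  moreover have "t * \<beta>\<^sup>2 / (2 * K) = t * \<beta>\<^sup>2 / (4 * K) + t * \<beta>\<^sup>2 / (4 * K)"
    by simp
  ultimately show ?thesis
    using lyapunov_step[OF Xt] e d y
    unfolding lyap_def \<beta>_def[symmetric] \<rho>_def[symmetric] \<gamma>_def[symmetric] C_def[symmetric]
    by linarith
qed

end

context projected_saddle
begin

text \<open>Telescoping of \<open>lyap_descent\<close>. The point \<open>Xt\<close> moves with each
  step, so the induction only claims that a suitable one exists.\<close>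

lemma run_bound:
  assumes "\<And>i. i < n \<Longrightarrow> euler_step S B b \<sigma> K (Y i) (Y (Suc i)) (e1 i) (X i) (X (Suc i)) (e2 i) (t i) (N i)"
  shows "energy (Y n) (X n) + (\<Sum>i<n. t i * (norm (B (R (Y i) (X i))))\<^sup>2 / (4 * K)
      + (norm (R (Y (Suc i)) (X (Suc i)) - R (Y i) (X i)))\<^sup>2 / t i)
    \<le> c3 * energy (Y 0) (X 0) + c2 * (\<Sum>i<n. t i * (N i)\<^sup>2)"
proof -
  let ?d = "\<lambda>i. t i * (norm (B (R (Y i) (X i))))\<^sup>2 / (4 * K)
      + (norm (R (Y (Suc i)) (X (Suc i)) - R (Y i) (X i)))\<^sup>2 / t i"
  have "\<exists>Xt\<in>S. lyap Xt (Y n) (X n) + (\<Sum>i<n. ?d i)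
      \<le> c3 * energy (Y 0) (X 0) + c2 * (\<Sum>i<n. t i * (N i)\<^sup>2)"
    using assms
  proof (induction n)
    case 0
    show ?case by (intro bexI[of _ "P (Y 0) (X 0)"]) (use P_in lyap_init in auto)
  next
    case (Suc n)
    then obtain Xt where Xt: "Xt \<in> S" "lyap Xt (Y n) (X n) + (\<Sum>i<n. ?d i)
      \<le> c3 * energy (Y 0) (X 0) + c2 * (\<Sum>i<n. t i * (N i)\<^sup>2)" by auto
    interpret euler_step S B b \<sigma> K "Y n" "Y (Suc n)" "e1 n" "X n" "X (Suc n)" "e2 n" "t n" "N n"
      by (rule Suc.prems) simp
    show ?case
      using lyap_descent[OF Xt(1)] shadow_step(1)[OF Xt(1)] Xt(2)
      by (intro bexI[of _ "Xt - (t n / \<sigma>) *\<^sub>R (Xt - P (Y n) (X n))"]) (auto simp: distrib_left)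
  qed
  then obtain Xt where "Xt \<in> S" "lyap Xt (Y n) (X n) + (\<Sum>i<n. ?d i)
      \<le> c3 * energy (Y 0) (X 0) + c2 * (\<Sum>i<n. t i * (N i)\<^sup>2)" by blast
  with energy_le_lyap[of Xt "Y n" "X n"] show ?thesis by simp
qed

end

section \<open>Convergence of the perturbed iteration\<close>

context projected_saddle
begin

text \<open>\<open>nrm_mono\<close> against a zero of F, where \<open>R Ys Xs = 0\<close>. The
  inequality offers a square of \<open>R Y X\<close> but none of \<open>B (P Y X)\<close>, for which
  \<open>dual_drift\<close> is used.\<close>

lemma monotone_at_solution:
  assumes sol: "P Ys Xs = Xs" "B Xs = 0"
  shows "(norm (R Y X))\<^sup>2 / \<sigma> \<le> B (P Y X) \<bullet> (Y - Ys) + (R Y X \<bullet> (X - Xs)) / \<sigma>"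
proof -
  have "nrm Y X - nrm Ys Xs = R Y X + \<sigma> *\<^sub>R adjoint B (Y - Ys)"
    by (simp add: nrm_def R_def sol linear_diff[OF adjoint_linear[OF lin]] algebra_simps)
  moreover have "P Y X - P Ys Xs = (X - Xs) - R Y X"
    by (simp add: R_def sol)
  moreover have "B ((X - Xs) - R Y X) = B (P Y X)"
    by (simp add: R_def linear_diff[OF lin] sol)
  ultimately have "0 \<le> R Y X \<bullet> ((X - Xs) - R Y X) + \<sigma> * ((Y - Ys) \<bullet> B (P Y X))"
    using nrm_mono[of Y X Ys Xs] by (simp add: inner_add_left adj del: inner_diff_right)
  then have "(norm (R Y X))\<^sup>2 / \<sigma> \<le> (R Y X \<bullet> (X - Xs) + \<sigma> * (B (P Y X) \<bullet> (Y - Ys))) / \<sigma>"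
    using \<sigma>_pos by (intro divide_right_mono) (auto simp: inner_diff_right power2_norm_eq_inner inner_commute)
  then show ?thesis using \<sigma>_pos by (simp add: add_divide_distrib)
qed

end

context euler_step
begin

text \<open>In the expanded squares the unperturbed first-order part is nonpositive by
  \<open>monotone_at_solution\<close>. The perturbation is multiplied by the distance itself, so
  this estimate alone does not keep the distance bounded over infinitely many steps.\<close>

lemma fejer_step:
  assumes sol: "P Ys Xs = Xs" "B Xs = 0"
    and D: "(norm (Y - Ys))\<^sup>2 + (norm (X - Xs))\<^sup>2 \<le> D"
  shows "(norm (Y' - Ys))\<^sup>2 + (norm (X' - Xs))\<^sup>2 + 2 * (t * ((norm r)\<^sup>2 / \<sigma>))
    \<le> (norm (Y - Ys))\<^sup>2 + (norm (X - Xs))\<^sup>2 + 4 * (t * N * sqrt D) + 8 * (K\<^sup>2 * N\<^sup>2)"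
proof -
  let ?y = "Y - Ys" and ?x = "X - Xs"
  let ?dy = "t *\<^sub>R (e1 - f)" and ?dx = "t *\<^sub>R (e2 - (1 / \<sigma>) *\<^sub>R r)"
  have K0: "K > 0" "K\<^sup>2 \<ge> 1" using K1 by (auto simp: one_le_power)
  have sq: "norm ?y \<le> sqrt D" "norm ?x \<le> sqrt D"
    using D by (auto intro!: real_le_rsqrt intro: order_trans[rotated, OF D])
  have tN: "t * N \<le> N" using t_le'(1) t_pos N_nonneg by (intro mult_left_le_one_le) auto
  have dy: "(norm ?dy)\<^sup>2 \<le> 4 * (K\<^sup>2 * N\<^sup>2)"
  proof -
    have "norm ?dy \<le> t * norm e1 + t * norm f"
      using norm_triangle_ineq4[of "t *\<^sub>R e1" "t *\<^sub>R f"] t_pos by (simp add: scaleR_diff_right)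
    also have "\<dots> \<le> N + N"
      using order_trans[OF mult_left_mono[OF e1, of t] tN] t_pos f_N by (intro add_mono) auto
    also have "\<dots> \<le> 2 * K * N" using K1 N_nonneg mult_right_mono[of 1 K "2 * N"] by simp
    finally have "(norm ?dy)\<^sup>2 \<le> (2 * K * N)\<^sup>2" by (rule power_mono) simp
    then show ?thesis by (simp add: power_mult_distrib)
  qed
  have dx: "(norm ?dx)\<^sup>2 \<le> 4 * (K\<^sup>2 * N\<^sup>2)"
  proof -
    have "norm ?dx \<le> t * norm e2 + (1 / \<sigma>) * (t * norm r)"
      using norm_triangle_ineq4[of "t *\<^sub>R e2" "t *\<^sub>R ((1 / \<sigma>) *\<^sub>R r)"] t_pos \<sigma>_pos
      by (simp add: scaleR_diff_right)
    also have "\<dots> \<le> K * N + K * N"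
    proof (intro add_mono)
      show "t * norm e2 \<le> K * N"
        using order_trans[OF mult_left_mono[OF e2, of t] tN] t_pos mult_right_mono[OF K1 N_nonneg]
        by simp
      show "1 / \<sigma> * (t * norm r) \<le> K * N"
        using inv_\<sigma>_le R_N t_pos K1 by (intro mult_mono) auto
    qed
    finally have "(norm ?dx)\<^sup>2 \<le> (2 * K * N)\<^sup>2" by (intro power_mono) auto
    then show ?thesis by (simp add: power_mult_distrib)
  qed
  have exp: "(norm (v + d))\<^sup>2 = (norm v)\<^sup>2 + 2 * (v \<bullet> d) + (norm d)\<^sup>2" for v d :: "'c::real_inner"
    by (simp add: power2_norm_eq_inner inner_add_left inner_add_right inner_commute)
  have "(norm (Y' - Ys))\<^sup>2 + (norm (X' - Xs))\<^sup>2
      = (norm (?y + ?dy))\<^sup>2 + (norm (?x + ?dx))\<^sup>2"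
    by (simp add: Y' X' algebra_simps)
  also have "\<dots> = (norm ?y)\<^sup>2 + (norm ?x)\<^sup>2 + 2 * (?y \<bullet> ?dy + ?x \<bullet> ?dx) + ((norm ?dy)\<^sup>2 + (norm ?dx)\<^sup>2)"
    unfolding exp by simp
  finally have main: "(norm (Y' - Ys))\<^sup>2 + (norm (X' - Xs))\<^sup>2
      = (norm ?y)\<^sup>2 + (norm ?x)\<^sup>2 + 2 * (?y \<bullet> ?dy + ?x \<bullet> ?dx) + ((norm ?dy)\<^sup>2 + (norm ?dx)\<^sup>2)" .
  define p q where "p = t * (e1 \<bullet> ?y + e2 \<bullet> ?x)" and "q = t * (f \<bullet> ?y + (r \<bullet> ?x) / \<sigma>)"
  have pq: "?y \<bullet> ?dy + ?x \<bullet> ?dx = p - q"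
  proof -
    have "?y \<bullet> ?dy + ?x \<bullet> ?dx = t * (e1 \<bullet> ?y + e2 \<bullet> ?x) - t * (f \<bullet> ?y + (r \<bullet> ?x) / \<sigma>)"
  proof -
    have "y \<bullet> (t *\<^sub>R (e1 - f)) + x \<bullet> (t *\<^sub>R (e2 - (1 / \<sigma>) *\<^sub>R r))
      = t * (e1 \<bullet> y + e2 \<bullet> x) - t * (f \<bullet> y + (r \<bullet> x) / \<sigma>)" for x y
      by (simp add: inner_diff_right inner_commute algebra_simps)
    then show ?thesis .
    qed
    then show ?thesis by (simp only: p_def q_def)
  qed
  have "t * ((norm r)\<^sup>2 / \<sigma>) \<le> q"
    unfolding q_def using monotone_at_solution[OF sol] t_pos by (intro mult_left_mono) auto
  moreover have "p \<le> 2 * (t * N * sqrt D)"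
  proof -
    have "e1 \<bullet> ?y \<le> N * sqrt D" "e2 \<bullet> ?x \<le> N * sqrt D"
      using e1 e2 sq N_nonneg
      by (auto intro!: order_trans[OF norm_cauchy_schwarz] mult_mono)
    then have "e1 \<bullet> ?y + e2 \<bullet> ?x \<le> 2 * (N * sqrt D)" by linarith
    from mult_left_mono[OF this, of t] t_pos show ?thesis unfolding p_def by (simp add: algebra_simps)
  qed
  moreover have "(norm (Y' - Ys))\<^sup>2 + (norm (X' - Xs))\<^sup>2
      = (norm ?y)\<^sup>2 + (norm ?x)\<^sup>2 + (2 * p - 2 * q) + ((norm ?dy)\<^sup>2 + (norm ?dx)\<^sup>2)"
    unfolding main pq by simp
  ultimately show ?thesis using dx dy by linarith
qed

text \<open>Summation by parts: up to \<open>t *\<^sub>R e1\<close>, the vector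
  \<open>t *\<^sub>R f\<close> is \<open>Y - Y'\<close>. In a sum the first two terms telescope and
  the third is controlled by the variation of \<open>f\<close>.\<close>

lemma dual_drift:
  "t * (norm f)\<^sup>2 = f \<bullet> (Y - Ys) - f' \<bullet> (Y' - Ys) + (f' - f) \<bullet> (Y' - Ys) + t * (f \<bullet> e1)"
proof -
  have "f \<bullet> (Y - Ys) + (f' - f) \<bullet> (Y' - Ys) - f' \<bullet> (Y' - Ys) = - (f \<bullet> (Y' - Y))"
    by (simp add: inner_diff_left inner_diff_right)
  also have "\<dots> = t * (norm f)\<^sup>2 - t * (f \<bullet> e1)"
    by (simp add: Y' inner_diff_right power2_norm_eq_inner algebra_simps)
  finally show ?thesis by simp
qed

end

context projected_saddle
begin

text \<open>\<open>H\<close> bounds the squared distance to the zero; it depends on \<open>T\<close>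
  only through \<open>\<omega> * T\<close>, and \<open>\<omega>\<close> is small for runs that start
  late. \<open>G1\<close> bounds the sum of the squared increments of \<open>B (P Y X)\<close>
  divided by \<open>t i\<close>. In the factor of \<open>H\<close>, \<open>K\<close> stems from the
  part of \<open>R\<close>, \<open>1\<close> from the boundary terms of the summation by parts and
  the last summand from the variation of \<open>B (P Y X)\<close>.\<close>

lemma run_average:
  fixes Y :: "nat \<Rightarrow> 'g" and X :: "nat \<Rightarrow> 'e" and Ys :: 'g and Xs :: 'e
    and t :: "nat \<Rightarrow> real" and A \<omega> G \<phi> \<epsilon> :: real and n :: nat
  defines "T \<equiv> \<Sum>i<n. t i"
    and "H \<equiv> 2 * ((norm (Y 0 - Ys))\<^sup>2 + (norm (X 0 - Xs))\<^sup>2) + 32 * K\<^sup>2 * A\<^sup>2 * (1 + \<omega> * (\<Sum>i<n. t i))"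
    and "G1 \<equiv> 3 * K\<^sup>2 * (G + A\<^sup>2)"
  assumes sol: "P Ys Xs = Xs" "B Xs = 0"
    and step: "\<And>i. i < n \<Longrightarrow> euler_step S B b \<sigma> K (Y i) (Y (Suc i)) (e1 i) (X i) (X (Suc i)) (e2 i) (t i) (A * t i)"
    and A: "A \<ge> 1" and \<omega>: "(\<Sum>i<n. t i ^ 3) \<le> \<omega>" "0 < \<omega>" "\<omega> \<le> 1"
    and G: "(\<Sum>i<n. t i * (norm (B (R (Y i) (X i))))\<^sup>2
      + (norm (R (Y (Suc i)) (X (Suc i)) - R (Y i) (X i)))\<^sup>2 / t i) \<le> G"
    and \<phi>: "\<And>i. i \<le> n \<Longrightarrow> norm (B (P (Y i) (X i))) \<le> \<phi>" and \<epsilon>: "\<epsilon> > 0"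
  shows "(\<Sum>i<n. t i * (2 * energy (Y i) (X i)))
    \<le> \<epsilon> * T + (K + 1 + G1 / (4 * \<epsilon>)) * H + \<phi>\<^sup>2 + \<phi> * A * (1 + \<omega> * T)"
proof -
  define D where "D i = (norm (Y i - Ys))\<^sup>2 + (norm (X i - Xs))\<^sup>2" for i
  define Dm where "Dm = Max (D ` {..n})"
  define U where "U = (\<Sum>i<n. (t i)\<^sup>2)"
  define f where "f i = B (P (Y i) (X i))" for i
  define r where "r i = R (Y i) (X i)" for i
  have tpos: "t i > 0" if "i < n" for i
    using step[OF that] by (simp add: euler_step_def euler_step_axioms_def)
  have T0: "T \<ge> 0" and U0: "U \<ge> 0"
    unfolding T_def U_def using tpos by (auto intro!: sum_nonneg simp: less_imp_le)
  have D_le: "D i \<le> Dm" if "i \<le> n" for i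
    unfolding Dm_def using that by (intro Max_ge) auto
  have D0: "D i \<ge> 0" for i by (simp add: D_def)
  have Dm0: "Dm \<ge> 0" using D0[of 0] D_le[of 0] by simp
  \<comment> \<open>Cauchy-Schwarz for \<open>(t i)\<^sup>2 = sqrt (t i) * sqrt (t i ^ 3)\<close>:
    the sum of squares has no fixed bound, but it is of order
    \<open>sqrt (\<omega> * T)\<close>.\<close>
  have U_sq: "U\<^sup>2 \<le> \<omega> * T"
  proof -
    have "U = (\<Sum>i<n. sqrt (t i) * sqrt (t i ^ 3))"
      unfolding U_def using tpos
      by (intro sum.cong refl) (simp flip: real_sqrt_mult power_Suc add: less_imp_le power2_eq_square power4_eq_xxxx mult.assoc real_sqrt_mult)
    then have "U\<^sup>2 \<le> (\<Sum>i<n. (sqrt (t i))\<^sup>2) * (\<Sum>i<n. (sqrt (t i ^ 3))\<^sup>2)"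
      by (simp only: Cauchy_Schwarz_ineq_sum)
    also have "\<dots> = T * (\<Sum>i<n. t i ^ 3)"
      unfolding T_def using tpos
      by (intro arg_cong2[where f = times] sum.cong refl) (auto simp: less_imp_le)
    also have "\<dots> \<le> T * \<omega>" using \<omega> T0 by (intro mult_left_mono)
    finally show ?thesis by (simp add: mult.commute)
  qed
  have U_le: "U \<le> 1 + \<omega> * T"
    using U_sq young[of 1 U 1] by simp
  define Q where "Q = K\<^sup>2 * A\<^sup>2 * (1 + \<omega> * T)"
  have KA: "K\<^sup>2 * A\<^sup>2 \<ge> A\<^sup>2"
    using K1 mult_right_mono[of 1 "K\<^sup>2" "A\<^sup>2"] by (simp add: one_le_power)
  \<comment> \<open>The unknown maximal distance enters through \<open>sqrt Dm\<close>; Young's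
    inequality makes it \<open>Dm / 2\<close>, which \<open>Dm_le\<close> absorbs.\<close>
  have cum: "D m + (\<Sum>i<m. 2 * (t i * ((norm (r i))\<^sup>2 / \<sigma>))) \<le> D 0 + Dm / 2 + 16 * Q" if "m \<le> n" for m
  proof -
    have "D m + (\<Sum>i<m. 2 * (t i * ((norm (r i))\<^sup>2 / \<sigma>)))
        \<le> D 0 + (\<Sum>i<m. 4 * (t i * (A * t i) * sqrt Dm) + 8 * (K\<^sup>2 * (A * t i)\<^sup>2))"
      using that
    proof (induction m)
      case (Suc m)
      interpret euler_step S B b \<sigma> K "Y m" "Y (Suc m)" "e1 m" "X m" "X (Suc m)" "e2 m" "t m" "A * t m"
        using Suc.prems by (intro step) auto
      have "D (Suc m) + 2 * (t m * ((norm (r m))\<^sup>2 / \<sigma>))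
          \<le> D m + 4 * (t m * (A * t m) * sqrt Dm) + 8 * (K\<^sup>2 * (A * t m)\<^sup>2)"
        using fejer_step[OF sol, of Dm] D_le[of m] Suc.prems by (simp add: D_def r_def)
      with Suc show ?case by simp
    qed simp
    also have "(\<Sum>i<m. 4 * (t i * (A * t i) * sqrt Dm) + 8 * (K\<^sup>2 * (A * t i)\<^sup>2))
        = (4 * A * sqrt Dm + 8 * K\<^sup>2 * A\<^sup>2) * (\<Sum>i<m. (t i)\<^sup>2)"
      by (simp add: sum_distrib_left sum.distrib algebra_simps power2_eq_square)
    also have "\<dots> \<le> (4 * A * sqrt Dm + 8 * K\<^sup>2 * A\<^sup>2) * U"
      unfolding U_def using that A Dm0 by (intro mult_left_mono sum_mono2) auto
    also have "\<dots> = sqrt Dm * (4 * A * U) + 8 * (K\<^sup>2 * A\<^sup>2 * U)"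
      by (simp add: algebra_simps)
    also have "sqrt Dm * (4 * A * U) \<le> Dm / 2 + 8 * (A\<^sup>2 * U\<^sup>2)"
      using young[of "1/2" "sqrt Dm" "4 * A * U"] Dm0 by (simp add: power_mult_distrib)
    also have "A\<^sup>2 * U\<^sup>2 \<le> Q"
      unfolding Q_def using KA U_sq T0 \<omega> by (intro mult_mono) auto
    also have "K\<^sup>2 * A\<^sup>2 * U \<le> Q"
      unfolding Q_def using U_le by (intro mult_left_mono) auto
    finally show ?thesis by simp
  qed
  have Dm_le: "Dm \<le> H"
  proof -
    have "D m \<le> D 0 + Dm / 2 + 16 * Q" if "m \<le> n" for m
    proof -
      have "0 \<le> (\<Sum>i<m. 2 * (t i * ((norm (r i))\<^sup>2 / \<sigma>)))"
        using tpos that \<sigma>_pos by (intro sum_nonneg) (auto simp: less_imp_le)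
      with cum[OF that] show ?thesis by linarith
    qed
    then have "Dm \<le> D 0 + Dm / 2 + 16 * Q"
      unfolding Dm_def by (subst Max_le_iff) auto
    then show ?thesis by (simp add: H_def D_def Q_def T_def)
  qed
  have sum_r: "(\<Sum>i<n. t i * (norm (r i))\<^sup>2 / \<sigma>\<^sup>2) \<le> K * H"
  proof -
    have "(\<Sum>i<n. 2 * (t i * ((norm (r i))\<^sup>2 / \<sigma>))) \<le> H"
    proof -
      have "(\<Sum>i<n. 2 * (t i * ((norm (r i))\<^sup>2 / \<sigma>))) \<le> D 0 + Dm / 2 + 16 * Q"
        using cum[of n] D0[of n] by simp
      also have "\<dots> \<le> D 0 + H / 2 + 16 * Q" using Dm_le by simp
      also have "\<dots> = H" by (simp add: H_def D_def Q_def T_def)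
      finally show ?thesis .
    qed
    moreover have "0 \<le> (\<Sum>i<n. 2 * (t i * ((norm (r i))\<^sup>2 / \<sigma>)))"
      using tpos \<sigma>_pos by (intro sum_nonneg) (auto simp: less_imp_le)
    moreover have "(\<Sum>i<n. t i * (norm (r i))\<^sup>2 / \<sigma>\<^sup>2) = (1 / \<sigma>) * ((\<Sum>i<n. 2 * (t i * ((norm (r i))\<^sup>2 / \<sigma>))) / 2)"
      by (simp add: sum_distrib_left sum_divide_distrib power2_eq_square)
    moreover have "\<dots> \<le> K * H"
      using calculation inv_\<sigma>_le K1 \<sigma>_pos by (intro mult_mono) auto
    ultimately show ?thesis by simp
  qed
  define s where "s = (\<Sum>i<n. norm (f (Suc i) - f i))"
  have \<phi>0: "\<phi> \<ge> 0" using \<phi>[of 0] norm_ge_zero order_trans by blast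
  have Y_le: "norm (Y i - Ys) \<le> sqrt Dm" if "i \<le> n" for i
    using D_le[OF that] by (intro real_le_rsqrt) (simp add: D_def order_trans[rotated])
  have G0: "G \<ge> 0"
    using tpos by (intro order_trans[OF sum_nonneg G]) (auto simp: less_imp_le)
  have "A\<^sup>2 > 0" using A by simp
  then have G1: "G1 > 0" using G0 K1 by (simp add: G1_def add_nonneg_pos)
  \<comment> \<open>\<open>norm_df\<close> bounds the increments of \<open>f\<close> by quantities
    whose squares, divided by \<open>t i\<close>, sum to at most \<open>G\<close> and
    \<open>A\<^sup>2\<close>; so the total variation is of order \<open>sqrt T\<close>.\<close>
  have s_sq: "s\<^sup>2 \<le> T * G1"
  proof -
    have "s = (\<Sum>i<n. sqrt (t i) * (norm (f (Suc i) - f i) / sqrt (t i)))"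
      unfolding s_def using tpos by (intro sum.cong refl) (force simp: less_imp_le)
    then have "s\<^sup>2 \<le> (\<Sum>i<n. (sqrt (t i))\<^sup>2) * (\<Sum>i<n. (norm (f (Suc i) - f i) / sqrt (t i))\<^sup>2)"
      by (simp only: Cauchy_Schwarz_ineq_sum)
    also have "\<dots> = T * (\<Sum>i<n. (norm (f (Suc i) - f i))\<^sup>2 / t i)"
      unfolding T_def using tpos
      by (intro arg_cong2[where f = times] sum.cong refl) (auto simp: less_imp_le power_divide)
    also have "\<dots> \<le> T * G1"
    proof (rule mult_left_mono[OF _ T0])
      have "(norm (f (Suc i) - f i))\<^sup>2 / t i \<le> 3 * K\<^sup>2 * (t i * (norm (B (r i)))\<^sup>2
          + (norm (r (Suc i) - r i))\<^sup>2 / t i + A\<^sup>2 * t i ^ 3)" if i: "i < n" for i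
      proof -
        interpret euler_step S B b \<sigma> K "Y i" "Y (Suc i)" "e1 i" "X i" "X (Suc i)" "e2 i" "t i" "A * t i"
          using i by (rule step)
        have "(norm (f (Suc i) - f i))\<^sup>2
            \<le> (K * (t i * norm (B (r i)) + t i * (A * t i) + norm (r (Suc i) - r i)))\<^sup>2"
          unfolding f_def r_def using norm_df by (intro power_mono) auto
        also have "\<dots> \<le> K\<^sup>2 * (3 * ((t i * norm (B (r i)))\<^sup>2 + (t i * (A * t i))\<^sup>2 + (norm (r (Suc i) - r i))\<^sup>2))"
          unfolding power_mult_distrib[of K] by (intro mult_left_mono power2_sum3_le) auto
        finally have "(norm (f (Suc i) - f i))\<^sup>2 / t i
            \<le> K\<^sup>2 * (3 * ((t i * norm (B (r i)))\<^sup>2 + (t i * (A * t i))\<^sup>2 + (norm (r (Suc i) - r i))\<^sup>2)) / t i"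
          using tpos[OF i] by (intro divide_right_mono) auto
        also have "\<dots> = 3 * K\<^sup>2 * (t i * (norm (B (r i)))\<^sup>2
          + (norm (r (Suc i) - r i))\<^sup>2 / t i + A\<^sup>2 * t i ^ 3)"
          using tpos[OF i] by (simp add: field_simps power2_eq_square power3_eq_cube)
        finally show ?thesis .
      qed
      then have "(\<Sum>i<n. (norm (f (Suc i) - f i))\<^sup>2 / t i) \<le> (\<Sum>i<n. 3 * K\<^sup>2 * (t i * (norm (B (r i)))\<^sup>2
          + (norm (r (Suc i) - r i))\<^sup>2 / t i + A\<^sup>2 * t i ^ 3))"
        by (intro sum_mono) auto
      also have "\<dots> = 3 * K\<^sup>2 * ((\<Sum>i<n. t i * (norm (B (r i)))\<^sup>2
          + (norm (r (Suc i) - r i))\<^sup>2 / t i) + A\<^sup>2 * (\<Sum>i<n. t i ^ 3))"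
        by (simp add: sum_distrib_left sum.distrib distrib_left)
      also have "\<dots> \<le> 3 * K\<^sup>2 * (G + A\<^sup>2 * 1)"
        using G \<omega> by (intro mult_left_mono add_mono) (auto simp: r_def)
      finally show "(\<Sum>i<n. (norm (f (Suc i) - f i))\<^sup>2 / t i) \<le> G1" by (simp add: G1_def)
    qed
    finally show ?thesis .
  qed
  have sum_f: "(\<Sum>i<n. t i * (norm (f i))\<^sup>2) \<le> 2 * (\<phi> * sqrt Dm) + sqrt Dm * s + \<phi> * A * U"
  proof -
    have g_le: "\<bar>f i \<bullet> (Y i - Ys)\<bar> \<le> \<phi> * sqrt Dm" if "i \<le> n" for i
      using \<phi>[OF that] Y_le[OF that] \<phi>0
      by (intro order_trans[OF Cauchy_Schwarz_ineq2] mult_mono) (auto simp: f_def)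
    have "(\<Sum>i<n. t i * (norm (f i))\<^sup>2) \<le> (\<Sum>i<n. (f i \<bullet> (Y i - Ys) - f (Suc i) \<bullet> (Y (Suc i) - Ys))
        + sqrt Dm * norm (f (Suc i) - f i) + \<phi> * A * (t i)\<^sup>2)"
    proof (rule sum_mono)
      fix i assume "i \<in> {..<n}"
      then have i: "i < n" by simp
      interpret euler_step S B b \<sigma> K "Y i" "Y (Suc i)" "e1 i" "X i" "X (Suc i)" "e2 i" "t i" "A * t i"
        using i by (rule step)
      have "(f (Suc i) - f i) \<bullet> (Y (Suc i) - Ys) \<le> norm (f (Suc i) - f i) * sqrt Dm"
        using Y_le[of "Suc i"] i by (intro order_trans[OF norm_cauchy_schwarz] mult_left_mono) auto
      moreover have "t i * (f i \<bullet> e1 i) \<le> t i * (\<phi> * (A * t i))"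
        using \<phi>[of i] e1 i tpos[OF i] \<phi>0 unfolding f_def
        by (intro mult_left_mono order_trans[OF norm_cauchy_schwarz] mult_mono) auto
      ultimately show "t i * (norm (f i))\<^sup>2 \<le> (f i \<bullet> (Y i - Ys) - f (Suc i) \<bullet> (Y (Suc i) - Ys))
        + sqrt Dm * norm (f (Suc i) - f i) + \<phi> * A * (t i)\<^sup>2"
        using dual_drift[of Ys] unfolding f_def by (simp add: power2_eq_square algebra_simps)
    qed
    also have "\<dots> = (f 0 \<bullet> (Y 0 - Ys) - f n \<bullet> (Y n - Ys)) + sqrt Dm * s + \<phi> * A * U"
      unfolding s_def U_def sum.distrib sum_distrib_left
      using sum_lessThan_telescope'[of "\<lambda>i. f i \<bullet> (Y i - Ys)" n] by simp
    also have "f 0 \<bullet> (Y 0 - Ys) - f n \<bullet> (Y n - Ys) \<le> 2 * (\<phi> * sqrt Dm)"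
      using g_le[of 0] g_le[of n] by linarith
    finally show ?thesis by simp
  qed
  have "2 * (\<phi> * sqrt Dm) \<le> \<phi>\<^sup>2 + Dm"
    using young[of "1/2" \<phi> "sqrt Dm"] Dm0 by simp
  moreover have "sqrt Dm * s \<le> \<epsilon> * T + G1 / (4 * \<epsilon>) * Dm"
  proof -
    have "s * sqrt Dm \<le> (\<epsilon> / G1) * s\<^sup>2 + (sqrt Dm)\<^sup>2 / (4 * (\<epsilon> / G1))"
      using G1 \<epsilon> by (intro young) auto
    also have "(\<epsilon> / G1) * s\<^sup>2 \<le> (\<epsilon> / G1) * (T * G1)"
      using s_sq G1 \<epsilon> by (intro mult_left_mono) auto
    finally show ?thesis using G1 Dm0 by (simp add: mult.commute)
  qed
  moreover have "\<phi> * A * U \<le> \<phi> * A * (1 + \<omega> * T)"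
    using U_le \<phi>0 A by (intro mult_left_mono) auto
  moreover have "G1 / (4 * \<epsilon>) * Dm \<le> G1 / (4 * \<epsilon>) * H"
    using Dm_le G1 \<epsilon> by (intro mult_left_mono) auto
  moreover have "(\<Sum>i<n. t i * (2 * energy (Y i) (X i)))
      = (\<Sum>i<n. t i * (norm (f i))\<^sup>2) + (\<Sum>i<n. t i * (norm (r i))\<^sup>2 / \<sigma>\<^sup>2)"
    unfolding sum.distrib[symmetric]
    by (intro sum.cong refl) (simp add: energy_def f_def r_def field_simps)
  ultimately show ?thesis
    using sum_f sum_r Dm_le unfolding distrib_right by linarith
qed

end

text \<open>\<open>D\<close> marks contraction steps; between them the sequence grows at most by a
  factor near 1 and a small summand. Every late index is reached from the last contraction before
  it, so a bound \<open>M\<close> on the history improves to \<open>q * M + \<eta>\<close>, where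
  \<open>q\<close> lies between \<open>\<nu>\<close> and 1 to leave room for the growth.\<close>

lemma nonmonotone_decrease:
  fixes \<phi> vs :: "nat \<Rightarrow> real" and \<nu> :: real and \<zeta> :: nat and D :: "nat \<Rightarrow> bool"
  assumes \<phi>: "\<And>k. \<phi> k \<ge> 0" and \<nu>: "0 < \<nu>" "\<nu> < 1" and \<zeta>: "\<zeta> \<ge> 1" and vs: "vs \<longlonglongrightarrow> 0"
    and dec: "\<And>k. k \<ge> 1 \<Longrightarrow> D k \<Longrightarrow> \<phi> (Suc k) \<le> \<nu> * (MAX j\<in>{max 1 (k + 1 - \<zeta>)..k}. \<phi> j) + vs k"
    and run: "\<And>\<epsilon>. \<epsilon> > 0 \<Longrightarrow> \<exists>k1. \<forall>k0\<ge>k1. \<forall>n. (\<forall>i<n. \<not> D (k0 + i)) \<longrightarrow> \<phi> (k0 + n) \<le> (1 + \<epsilon>) * \<phi> k0 + \<epsilon>"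
    and inf: "\<exists>\<^sub>\<infinity>k. D k"
  shows "\<phi> \<longlonglongrightarrow> 0"
proof -
  define q where "q = (1 + \<nu>) / 2"
  have q: "0 < q" "q < 1" using \<nu> by (auto simp: q_def)
  have step: "\<exists>k1\<ge>m. \<forall>j>k1. \<forall>M\<ge>0. (\<forall>i\<ge>k1 + 1 - \<zeta>. i < j \<longrightarrow> \<phi> i \<le> M) \<longrightarrow> \<phi> j \<le> q * M + \<eta>"
    if "\<eta> > 0" for \<eta> m
  proof -
    \<comment> \<open>The second bound gives \<open>(1 + \<epsilon>) * \<nu> \<le> q\<close>; the
      first lets the summands add up to at most \<open>\<eta>\<close>.\<close>
    define \<epsilon> where "\<epsilon> = min (\<eta> / 2) ((1 - \<nu>) / 2)"
    have \<epsilon>: "\<epsilon> > 0" "\<epsilon> \<le> \<eta> / 2" "\<epsilon> \<le> (1 - \<nu>) / 2"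
      using that \<nu> unfolding \<epsilon>_def by simp_all (simp add: min_def)
    then have "\<epsilon> \<le> 1" using \<nu> by simp
    obtain k1 where k1: "\<And>k0 n. k0 \<ge> k1 \<Longrightarrow> (\<And>i. i < n \<Longrightarrow> \<not> D (k0 + i)) \<Longrightarrow> \<phi> (k0 + n) \<le> (1 + \<epsilon>) * \<phi> k0 + \<epsilon>"
      using run[OF \<epsilon>(1)] by metis
    have "eventually (\<lambda>k. vs k < \<eta> / 4) sequentially"
      using order_tendstoD(2)[OF vs, of "\<eta> / 4"] that by simp
    then obtain k2 where k2: "\<And>k. k \<ge> k2 \<Longrightarrow> vs k < \<eta> / 4"
      unfolding eventually_sequentially by blast
    obtain k3 where k3: "k3 \<ge> Max {1, m, k1, k2}" "D k3"
      using inf unfolding INFM_nat_le by blast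
    have "\<phi> j \<le> q * M + \<eta>" if j: "j > k3" and M: "M \<ge> 0" "\<forall>i\<ge>k3 + 1 - \<zeta>. i < j \<longrightarrow> \<phi> i \<le> M" for j M
    proof -
      define l where "l = Max {i. i < j \<and> D i}"
      have fin: "finite {i. i < j \<and> D i}" and ne: "k3 \<in> {i. i < j \<and> D i}"
        using j k3 by auto
      have "l \<in> {i. i < j \<and> D i}"
        unfolding l_def using Max_in[OF fin] ne by blast
      then have l: "l < j" "D l" "l \<ge> k3"
        using Max_ge[OF fin ne] by (auto simp: l_def)
      have nD: "\<not> D i" if "l < i" "i < j" for i
      proof
        assume "D i"
        then have "i \<le> l" unfolding l_def using that by (intro Max_ge[OF fin]) simp
        with that show False by simp
      qed
      have l1: "l \<ge> 1" "l \<ge> k1" "l \<ge> k2" using l(3) k3(1) by auto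
      have "(MAX j\<in>{max 1 (l + 1 - \<zeta>)..l}. \<phi> j) \<le> M"
        using l l1 M \<zeta> by (subst Max_le_iff) auto
      then have "\<phi> (Suc l) \<le> \<nu> * M + vs l"
        using dec[OF l1(1) l(2)] \<nu> by (meson add_right_mono less_imp_le mult_left_mono order_trans)
      also have "vs l \<le> \<eta> / 4" using k2[OF l1(3)] by simp
      finally have Sl: "\<phi> (Suc l) \<le> \<nu> * M + \<eta> / 4" by simp
      have "\<phi> (Suc l + (j - Suc l)) \<le> (1 + \<epsilon>) * \<phi> (Suc l) + \<epsilon>"
        using l l1 nD by (intro k1) auto
      also have "\<dots> \<le> (1 + \<epsilon>) * (\<nu> * M + \<eta> / 4) + \<epsilon>"
        using Sl \<epsilon> by (intro add_right_mono mult_left_mono) auto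
      also have "\<dots> = ((1 + \<epsilon>) * \<nu>) * M + (1 + \<epsilon>) * (\<eta> / 4) + \<epsilon>"
        by (simp add: algebra_simps)
      also have "(1 + \<epsilon>) * \<nu> * M \<le> q * M"
      proof (rule mult_right_mono[OF _ M(1)])
        have "\<epsilon> * \<nu> \<le> \<epsilon>" using \<epsilon> \<nu> by (intro mult_left_le) auto
        then have "(1 + \<epsilon>) * \<nu> \<le> \<nu> + \<epsilon>" by (simp add: distrib_right)
        then show "(1 + \<epsilon>) * \<nu> \<le> q" using \<epsilon>(3) unfolding q_def by simp
      qed
      also have "(1 + \<epsilon>) * (\<eta> / 4) \<le> 2 * (\<eta> / 4)"
        using \<open>\<epsilon> \<le> 1\<close> \<open>\<eta> > 0\<close> by (intro mult_right_mono) auto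
      finally show ?thesis using l(1) \<epsilon>(2) by simp
    qed
    moreover have "k3 \<ge> m" using k3(1) by simp
    ultimately show ?thesis by blast
  qed
  \<comment> \<open>Boundedness by strong induction: any \<open>M\<close> of at least
    \<open>1 / (1 - q)\<close> satisfies \<open>q * M + 1 \<le> M\<close>.\<close>
  have "\<exists>M\<ge>0. \<forall>j. \<phi> j \<le> M"
  proof -
    obtain k1 where k1: "\<And>j M. j > k1 \<Longrightarrow> M \<ge> 0 \<Longrightarrow> (\<And>i. i \<ge> k1 + 1 - \<zeta> \<Longrightarrow> i < j \<Longrightarrow> \<phi> i \<le> M) \<Longrightarrow> \<phi> j \<le> q * M + 1"
      using step[of 1 0] by auto
    define M where "M = max (Max (\<phi> ` {..k1})) (1 / (1 - q))"
    have M: "\<phi> i \<le> M" if "i \<le> k1" for i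
      unfolding M_def using that by (intro max.coboundedI1 Max_ge) auto
    have M0: "M \<ge> 0" using M[of 0] \<phi>[of 0] by simp
    have "1 / (1 - q) \<le> M" by (simp add: M_def)
    then have qM: "q * M + 1 \<le> M" using q by (simp add: field_simps)
    have "\<phi> j \<le> M" for j
    proof (induction j rule: less_induct)
      case (less j)
      show ?case
      proof (cases "j \<le> k1")
        case False
        then have "\<phi> j \<le> q * M + 1" using M0 less by (intro k1) auto
        with qM show ?thesis by simp
      qed (rule M)
    qed
    with M0 show ?thesis by blast
  qed
  then obtain M0 where M0: "M0 \<ge> 0" "\<And>j. \<phi> j \<le> M0" by blast
  \<comment> \<open>The eventual upper bounds; their infimum \<open>L\<close> is the limes superior,
    and \<open>V_step\<close> will give \<open>L \<le> q * L\<close>.\<close>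
  define V where "V = {M. M \<ge> 0 \<and> eventually (\<lambda>j. \<phi> j \<le> M) sequentially}"
  have V_step: "q * M + \<eta> \<in> V" if "M \<in> V" "\<eta> > 0" for M \<eta>
  proof -
    obtain m where m: "\<And>j. j \<ge> m \<Longrightarrow> \<phi> j \<le> M"
      using \<open>M \<in> V\<close> unfolding V_def eventually_sequentially by blast
    have "M \<ge> 0" using \<open>M \<in> V\<close> by (simp add: V_def)
    \<comment> \<open>The shift by \<open>\<zeta>\<close> keeps the whole history window beyond
      \<open>m\<close>, where \<open>M\<close> is a bound.\<close>
    obtain k1 where k1: "k1 \<ge> m + \<zeta>"
      "\<And>j M. j > k1 \<Longrightarrow> M \<ge> 0 \<Longrightarrow> (\<And>i. i \<ge> k1 + 1 - \<zeta> \<Longrightarrow> i < j \<Longrightarrow> \<phi> i \<le> M) \<Longrightarrow> \<phi> j \<le> q * M + \<eta>"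
      using step[OF \<open>\<eta> > 0\<close>, of "m + \<zeta>"] by blast
    have "\<phi> j \<le> q * M + \<eta>" if "j > k1" for j
      using that \<open>M \<ge> 0\<close> k1(1) by (intro k1(2) m) auto
    then have "eventually (\<lambda>j. \<phi> j \<le> q * M + \<eta>) sequentially"
      unfolding eventually_sequentially by (intro exI[of _ "Suc k1"]) auto
    then show ?thesis using \<open>M \<ge> 0\<close> \<open>\<eta> > 0\<close> q by (simp add: V_def)
  qed
  have Vne: "M0 \<in> V" using M0 by (simp add: V_def)
  have Vbdd: "bdd_below V" by (auto simp: V_def intro: bdd_belowI[of _ 0])
  define L where "L = Inf V"
  have L0: "L \<ge> 0" unfolding L_def using Vne by (intro cInf_greatest) (auto simp: V_def)
  have "L \<le> q * L"
  proof (rule field_le_epsilon)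
    fix e :: real assume "e > 0"
    then obtain M where M: "M \<in> V" "M < L + e / 2"
      using cInf_lessD[of V "L + e / 2"] Vne unfolding L_def by auto
    have "L \<le> q * M + e / 2"
      unfolding L_def using V_step[OF M(1), of "e / 2"] \<open>e > 0\<close> Vbdd by (intro cInf_lower) auto
    also have "q * M \<le> q * (L + e / 2)" using M q by (intro mult_left_mono) auto
    also have "\<dots> \<le> q * L + e / 2"
      using q \<open>e > 0\<close> by (simp add: distrib_left mult_left_le_one_le)
    finally show "L \<le> q * L + e" by simp
  qed
  then have "L = 0" using L0 q by (smt (verit) mult_left_le_one_le mult_le_cancel_right1)
  show ?thesis
  proof (rule order_tendstoI)
    fix a :: real assume "a < 0"
    then show "eventually (\<lambda>j. a < \<phi> j) sequentially" using less_le_trans[OF _ \<phi>] by simp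
  next
    fix a :: real assume "0 < a"
    then obtain M where "M \<in> V" "M < a"
      using cInf_lessD[of V a] Vne \<open>L = 0\<close> unfolding L_def by auto
    then show "eventually (\<lambda>j. \<phi> j < a) sequentially"
      unfolding V_def by (auto elim: eventually_mono)
  qed
qed

lemma summable_tail_le:
  fixes a :: "nat \<Rightarrow> real"
  assumes "summable a" "\<And>k. a k \<ge> 0" "\<omega> > 0"
  obtains k1 where "\<And>k0 n. k0 \<ge> k1 \<Longrightarrow> (\<Sum>i<n. a (k0 + i)) \<le> \<omega>"
proof -
  obtain k1 where k1: "\<And>k0. k0 \<ge> k1 \<Longrightarrow> norm (\<Sum>i. a (i + k0)) < \<omega>"
    using suminf_exist_split[OF \<open>\<omega> > 0\<close> \<open>summable a\<close>] by blast
  have "(\<Sum>i<n. a (k0 + i)) \<le> \<omega>" if "k0 \<ge> k1" for k0 n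
  proof -
    have "summable (\<lambda>i. a (i + k0))" using assms(1) by (simp add: summable_iff_shift)
    then have "(\<Sum>i<n. a (i + k0)) \<le> (\<Sum>i. a (i + k0))"
      using assms(2) by (intro sum_le_suminf) auto
    with k1[OF that] show ?thesis by (simp add: add.commute)
  qed
  then show ?thesis by (rule that)
qed

text \<open>The relation between consecutive iterates is left open; \<open>euler_at\<close> singles
  out the steps of type (D2). \<open>K \<le> c\<^sub>N\<close> lets the bound of the perturbation
  also cover the second-order quantities of \<open>euler_step\<close>.\<close>

locale perturbed_iteration = projected_saddle S B b \<sigma> K
  for S :: "'e::euclidean_space set" and B :: "'e \<Rightarrow> 'g::euclidean_space" and b \<sigma> K +
  fixes Y :: "nat \<Rightarrow> 'g" and X :: "nat \<Rightarrow> 'e" and t :: "nat \<Rightarrow> real" and c\<^sub>N :: real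
  assumes t_pos: "t k > 0" and t_lim: "t \<longlonglongrightarrow> 0"
    and t_cube: "summable (\<lambda>k. t k ^ 3)" and t_div: "\<not> summable t" and c\<^sub>N: "K \<le> c\<^sub>N"
begin

abbreviation "en k \<equiv> energy (Y k) (X k)"

definition euler_at :: "nat \<Rightarrow> bool" where
  "euler_at k \<longleftrightarrow> (\<exists>e1 e2. Y (Suc k) = Y k + t k *\<^sub>R (e1 - B (P (Y k) (X k)))
     \<and> X (Suc k) = X k + t k *\<^sub>R (e2 - (1 / \<sigma>) *\<^sub>R R (Y k) (X k))
     \<and> norm e1 \<le> c\<^sub>N * t k * (1 + sqrt (2 * en k)) \<and> norm e2 \<le> c\<^sub>N * t k * (1 + sqrt (2 * en k)))"

lemma euler_at_step:
  assumes "euler_at k" "t k \<le> 1 / (8 * K ^ 3)" "c\<^sub>N * t k * (1 + sqrt (2 * en k)) \<le> N"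
  shows "\<exists>e1 e2. euler_step S B b \<sigma> K (Y k) (Y (Suc k)) e1 (X k) (X (Suc k)) e2 (t k) N"
proof -
  obtain e1 e2 where e: "Y (Suc k) = Y k + t k *\<^sub>R (e1 - B (P (Y k) (X k)))"
     "X (Suc k) = X k + t k *\<^sub>R (e2 - (1 / \<sigma>) *\<^sub>R R (Y k) (X k))"
     "norm e1 \<le> c\<^sub>N * t k * (1 + sqrt (2 * en k))" "norm e2 \<le> c\<^sub>N * t k * (1 + sqrt (2 * en k))"
    using assms(1) unfolding euler_at_def by blast
  have f: "norm (B (P (Y k) (X k))) \<le> sqrt (2 * en k)"
    by (rule real_le_rsqrt[OF norm_le_energy(1)])
  have r: "norm (R (Y k) (X k)) \<le> K * sqrt (2 * en k)"
  proof -
    have "norm (R (Y k) (X k)) \<le> sqrt (2 * K\<^sup>2 * en k)"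
      by (rule real_le_rsqrt[OF norm_le_energy(2)])
    then show ?thesis using K1 by (simp add: real_sqrt_mult algebra_simps)
  qed
  have E: "sqrt (2 * en k) \<ge> 0" using energy_nonneg by simp
  have c: "c\<^sub>N \<ge> 1" using K1 c\<^sub>N by simp
  have le: "K * sqrt (2 * en k) \<le> c\<^sub>N * (1 + sqrt (2 * en k))"
    using c\<^sub>N E K1 c by (intro mult_mono) auto
  have le': "sqrt (2 * en k) \<le> K * sqrt (2 * en k)" using K1 E mult_right_mono by force
  have "t k * x \<le> N" if "x \<le> K * sqrt (2 * en k)" for x
  proof -
    have "t k * x \<le> t k * (c\<^sub>N * (1 + sqrt (2 * en k)))"
      using that le t_pos[of k] by (intro mult_left_mono) auto
    with assms(3) show ?thesis by (simp add: algebra_simps)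
  qed
  then have "euler_step S B b \<sigma> K (Y k) (Y (Suc k)) e1 (X k) (X (Suc k)) e2 (t k) N"
    using e f r le' assms t_pos[of k] by unfold_locales auto
  then show ?thesis by blast
qed

lemma small_steps: "\<exists>k1. \<forall>k\<ge>k1. t k \<le> \<delta>" if "\<delta> > 0"
  using order_tendstoD(2)[OF t_lim that] unfolding eventually_sequentially by (meson less_imp_le)

text \<open>Two passes over the run. The perturbation grows with the energy, but a small tail of
  \<open>t k ^ 3\<close> limits its contribution in \<open>run_bound\<close> to half of
  \<open>1 + Em\<close>, with \<open>Em\<close> the largest energy; absorbing this bounds the
  dissipation by \<open>C * (1 + en k0)\<close>. Then \<open>energy_step\<close> is summed anew,
  with Young's inequality of weight \<open>\<delta>\<close> for the critical product, which now
  finds both factors under control.\<close>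

lemma run_estimate:
  shows "\<exists>C\<ge>0. \<forall>\<epsilon>>0. \<exists>k1. \<forall>k0\<ge>k1. \<forall>n. (\<forall>i<n. euler_at (k0 + i)) \<longrightarrow>
    en (k0 + n) \<le> en k0 + \<epsilon> * (1 + en k0) \<and>
    (\<Sum>i<n. t (k0 + i) * (norm (B (R (Y (k0 + i)) (X (k0 + i)))))\<^sup>2
      + (norm (R (Y (k0 + Suc i)) (X (k0 + Suc i)) - R (Y (k0 + i)) (X (k0 + i))))\<^sup>2 / t (k0 + i))
      \<le> C * (1 + en k0)"
proof -
  define C1 where "C1 = 1 + 2 * c3"
  define C where "C = 4 * K * C1"
  define a where "a = 4 * c\<^sub>N\<^sup>2"
  have C1: "C1 \<ge> 1" using const_nonneg by (simp add: C1_def)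
  have C: "C > 0" using C1 K1 by (simp add: C_def)
  have a: "a > 0" using c\<^sub>N K1 by (simp add: a_def)
  have K3: "K ^ 3 > 0" using K1 by simp
  show ?thesis
  proof (intro exI[of _ C] conjI allI impI)
    fix \<epsilon> :: real assume \<epsilon>: "\<epsilon> > 0"
    \<comment> \<open>Made for \<open>11 * K ^ 3 * \<delta> * C = \<epsilon> / 2\<close> and
      \<open>W * \<omega> \<le> \<epsilon> / 2\<close> in the second pass, and for
      \<open>c2 * (a * \<omega>) \<le> 1 / 2\<close> in the first.\<close>
    define \<delta> where "\<delta> = \<epsilon> / (22 * K ^ 3 * C)"
    define W where "W = 11 * K ^ 3 * (1 / (4 * \<delta>) + 1) * (2 * a * C1)"
    define \<omega> where "\<omega> = min (1 / (2 * (c2 + 1) * a)) (\<epsilon> / (2 * W))"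
    have \<delta>: "\<delta> > 0" using \<epsilon> K3 C by (simp add: \<delta>_def)
    have W: "W > 0" unfolding W_def using K3 \<delta> a C1 by (intro mult_pos_pos add_pos_pos) auto
    have \<omega>: "\<omega> > 0" using a const_nonneg(3) \<epsilon> W by (simp add: \<omega>_def)
    have \<omega>1: "c2 * (a * \<omega>) \<le> 1 / 2"
    proof -
      have "c2 * (a * \<omega>) \<le> (c2 + 1) * (a * \<omega>)" using a \<omega> by (intro mult_right_mono) auto
      also have "\<dots> \<le> (c2 + 1) * (a * (1 / (2 * (c2 + 1) * a)))"
        using a const_nonneg(3) by (intro mult_left_mono) (auto simp: \<omega>_def)
      also have "\<dots> = 1 / 2"
      proof -
        have "g * (a * (1 / (2 * g * a))) = 1 / 2" if "g > 0" for g
          using a that by (simp add: field_simps)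
        from this[of "c2 + 1"] show ?thesis using const_nonneg(3) by simp
      qed
      finally show ?thesis .
    qed
    have \<omega>2: "W * \<omega> \<le> \<epsilon> / 2"
      using mult_left_mono[of \<omega> "\<epsilon> / (2 * W)" W] W by (simp add: \<omega>_def)
    obtain k1 where k1: "\<And>k0 n. k0 \<ge> k1 \<Longrightarrow> (\<Sum>i<n. t (k0 + i) ^ 3) \<le> \<omega>"
      by (rule summable_tail_le[OF t_cube _ \<omega>]) (use t_pos in \<open>auto simp: less_imp_le\<close>)
    obtain k2 where k2: "\<And>k. k \<ge> k2 \<Longrightarrow> t k \<le> 1 / (8 * K ^ 3)"
      using small_steps[of "1 / (8 * K ^ 3)"] K3 by auto
    have "en (k0 + n) \<le> en k0 + \<epsilon> * (1 + en k0) \<and>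
        (\<Sum>i<n. t (k0 + i) * (norm (B (R (Y (k0 + i)) (X (k0 + i)))))\<^sup>2
          + (norm (R (Y (k0 + Suc i)) (X (k0 + Suc i)) - R (Y (k0 + i)) (X (k0 + i))))\<^sup>2 / t (k0 + i))
          \<le> C * (1 + en k0)"
      if k0: "k0 \<ge> max k1 k2" and eu: "\<forall>i<n. euler_at (k0 + i)" for k0 n
    proof -
      define N where "N i = c\<^sub>N * t (k0 + i) * (1 + sqrt (2 * en (k0 + i)))" for i
      define \<beta> where "\<beta> i = norm (B (R (Y (k0 + i)) (X (k0 + i))))" for i
      define \<rho> where "\<rho> i = norm (R (Y (k0 + Suc i)) (X (k0 + Suc i)) - R (Y (k0 + i)) (X (k0 + i)))" for i
      define \<tau> where "\<tau> i = t (k0 + i)" for i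
      have \<tau>: "\<tau> i > 0" for i by (simp add: \<tau>_def t_pos)
      have "\<exists>e1 e2. euler_step S B b \<sigma> K (Y (k0 + i)) (Y (k0 + Suc i)) e1 (X (k0 + i)) (X (k0 + Suc i)) e2 (\<tau> i) (N i)"
        if "i < n" for i
        using euler_at_step[of "k0 + i" "N i"] eu that k2 k0 by (auto simp: N_def \<tau>_def)
      then obtain e1 e2 where st: "\<And>i. i < n \<Longrightarrow> euler_step S B b \<sigma> K (Y (k0 + i)) (Y (k0 + Suc i)) (e1 i) (X (k0 + i)) (X (k0 + Suc i)) (e2 i) (\<tau> i) (N i)"
        by metis
      have rb: "en (k0 + m) + (\<Sum>i<m. \<tau> i * (\<beta> i)\<^sup>2 / (4 * K) + (\<rho> i)\<^sup>2 / \<tau> i)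
          \<le> c3 * en k0 + c2 * (\<Sum>i<m. \<tau> i * (N i)\<^sup>2)" if "m \<le> n" for m
        using run_bound[of m "\<lambda>i. Y (k0 + i)" e1 "\<lambda>i. X (k0 + i)" e2 \<tau> N] st that
        by (simp add: \<beta>_def \<rho>_def)
      define Em where "Em = Max ((\<lambda>i. en (k0 + i)) ` {..n})"
      have Em: "en (k0 + i) \<le> Em" if "i \<le> n" for i
        unfolding Em_def using that by (intro Max_ge) auto
      have Em0: "Em \<ge> 0" using Em[of 0] energy_nonneg order_trans by blast
      have sN: "(\<Sum>i<m. \<tau> i * (N i)\<^sup>2) \<le> a * \<omega> * (1 + Em)" if "m \<le> n" for m
      proof -
        have "\<tau> i * (N i)\<^sup>2 \<le> a * (1 + Em) * \<tau> i ^ 3" if "i < m" for i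
        proof -
          have "(1 + sqrt (2 * en (k0 + i)))\<^sup>2 \<le> 4 * (1 + Em)"
          proof -
            have "(1 + x)\<^sup>2 \<le> 2 + 2 * x\<^sup>2" for x :: real
              using zero_le_power2[of "1 - x"] by (simp add: power2_eq_square algebra_simps)
            from this[of "sqrt (2 * en (k0 + i))"] show ?thesis
              using Em[of i] \<open>i < m\<close> \<open>m \<le> n\<close> energy_nonneg by simp
          qed
          then have "\<tau> i * (c\<^sub>N * \<tau> i)\<^sup>2 * (1 + sqrt (2 * en (k0 + i)))\<^sup>2 \<le> \<tau> i * (c\<^sub>N * \<tau> i)\<^sup>2 * (4 * (1 + Em))"
            using \<tau>[of i] by (intro mult_left_mono) auto
          then show ?thesis
            by (simp add: N_def \<tau>_def a_def power_mult_distrib power3_eq_cube power2_eq_square algebra_simps)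
        qed
        then have "(\<Sum>i<m. \<tau> i * (N i)\<^sup>2) \<le> (\<Sum>i<m. a * (1 + Em) * \<tau> i ^ 3)"
          by (intro sum_mono) auto
        also have "\<dots> = a * (1 + Em) * (\<Sum>i<m. \<tau> i ^ 3)" by (simp add: sum_distrib_left)
        also have "\<dots> \<le> a * (1 + Em) * \<omega>"
          using k1[of k0 m] k0 a Em0 by (intro mult_left_mono) (auto simp: \<tau>_def)
        finally show ?thesis by (simp add: algebra_simps)
      qed
      have c2N: "c2 * (\<Sum>i<m. \<tau> i * (N i)\<^sup>2) \<le> (1 + Em) / 2" if "m \<le> n" for m
      proof -
        have "c2 * (\<Sum>i<m. \<tau> i * (N i)\<^sup>2) \<le> c2 * (a * \<omega> * (1 + Em))"
          using sN[OF that] const_nonneg(3) by (rule mult_left_mono)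
        also have "\<dots> = (c2 * (a * \<omega>)) * (1 + Em)" by simp
        also have "\<dots> \<le> 1 / 2 * (1 + Em)" using \<omega>1 Em0 by (intro mult_right_mono) auto
        finally show ?thesis by simp
      qed
      have diss0: "0 \<le> \<tau> i * (\<beta> i)\<^sup>2 / (4 * K) + (\<rho> i)\<^sup>2 / \<tau> i" for i
        using \<tau>[of i] K1 by (intro add_nonneg_nonneg divide_nonneg_nonneg mult_nonneg_nonneg) auto
      have "en (k0 + m) \<le> c3 * en k0 + (1 + Em) / 2" if "m \<le> n" for m
      proof -
        have "0 \<le> (\<Sum>i<m. \<tau> i * (\<beta> i)\<^sup>2 / (4 * K) + (\<rho> i)\<^sup>2 / \<tau> i)"
          by (intro sum_nonneg diss0)
        with rb[OF that] c2N[OF that] show ?thesis by linarith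
      qed
      then have Em_half: "Em \<le> c3 * en k0 + (1 + Em) / 2"
        unfolding Em_def by (subst Max_le_iff) auto
      have C1_ge: "1 + 2 * (c3 * en k0) \<le> C1 * (1 + en k0)"
        using energy_nonneg[of "Y k0" "X k0"] const_nonneg(4) by (simp add: C1_def algebra_simps)
      have c3E: "0 \<le> c3 * en k0"
        using energy_nonneg const_nonneg(4) by simp
      have Em_le: "1 + Em \<le> 2 * C1 * (1 + en k0)"
      proof -
        have "1 + Em \<le> 2 * (1 + 2 * (c3 * en k0))"
          using Em_half c3E by (simp add: field_simps)
        also have "\<dots> \<le> 2 * (C1 * (1 + en k0))"
          using C1_ge by (rule mult_left_mono) simp
        finally show ?thesis by (simp only: mult.assoc)
      qed
      have "(\<Sum>i<n. \<tau> i * (\<beta> i)\<^sup>2 / (4 * K) + (\<rho> i)\<^sup>2 / \<tau> i) \<le> C1 * (1 + en k0)"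
      proof -
        have "(\<Sum>i<n. \<tau> i * (\<beta> i)\<^sup>2 / (4 * K) + (\<rho> i)\<^sup>2 / \<tau> i) \<le> c3 * en k0 + (1 + Em) / 2"
          using rb[OF order_refl] c2N[OF order_refl] energy_nonneg[of "Y (k0 + n)" "X (k0 + n)"]
          by linarith
        also have "\<dots> \<le> c3 * en k0 + (1 + c3 * en k0)"
          using Em_half by (simp add: field_simps)
        also have "\<dots> \<le> C1 * (1 + en k0)" using C1_ge by simp
        finally show ?thesis .
      qed
      then have "4 * K * (\<Sum>i<n. \<tau> i * (\<beta> i)\<^sup>2 / (4 * K) + (\<rho> i)\<^sup>2 / \<tau> i) \<le> 4 * K * (C1 * (1 + en k0))"
        using K1 by (intro mult_left_mono) auto
      moreover have "(\<Sum>i<n. \<tau> i * (\<beta> i)\<^sup>2 + (\<rho> i)\<^sup>2 / \<tau> i)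
          \<le> 4 * K * (\<Sum>i<n. \<tau> i * (\<beta> i)\<^sup>2 / (4 * K) + (\<rho> i)\<^sup>2 / \<tau> i)"
        unfolding sum_distrib_left
      proof (rule sum_mono)
        fix i
        have "1 * ((\<rho> i)\<^sup>2 / \<tau> i) \<le> 4 * K * ((\<rho> i)\<^sup>2 / \<tau> i)"
          using K1 \<tau>[of i] by (intro mult_right_mono) auto
        then show "\<tau> i * (\<beta> i)\<^sup>2 + (\<rho> i)\<^sup>2 / \<tau> i \<le> 4 * K * (\<tau> i * (\<beta> i)\<^sup>2 / (4 * K) + (\<rho> i)\<^sup>2 / \<tau> i)"
          using K1 by (simp add: distrib_left)
      qed
      ultimately have G: "(\<Sum>i<n. \<tau> i * (\<beta> i)\<^sup>2 + (\<rho> i)\<^sup>2 / \<tau> i) \<le> C * (1 + en k0)"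
        by (simp add: C_def mult.assoc)
      have b2: "(\<Sum>i<n. \<tau> i * (\<beta> i)\<^sup>2) \<le> C * (1 + en k0)"
        using \<tau> by (intro order_trans[OF sum_mono G]) (auto simp: less_imp_le)
      have N2: "(\<Sum>i<n. \<tau> i * (N i)\<^sup>2) \<le> 2 * a * C1 * \<omega> * (1 + en k0)"
      proof -
        have "(\<Sum>i<n. \<tau> i * (N i)\<^sup>2) \<le> a * \<omega> * (1 + Em)" by (rule sN) simp
        also have "\<dots> \<le> a * \<omega> * (2 * C1 * (1 + en k0))"
          using Em_le a \<omega> by (intro mult_left_mono) auto
        finally show ?thesis by (simp add: algebra_simps)
      qed
      have "en (k0 + m) \<le> en k0 + (\<Sum>i<m. 11 * K ^ 3 * (\<delta> * (\<tau> i * (\<beta> i)\<^sup>2) + (1 / (4 * \<delta>) + 1) * (\<tau> i * (N i)\<^sup>2)))"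
        if "m \<le> n" for m
        using that
      proof (induction m)
        case (Suc m)
        interpret euler_step S B b \<sigma> K "Y (k0 + m)" "Y (k0 + Suc m)" "e1 m" "X (k0 + m)" "X (k0 + Suc m)" "e2 m" "\<tau> m" "N m"
          using Suc.prems by (intro st) auto
        have "en (k0 + Suc m) \<le> en (k0 + m) - (\<rho> m)\<^sup>2 / (2 * K * \<tau> m)
            + 11 * K ^ 3 * (\<tau> m * \<beta> m * N m + \<tau> m * (N m)\<^sup>2)"
          using energy_step by (simp add: \<rho>_def \<beta>_def)
        moreover have "0 \<le> (\<rho> m)\<^sup>2 / (2 * K * \<tau> m)" using K1 \<tau>[of m] by simp
        moreover have "11 * K ^ 3 * (\<tau> m * \<beta> m * N m + \<tau> m * (N m)\<^sup>2)
            \<le> 11 * K ^ 3 * (\<delta> * (\<tau> m * (\<beta> m)\<^sup>2) + (1 / (4 * \<delta>) + 1) * (\<tau> m * (N m)\<^sup>2))"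
        proof (rule mult_left_mono)
          have "\<tau> m * (\<beta> m * N m) \<le> \<tau> m * (\<delta> * (\<beta> m)\<^sup>2 + (N m)\<^sup>2 / (4 * \<delta>))"
            using young[OF \<delta>] \<tau>[of m] by (intro mult_left_mono) auto
          then show "\<tau> m * \<beta> m * N m + \<tau> m * (N m)\<^sup>2 \<le> \<delta> * (\<tau> m * (\<beta> m)\<^sup>2) + (1 / (4 * \<delta>) + 1) * (\<tau> m * (N m)\<^sup>2)"
            by (simp add: algebra_simps)
        qed (use K1 in auto)
        ultimately show ?case using Suc by simp
      qed simp
      from this[of n] have "en (k0 + n) \<le> en k0
          + 11 * K ^ 3 * (\<delta> * (\<Sum>i<n. \<tau> i * (\<beta> i)\<^sup>2) + (1 / (4 * \<delta>) + 1) * (\<Sum>i<n. \<tau> i * (N i)\<^sup>2))"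
        by (simp only: sum_distrib_left[symmetric] sum.distrib)
      also have "\<dots> \<le> en k0 + 11 * K ^ 3 * (\<delta> * (C * (1 + en k0))
          + (1 / (4 * \<delta>) + 1) * (2 * a * C1 * \<omega> * (1 + en k0)))"
        using b2 N2 \<delta> K1 by (intro add_left_mono mult_left_mono add_mono) auto
      also have "\<dots> = en k0 + (11 * K ^ 3 * \<delta> * C + W * \<omega>) * (1 + en k0)"
      proof -
        have "11 * K ^ 3 * (\<delta> * (C * e) + d * (2 * a * C1 * \<omega> * e))
            = (11 * K ^ 3 * \<delta> * C + (11 * K ^ 3 * d * (2 * a * C1)) * \<omega>) * e" for d e
          by (simp add: algebra_simps)
        then show ?thesis by (simp only: W_def)
      qed
      also have "\<dots> \<le> en k0 + \<epsilon> * (1 + en k0)"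
      proof -
        have "11 * K ^ 3 * \<delta> * C = \<epsilon> / 2" using K3 C by (simp add: \<delta>_def field_simps)
        then show ?thesis
          using \<omega>2 energy_nonneg[of "Y k0" "X k0"] by (intro add_left_mono mult_right_mono) auto
      qed
      finally show ?thesis using G by (simp add: \<beta>_def \<rho>_def \<tau>_def)
    qed
    then show "\<exists>k1. \<forall>k0\<ge>k1. \<forall>n. (\<forall>i<n. euler_at (k0 + i)) \<longrightarrow>
      en (k0 + n) \<le> en k0 + \<epsilon> * (1 + en k0) \<and>
      (\<Sum>i<n. t (k0 + i) * (norm (B (R (Y (k0 + i)) (X (k0 + i)))))\<^sup>2
        + (norm (R (Y (k0 + Suc i)) (X (k0 + Suc i)) - R (Y (k0 + i)) (X (k0 + i))))\<^sup>2 / t (k0 + i))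
        \<le> C * (1 + en k0)"
      by blast
  qed (use C in auto)
qed

text \<open>If the energy stayed above \<open>\<epsilon>\<close>, the sum estimated in
  \<open>run_average\<close> would be at least \<open>2 * \<epsilon> * T\<close>, whereas the
  estimate is a constant plus \<open>3 / 2 * \<epsilon> * T\<close>; so \<open>T\<close> would be
  bounded.\<close>

lemma energy_infinitely_often_small:
  assumes sol: "P Ys Xs = Xs" "B Xs = 0" and ev: "\<And>k. k \<ge> m0 \<Longrightarrow> euler_at k" and \<epsilon>: "\<epsilon> > 0"
  shows "\<exists>k\<ge>m. en k < \<epsilon>"
proof (rule ccontr)
  assume "\<not> ?thesis"
  then have large: "\<And>k. k \<ge> m \<Longrightarrow> en k \<ge> \<epsilon>" by force
  obtain C where C: "C \<ge> 0" "\<And>\<epsilon>. \<epsilon> > 0 \<Longrightarrow> \<exists>k1. \<forall>k0\<ge>k1. \<forall>n. (\<forall>i<n. euler_at (k0 + i)) \<longrightarrow>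
    en (k0 + n) \<le> en k0 + \<epsilon> * (1 + en k0) \<and>
    (\<Sum>i<n. t (k0 + i) * (norm (B (R (Y (k0 + i)) (X (k0 + i)))))\<^sup>2
      + (norm (R (Y (k0 + Suc i)) (X (k0 + Suc i)) - R (Y (k0 + i)) (X (k0 + i))))\<^sup>2 / t (k0 + i))
      \<le> C * (1 + en k0)"
    using run_estimate by blast
  obtain k1 where k1: "\<And>k0 n. k0 \<ge> k1 \<Longrightarrow> (\<forall>i<n. euler_at (k0 + i)) \<Longrightarrow>
    en (k0 + n) \<le> en k0 + 1 * (1 + en k0) \<and>
    (\<Sum>i<n. t (k0 + i) * (norm (B (R (Y (k0 + i)) (X (k0 + i)))))\<^sup>2
      + (norm (R (Y (k0 + Suc i)) (X (k0 + Suc i)) - R (Y (k0 + i)) (X (k0 + i))))\<^sup>2 / t (k0 + i))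
      \<le> C * (1 + en k0)"
    using C(2)[of 1] by auto
  define k2 where "k2 = Max {k1, m, m0}"
  have k2: "k2 \<ge> k1" "k2 \<ge> m" "k2 \<ge> m0" by (auto simp: k2_def)
  define E where "E = en k2 + 1 * (1 + en k2)"
  have E: "en k \<le> E" if "k \<ge> k2" for k
    using k1[of k2 "k - k2"] k2 ev that by (simp add: E_def)
  have E0: "E \<ge> 0" using E[of k2] energy_nonneg order_trans by blast
  define \<phi> A G where "\<phi> = sqrt (2 * E)" and "A = c\<^sub>N * (1 + \<phi>)" and "G = C * (1 + E)"
  have \<phi>0: "\<phi> \<ge> 0" using E0 by (simp add: \<phi>_def)
  have cN1: "c\<^sub>N \<ge> 1" using c\<^sub>N K1 by simp
  have A1: "A \<ge> 1" unfolding A_def using mult_mono[of 1 c\<^sub>N 1 "1 + \<phi>"] cN1 \<phi>0 by simp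
  have G0: "G \<ge> 0" using C(1) E0 by (simp add: G_def)
  define G1 where "G1 = 3 * K\<^sup>2 * (G + A\<^sup>2)"
  define M where "M = K + 1 + G1 / (4 * \<epsilon>)"
  define V where "V = M * (32 * K\<^sup>2 * A\<^sup>2) + \<phi> * A"
  have M: "M \<ge> 1" unfolding M_def G1_def using G0 \<epsilon> K1 by simp
  have V: "V > 0" unfolding V_def using M K1 A1 \<phi>0 by (intro add_pos_nonneg mult_pos_pos) auto
  \<comment> \<open>\<open>E\<close> bounds all later energies, so \<open>\<phi>\<close>,
    \<open>A\<close>, \<open>G\<close> and \<open>V\<close> do not depend on the start and
    \<open>\<omega>\<close> can be fixed before \<open>k0\<close>. The initial distance
    \<open>D0\<close> does depend on \<open>k0\<close>, but it enters only the constant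
    \<open>c\<close>.\<close>
  define \<omega> where "\<omega> = min 1 (\<epsilon> / (2 * V))"
  have \<omega>: "\<omega> > 0" "\<omega> \<le> 1" using V \<epsilon> by (auto simp: \<omega>_def)
  have V\<omega>: "V * \<omega> \<le> \<epsilon> / 2"
    using mult_left_mono[of \<omega> "\<epsilon> / (2 * V)" V] V by (simp add: \<omega>_def)
  obtain k3 where k3: "\<And>k0 n. k0 \<ge> k3 \<Longrightarrow> (\<Sum>i<n. t (k0 + i) ^ 3) \<le> \<omega>"
    by (rule summable_tail_le[OF t_cube _ \<omega>(1)]) (use t_pos in \<open>auto simp: less_imp_le\<close>)
  obtain k4 where k4: "\<And>k. k \<ge> k4 \<Longrightarrow> t k \<le> 1 / (8 * K ^ 3)"
    using small_steps[of "1 / (8 * K ^ 3)"] K1 by auto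
  define k0 where "k0 = Max {k2, k3, k4}"
  have k0: "k0 \<ge> k2" "k0 \<ge> k3" "k0 \<ge> k4" by (auto simp: k0_def)
  have f_le: "sqrt (2 * en k) \<le> \<phi>" if "k \<ge> k2" for k
    unfolding \<phi>_def using E[OF that] by simp
  have "\<exists>e1 e2. euler_step S B b \<sigma> K (Y (k0 + i)) (Y (k0 + Suc i)) e1 (X (k0 + i)) (X (k0 + Suc i)) e2 (t (k0 + i)) (A * t (k0 + i))" for i
  proof -
    have "c\<^sub>N * t (k0 + i) * (1 + sqrt (2 * en (k0 + i))) \<le> c\<^sub>N * t (k0 + i) * (1 + \<phi>)"
      using f_le[of "k0 + i"] k0 cN1 t_pos[of "k0 + i"] by (intro mult_left_mono) auto
    then have "c\<^sub>N * t (k0 + i) * (1 + sqrt (2 * en (k0 + i))) \<le> A * t (k0 + i)"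
      by (simp add: A_def algebra_simps)
    moreover have "euler_at (k0 + i)" "t (k0 + i) \<le> 1 / (8 * K ^ 3)"
      using ev[of "k0 + i"] k4[of "k0 + i"] k0 k2 by auto
    ultimately show ?thesis
      using euler_at_step[of "k0 + i" "A * t (k0 + i)"] by (metis add_Suc_right)
  qed
  then obtain e1 e2 where st: "\<And>i. euler_step S B b \<sigma> K (Y (k0 + i)) (Y (k0 + Suc i)) (e1 i) (X (k0 + i)) (X (k0 + Suc i)) (e2 i) (t (k0 + i)) (A * t (k0 + i))"
    by metis
  define D0 where "D0 = (norm (Y k0 - Ys))\<^sup>2 + (norm (X k0 - Xs))\<^sup>2"
  define c where "c = M * (2 * D0 + 32 * K\<^sup>2 * A\<^sup>2) + \<phi>\<^sup>2 + \<phi> * A"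
  have T_le: "(\<Sum>i<n. t (k0 + i)) \<le> 2 * c / \<epsilon>" for n
  proof -
    define T where "T = (\<Sum>i<n. t (k0 + i))"
    have T0: "T \<ge> 0" unfolding T_def using t_pos by (intro sum_nonneg) (auto simp: less_imp_le)
    have "(\<Sum>i<n. t (k0 + i) * (2 * \<epsilon>)) \<le> (\<Sum>i<n. t (k0 + i) * (2 * en (k0 + i)))"
      using large k0 k2 t_pos by (intro sum_mono mult_left_mono) (auto simp: less_imp_le)
    also have "\<dots> \<le> \<epsilon> * T + M * (2 * D0 + 32 * K\<^sup>2 * A\<^sup>2 * (1 + \<omega> * T)) + \<phi>\<^sup>2 + \<phi> * A * (1 + \<omega> * T)"
    proof -
      have "(\<Sum>i<n. t (k0 + i) * (norm (B (R (Y (k0 + i)) (X (k0 + i)))))\<^sup>2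
          + (norm (R (Y (k0 + Suc i)) (X (k0 + Suc i)) - R (Y (k0 + i)) (X (k0 + i))))\<^sup>2 / t (k0 + i)) \<le> C * (1 + en k0)"
        using k1[of k0 n] k0 k2 ev by auto
      also have "\<dots> \<le> G" unfolding G_def using E[OF k0(1)] C(1) by (intro mult_left_mono) auto
      finally show ?thesis
        using run_average[of Ys Xs n "\<lambda>i. Y (k0 + i)" e1 "\<lambda>i. X (k0 + i)" e2 "\<lambda>i. t (k0 + i)" A \<omega> G \<phi> \<epsilon>]
          sol st A1 \<omega> k3[OF k0(2)] \<epsilon>
          order_trans[OF real_le_rsqrt[OF norm_le_energy(1)] f_le] k0
        by (simp add: T_def D0_def M_def G1_def)
    qed
    also have "\<dots> = \<epsilon> * T + c + V * \<omega> * T"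
      by (simp add: c_def V_def algebra_simps)
    also have "V * \<omega> * T \<le> \<epsilon> / 2 * T" using V\<omega> T0 by (rule mult_right_mono)
    also have "(\<Sum>i<n. t (k0 + i) * (2 * \<epsilon>)) = 2 * (\<epsilon> * T)"
      by (simp add: T_def sum_distrib_left algebra_simps)
    also have "\<epsilon> / 2 * T = \<epsilon> * T / 2" by simp
    finally have "\<epsilon> * T \<le> 2 * c" by linarith
    then show ?thesis using \<epsilon> by (simp add: T_def field_simps)
  qed
  have "summable (\<lambda>i. t (k0 + i))"
    by (rule summableI_nonneg_bounded[OF _ T_le]) (use t_pos in \<open>auto simp: less_imp_le\<close>)
  then have "summable t" using summable_iff_shift[of t k0] by (simp add: add.commute)
  with t_div show False by simp
qed

theorem energy_tendsto_0:
  assumes sol: "P Ys Xs = Xs" "B Xs = 0"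
    and \<nu>: "0 < \<nu>" "\<nu> < 1" and \<zeta>: "\<zeta> \<ge> 1" and vs: "vs \<longlonglongrightarrow> 0"
    and m1: "m1 \<ge> 1"
    and alt: "\<And>k. k \<ge> m1 \<Longrightarrow> sqrt (2 * en (Suc k)) \<le> \<nu> * (MAX j\<in>{max 1 (k + 1 - \<zeta>)..k}. sqrt (2 * en j)) + vs k
        \<or> euler_at k"
  shows "(\<lambda>k. sqrt (2 * en k)) \<longlonglongrightarrow> 0"
proof -
  have run: "\<exists>k1. \<forall>k0\<ge>k1. \<forall>n. (\<forall>i<n. euler_at (k0 + i)) \<longrightarrow>
      sqrt (2 * en (k0 + n)) \<le> (1 + \<epsilon>) * sqrt (2 * en k0) + \<epsilon>" if "\<epsilon> > 0" for \<epsilon>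
  proof -
    \<comment> \<open>Passing to square roots needs \<open>(1 + \<delta>) * x\<^sup>2 + 2 * \<delta>
      \<le> ((1 + \<epsilon>) * x + \<epsilon>)\<^sup>2\<close>.\<close>
    define \<delta> where "\<delta> = min \<epsilon> (\<epsilon>\<^sup>2 / 2)"
    have \<delta>: "\<delta> > 0" "\<delta> \<le> \<epsilon>" "2 * \<delta> \<le> \<epsilon>\<^sup>2" using that by (auto simp: \<delta>_def min_def)
    obtain k1 where k1: "\<And>k0 n. k0 \<ge> k1 \<Longrightarrow> (\<forall>i<n. euler_at (k0 + i)) \<Longrightarrow> en (k0 + n) \<le> en k0 + \<delta> * (1 + en k0)"
      using run_estimate \<delta>(1) by meson
    have "sqrt (2 * en (k0 + n)) \<le> (1 + \<epsilon>) * sqrt (2 * en k0) + \<epsilon>"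
      if "k0 \<ge> k1" "\<forall>i<n. euler_at (k0 + i)" for k0 n
    proof (rule real_le_lsqrt)
      define x where "x = sqrt (2 * en k0)"
      have x: "x \<ge> 0" "x\<^sup>2 = 2 * en k0" using energy_nonneg by (auto simp: x_def)
      have "2 * en (k0 + n) \<le> (1 + \<delta>) * x\<^sup>2 + 2 * \<delta>"
        using k1[OF that] x by (simp add: algebra_simps)
      also have "\<dots> \<le> (1 + \<epsilon>) * x\<^sup>2 + \<epsilon>\<^sup>2"
        using \<delta> by (intro add_mono mult_right_mono) auto
      also have "\<dots> \<le> ((1 + \<epsilon>) * x + \<epsilon>)\<^sup>2"
      proof -
        have "(1 + \<epsilon>) * x\<^sup>2 \<le> ((1 + \<epsilon>) * x)\<^sup>2"
          using \<open>\<epsilon> > 0\<close> by (simp add: power_mult_distrib mult_right_mono self_le_power)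
        moreover have "0 \<le> 2 * ((1 + \<epsilon>) * x) * \<epsilon>"
          using x \<open>\<epsilon> > 0\<close> by (intro mult_nonneg_nonneg) auto
        ultimately show ?thesis unfolding power2_sum by linarith
      qed
      finally show "2 * en (k0 + n) \<le> ((1 + \<epsilon>) * sqrt (2 * en k0) + \<epsilon>)\<^sup>2" by (simp add: x_def)
    qed (use \<open>\<epsilon> > 0\<close> energy_nonneg in auto)
    then show ?thesis by blast
  qed
  show ?thesis
  proof (cases "\<exists>\<^sub>\<infinity>k. k \<ge> m1 \<and> \<not> euler_at k")
    case True
    \<comment> \<open>The contraction steps are taken to be those that are not Euler steps: there
      \<open>alt\<close> leaves only (D1), and the gaps between them are runs.\<close>
    show ?thesis
    proof (rule nonmonotone_decrease[OF _ \<nu> \<zeta> vs, where D = "\<lambda>k. k \<ge> m1 \<and> \<not> euler_at k"])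
      fix \<epsilon> :: real assume "\<epsilon> > 0"
      then obtain k1 where k1: "\<And>k0 n. k0 \<ge> k1 \<Longrightarrow> (\<forall>i<n. euler_at (k0 + i)) \<Longrightarrow>
          sqrt (2 * en (k0 + n)) \<le> (1 + \<epsilon>) * sqrt (2 * en k0) + \<epsilon>"
        using run by blast
      show "\<exists>k1. \<forall>k0\<ge>k1. \<forall>n. (\<forall>i<n. \<not> (k0 + i \<ge> m1 \<and> \<not> euler_at (k0 + i))) \<longrightarrow>
          sqrt (2 * en (k0 + n)) \<le> (1 + \<epsilon>) * sqrt (2 * en k0) + \<epsilon>"
        by (intro exI[of _ "max m1 k1"]) (use k1 in auto)
    qed (use alt True energy_nonneg in auto)
  next
    case False
    then obtain m where m: "\<And>k. k \<ge> m \<Longrightarrow> k \<ge> m1 \<Longrightarrow> euler_at k"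
      unfolding INFM_nat_le by blast
    define m0 where "m0 = max m1 m"
    have ev: "euler_at k" if "k \<ge> m0" for k using m that by (simp add: m0_def)
    show ?thesis
    proof (rule LIMSEQ_I)
      fix r :: real assume "r > 0"
      \<comment> \<open>One small energy suffices: almost monotonicity keeps all later values below
        \<open>3 * \<epsilon>\<close>, hence below \<open>r\<close>.\<close>
      define \<epsilon> where "\<epsilon> = min 1 (r / 4)"
      have \<epsilon>: "\<epsilon> > 0" "\<epsilon> \<le> 1" "\<epsilon> \<le> r / 4" using \<open>r > 0\<close> by (auto simp: \<epsilon>_def)
      obtain k1 where k1: "\<And>k0 n. k0 \<ge> k1 \<Longrightarrow> (\<forall>i<n. euler_at (k0 + i)) \<Longrightarrow>
          sqrt (2 * en (k0 + n)) \<le> (1 + \<epsilon>) * sqrt (2 * en k0) + \<epsilon>"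
        using run[OF \<epsilon>(1)] by blast
      obtain k0 where k0: "k0 \<ge> max k1 m0" "en k0 < \<epsilon>\<^sup>2 / 2"
        using energy_infinitely_often_small[OF sol ev, where \<epsilon> = "\<epsilon>\<^sup>2 / 2" and m = "max k1 m0"] \<epsilon>(1) by auto
      have "sqrt (2 * en k0) \<le> \<epsilon>" using k0(2) \<epsilon> by (intro real_le_lsqrt) (auto simp: energy_nonneg)
      then have *: "(1 + \<epsilon>) * sqrt (2 * en k0) + \<epsilon> \<le> 2 * \<epsilon> + \<epsilon>"
        using \<epsilon> energy_nonneg by (intro add_right_mono mult_mono) auto
      have "norm (sqrt (2 * en k) - 0) < r" if "k \<ge> k0" for k
      proof -
        have "sqrt (2 * en (k0 + (k - k0))) \<le> (1 + \<epsilon>) * sqrt (2 * en k0) + \<epsilon>"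
          using k0 ev by (intro k1) auto
        then have "sqrt (2 * en k) < r" using * that \<epsilon> \<open>r > 0\<close> by simp
        then show ?thesis using energy_nonneg by simp
      qed
      then show "\<exists>no. \<forall>k\<ge>no. norm (sqrt (2 * en k) - 0) < r" by blast
    qed
  qed
qed

end

section \<open>The semismooth Newton method\<close>

lemma closest_point_eqI:
  fixes S :: "'a::euclidean_space set"
  assumes S: "convex S" "closed S" "p \<in> S" and normal: "\<And>s. s \<in> S \<Longrightarrow> (a - p) \<bullet> (s - p) \<le> 0"
  shows "closest_point S a = p"
proof -
  have "dist a p \<le> dist a s" if "s \<in> S" for s
  proof -
    have "(dist a s)\<^sup>2 = (dist a p)\<^sup>2 - 2 * ((a - p) \<bullet> (s - p)) + (norm (s - p))\<^sup>2"
      unfolding dist_norm power2_norm_eq_inner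
      by (simp add: inner_diff_left inner_diff_right inner_commute)
    then have "(dist a p)\<^sup>2 \<le> (dist a s)\<^sup>2"
      using normal[OF that] zero_le_power2[of "norm (s - p)"] by linarith
    then show ?thesis by (rule power2_le_imp_le) simp
  qed
  then show ?thesis using closest_point_unique[OF S] by metis
qed

lemma closest_point_Times:
  fixes S :: "'a::euclidean_space set" and T :: "'b::euclidean_space set"
  assumes "convex S" "closed S" "S \<noteq> {}" "convex T" "closed T" "T \<noteq> {}"
  shows "closest_point (S \<times> T) (a, b) = (closest_point S a, closest_point T b)"
proof (rule closest_point_eqI)
  show "(closest_point S a, closest_point T b) \<in> S \<times> T"
    using assms by (simp add: closest_point_in_set)
  fix s assume "s \<in> S \<times> T"
  then show "((a, b) - (closest_point S a, closest_point T b)) \<bullet> (s - (closest_point S a, closest_point T b)) \<le> 0"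
    using closest_point_dot[OF assms(1,2), of "fst s" a] closest_point_dot[OF assms(4,5), of "snd s" b]
    by (auto simp: inner_prod_def)
qed (use assms in \<open>auto simp: convex_Times closed_Times\<close>)

lemma barrier_cone_Times:
  assumes "S \<noteq> {}" "T \<noteq> {}"
  shows "barrier_cone (S \<times> T) = barrier_cone S \<times> barrier_cone T"
proof (intro set_eqI iffI; clarify)
  fix \<xi> \<eta> assume "(\<xi>, \<eta>) \<in> barrier_cone (S \<times> T)"
  then obtain r where r: "\<And>p q. p \<in> S \<Longrightarrow> q \<in> T \<Longrightarrow> \<xi> \<bullet> p + \<eta> \<bullet> q \<le> r"
    unfolding barrier_cone_def by (auto simp: inner_prod_def)
  obtain p0 q0 where "p0 \<in> S" "q0 \<in> T" using assms by blast
  then have "\<forall>p\<in>S. \<xi> \<bullet> p \<le> r - \<eta> \<bullet> q0" "\<forall>q\<in>T. \<eta> \<bullet> q \<le> r - \<xi> \<bullet> p0"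
    using r[of _ q0] r[of p0] by (auto simp: algebra_simps)
  then show "\<xi> \<in> barrier_cone S \<and> \<eta> \<in> barrier_cone T"
    unfolding barrier_cone_def by blast
next
  fix \<xi> \<eta> assume "\<xi> \<in> barrier_cone S" "\<eta> \<in> barrier_cone T"
  then obtain r s where "\<forall>p\<in>S. \<xi> \<bullet> p \<le> r" "\<forall>q\<in>T. \<eta> \<bullet> q \<le> s"
    unfolding barrier_cone_def by blast
  then have "\<forall>p\<in>S \<times> T. (\<xi>, \<eta>) \<bullet> p \<le> r + s"
    by (auto simp: inner_prod_def intro!: add_mono)
  then show "(\<xi>, \<eta>) \<in> barrier_cone (S \<times> T)"
    unfolding barrier_cone_def by blast
qed

lemma fenchel_conjugate_delta_ge: "p \<in> S \<Longrightarrow> ereal (\<xi> \<bullet> p) \<le> fenchel_conjugate (delta S) \<xi>"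
  unfolding fenchel_conjugate_def by (rule SUP_upper2[of p]) (auto simp: delta_def)

lemma fenchel_conjugate_delta_le:
  "(\<And>p. p \<in> S \<Longrightarrow> ereal (\<xi> \<bullet> p) \<le> r) \<Longrightarrow> fenchel_conjugate (delta S) \<xi> \<le> r"
  unfolding fenchel_conjugate_def by (rule SUP_least) (auto simp: delta_def)

lemma effective_domain_conjugate_delta:
  "effective_domain (fenchel_conjugate (delta S)) = barrier_cone S"
proof (intro set_eqI iffI)
  fix \<xi> assume "\<xi> \<in> effective_domain (fenchel_conjugate (delta S))"
  then have "fenchel_conjugate (delta S) \<xi> < \<infinity>" by (simp add: effective_domain_def)
  then obtain r where "fenchel_conjugate (delta S) \<xi> < ereal r"
    using ereal_dense2 by blast
  then have "\<xi> \<bullet> p \<le> r" if "p \<in> S" for p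
    using fenchel_conjugate_delta_ge[OF that, of \<xi>] by (metis ereal_less_eq(3) less_imp_le order_trans)
  then show "\<xi> \<in> barrier_cone S" unfolding barrier_cone_def by blast
next
  fix \<xi> assume "\<xi> \<in> barrier_cone S"
  then obtain r where "\<And>p. p \<in> S \<Longrightarrow> \<xi> \<bullet> p \<le> r" unfolding barrier_cone_def by blast
  then have "fenchel_conjugate (delta S) \<xi> \<le> ereal r" by (intro fenchel_conjugate_delta_le) simp
  then show "\<xi> \<in> effective_domain (fenchel_conjugate (delta S))"
    by (auto simp: effective_domain_def intro: le_less_trans)
qed

text \<open>Sums of extended real conjugates are bounded one summand at a time; \<open>x\<close>
  holds the others. It turns out finite, so that it can be moved to the other side.\<close>

lemma add_fenchel_conjugate_delta_le:
  assumes "S \<noteq> {}" "x \<noteq> -\<infinity>" "\<And>p. p \<in> S \<Longrightarrow> x + ereal (\<xi> \<bullet> p) \<le> ereal r"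
  shows "x + fenchel_conjugate (delta S) \<xi> \<le> ereal r"
proof -
  obtain p0 where "p0 \<in> S" using assms(1) by blast
  then have "x \<noteq> \<infinity>" using assms(3)[of p0] by auto
  then obtain x' where x': "x = ereal x'" using assms(2) by (cases x) auto
  have "fenchel_conjugate (delta S) \<xi> \<le> ereal (r - x')"
    using assms(3) by (intro fenchel_conjugate_delta_le) (force simp: x')
  then have "x + fenchel_conjugate (delta S) \<xi> \<le> x + ereal (r - x')" by (rule add_left_mono)
  then show ?thesis by (simp add: x')
qed

lemma fenchel_conjugate_delta_neq: "S \<noteq> {} \<Longrightarrow> fenchel_conjugate (delta S) \<xi> \<noteq> -\<infinity>"
  using fenchel_conjugate_delta_ge[of _ S \<xi>] by (metis MInfty_neq_ereal(1) all_not_in_conv ereal_infty_less_eq(2))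

text \<open>\<open>arg_min\<close> selects some minimizer, so it is identified by showing that a
  minimizer exists and is unique.\<close>

lemma prox_delta:
  fixes S :: "'a::euclidean_space set"
  assumes "convex S" "closed S" "S \<noteq> {}" "\<sigma> > 0"
  shows "prox \<sigma> (delta S) x = closest_point S x"
proof -
  let ?g = "\<lambda>y. delta S y + ereal (1 / (2 * \<sigma>) * (norm (y - x))\<^sup>2)"
  let ?p = "closest_point S x"
  have p: "?p \<in> S" using assms by (simp add: closest_point_in_set)
  have unique: "y = ?p" if "is_arg_min ?g (\<lambda>_. True) y" for y
  proof (rule closest_point_unique[OF assms(1,2)])
    have le: "?g y \<le> ?g s" for s
      using that by (auto simp: is_arg_min_def not_less)
    have "?g y \<le> ereal (1 / (2 * \<sigma>) * (norm (?p - x))\<^sup>2)" using le[of ?p] p by (simp add: delta_def)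
    then show y: "y \<in> S" by (auto simp: delta_def split: if_splits)
    show "\<forall>s\<in>S. dist x y \<le> dist x s"
    proof
      fix s assume "s \<in> S"
      then have "1 / (2 * \<sigma>) * (norm (y - x))\<^sup>2 \<le> 1 / (2 * \<sigma>) * (norm (s - x))\<^sup>2"
        using le[of s] y by (simp add: delta_def)
      then have "(norm (y - x))\<^sup>2 \<le> (norm (s - x))\<^sup>2" using \<open>\<sigma> > 0\<close> by (simp add: field_simps)
      then show "dist x y \<le> dist x s"
        using power2_le_imp_le by (force simp: dist_norm norm_minus_commute)
    qed
  qed
  have "is_arg_min ?g (\<lambda>_. True) ?p"
    unfolding is_arg_min_def
  proof (intro conjI TrueI notI, elim exE conjE)
    fix s assume "?g s < ?g ?p"
    then have *: "?g s < ereal (1 / (2 * \<sigma>) * (norm (?p - x))\<^sup>2)" using p by (simp add: delta_def)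
    then have s: "s \<in> S" by (auto simp: delta_def split: if_splits)
    then have "1 / (2 * \<sigma>) * (norm (s - x))\<^sup>2 < 1 / (2 * \<sigma>) * (norm (?p - x))\<^sup>2"
      using * by (simp add: delta_def)
    then have "(norm (s - x))\<^sup>2 < (norm (?p - x))\<^sup>2" using \<open>\<sigma> > 0\<close> by (simp add: field_simps)
    then have "norm (s - x) < norm (?p - x)" by (rule power2_less_imp_less) simp
    then show False
      using closest_point_le[OF assms(2) s, of x] by (simp add: dist_norm norm_minus_commute)
  qed
  then have "is_arg_min ?g (\<lambda>_. True) (prox \<sigma> (delta S) x)"
    unfolding prox_def arg_min_def by (rule someI)
  then show ?thesis by (rule unique)
qed

section \<open>Clarke subdifferentials of nonexpansive maps\<close>

lemma has_derivative_nonexpansive: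
  assumes f: "(f has_derivative D) (at x)" and nonexp: "\<And>x y. dist (f x) (f y) \<le> dist x y"
  shows "norm (D v) \<le> norm v"
proof (rule field_le_epsilon)
  interpret bounded_linear D using f by (rule has_derivative_bounded_linear)
  fix e :: real assume "e > 0"
  define \<epsilon> where "\<epsilon> = e / (norm v + 1)"
  have \<epsilon>: "\<epsilon> > 0" "\<epsilon> * norm v \<le> e"
    using \<open>e > 0\<close> by (auto simp: \<epsilon>_def divide_simps add_nonneg_pos)
  then obtain d where d: "d > 0" "\<And>y. norm (y - x) < d \<Longrightarrow> norm (f y - f x - D (y - x)) \<le> \<epsilon> * norm (y - x)"
    using f unfolding has_derivative_at_alt by blast
  define s where "s = d / (2 * (norm v + 1))"
  have s: "s > 0" "norm (s *\<^sub>R v) < d"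
  proof -
    show "s > 0" using d by (simp add: s_def add_nonneg_pos)
    have "s * norm v \<le> s * (norm v + 1)" using \<open>s > 0\<close> by simp
    also have "\<dots> = d / 2" using norm_ge_zero[of v] by (simp add: s_def field_simps add_nonneg_eq_0_iff)
    finally show "norm (s *\<^sub>R v) < d" using \<open>s > 0\<close> d by simp
  qed
  have "norm (D (s *\<^sub>R v)) \<le> norm (f (x + s *\<^sub>R v) - f x) + norm (f (x + s *\<^sub>R v) - f x - D (s *\<^sub>R v))"
    by (metis diff_add_cancel norm_minus_commute norm_triangle_sub)
  also have "\<dots> \<le> norm (s *\<^sub>R v) + \<epsilon> * norm (s *\<^sub>R v)"
    using d(2)[of "x + s *\<^sub>R v"] s nonexp[of "x + s *\<^sub>R v" x] by (intro add_mono) (auto simp: dist_norm)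
  finally have "s * norm (D v) \<le> s * (norm v + \<epsilon> * norm v)"
    using s by (simp add: scaleR algebra_simps)
  then have "norm (D v) \<le> norm v + \<epsilon> * norm v" using s by simp
  with \<epsilon> show "norm (D v) \<le> norm v + e" by simp
qed

text \<open>The bound 1 on the derivatives passes to limits, and to the convex hull because the unit
  ball is convex.\<close>

lemma clarke_subdifferential_nonexpansive:
  fixes f :: "'a::real_normed_vector \<Rightarrow> 'b::real_normed_vector"
  assumes nonexp: "\<And>x y. dist (f x) (f y) \<le> dist x y" and V: "V \<in> clarke_subdifferential f x"
  shows "norm (blinfun_apply V v) \<le> norm v"
proof -
  have "clarke_subdifferential f x \<subseteq> cball 0 1"
    unfolding clarke_subdifferential_def
  proof (rule hull_minimal)
    show "{V. \<exists>X D. X \<longlonglongrightarrow> x \<and> (\<forall>k. (f has_derivative blinfun_apply (D k)) (at (X k))) \<and> D \<longlonglongrightarrow> V} \<subseteq> cball 0 1"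
    proof clarify
      fix V X D assume D: "\<forall>k. (f has_derivative blinfun_apply (D k)) (at (X k))" "D \<longlonglongrightarrow> V"
      have "norm (D k) \<le> 1" for k
        using has_derivative_nonexpansive[OF D(1)[rule_format] nonexp] by (intro norm_blinfun_bound) auto
      then have "norm V \<le> 1"
        by (intro Lim_bounded[OF tendsto_norm[OF D(2)], of 0]) auto
      then show "V \<in> cball 0 1" by simp
    qed
  qed simp
  then have "norm V \<le> 1" using V by auto
  then show ?thesis
    using norm_blinfun[of V v] mult_right_mono[of "norm V" 1 "norm v"] by simp
qed

section \<open>The three constraint sets\<close>

lemma linear_entry: "linear (\<lambda>X. entry X i j)"
  by (rule linearI) (auto simp: entry_def plus_symmat.rep_eq scaleR_symmat.rep_eq)

lemma continuous_on_entry: "continuous_on S (\<lambda>X. entry X i j)"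
  by (rule linear_continuous_on) (use linear_entry in \<open>simp add: linear_conv_bounded_linear\<close>)

lemma closed_psd_cone: "closed (psd_cone :: 'n::finite symmat set)"
  and convex_psd_cone: "convex (psd_cone :: 'n::finite symmat set)"
  and zero_in_psd_cone: "0 \<in> (psd_cone :: 'n::finite symmat set)"
proof -
  have lin: "linear (\<lambda>X :: 'n symmat. v \<bullet> (mat_of_sym X *v v))" for v
    by (rule linearI) (auto simp: plus_symmat.rep_eq scaleR_symmat.rep_eq matrix_vector_mult_add_rdistrib
        scaleR_matrix_vector_assoc[symmetric] inner_add_right)
  have eq: "psd_cone = (\<Inter>v. (\<lambda>X :: 'n symmat. v \<bullet> (mat_of_sym X *v v)) -` {0..})"
    by (auto simp: psd_cone_def)
  show "closed (psd_cone :: 'n symmat set)"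
    unfolding eq using lin
    by (intro closed_INT ballI closed_vimage) (auto intro: linear_continuous_on simp: linear_conv_bounded_linear)
  show "convex (psd_cone :: 'n symmat set)"
    unfolding eq using lin by (intro convex_INT convex_linear_vimage) auto
  show "0 \<in> (psd_cone :: 'n symmat set)"
    by (auto simp: psd_cone_def zero_symmat.rep_eq)
qed

lemma box_convex_closed:
  fixes Q :: "'m::finite \<Rightarrow> real set"
  assumes "\<And>i. closed (Q i)" "\<And>i. is_interval (Q i)" "\<And>i. Q i \<noteq> {}"
  shows "convex (box Q)" "closed (box Q)" "box Q \<noteq> {}"
proof -
  have eq: "box Q = (\<Inter>i. (\<lambda>u. u $ i) -` Q i)" by (auto simp: box_def)
  show "convex (box Q)" unfolding eq
    using assms(2) by (intro convex_INT convex_linear_vimage bounded_linear.linear bounded_linear_vec_nth)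
      (auto simp: is_interval_convex)
  show "closed (box Q)" unfolding eq
    using assms(1) by (intro closed_INT ballI closed_vimage continuous_intros) auto
  have "(\<chi> i. SOME x. x \<in> Q i) \<in> box Q"
    using assms(3) by (simp add: box_def some_in_eq)
  then show "box Q \<noteq> {}" by blast
qed

definition entrywise :: "('n::finite \<Rightarrow> 'n \<Rightarrow> real set) \<Rightarrow> 'n symmat set" where
  "entrywise C = {x. \<forall>i j. entry x i j \<in> C i j}"

lemma entrywise_convex_closed:
  assumes "\<And>i j. polyhedron (C i j)"
  shows "convex (entrywise C)" "closed (entrywise C)"
proof -
  have eq: "entrywise C = (\<Inter>i. \<Inter>j. (\<lambda>x. entry x i j) -` C i j)" by (auto simp: entrywise_def)
  show "convex (entrywise C)" unfolding eq
    using assms by (intro convex_INT convex_linear_vimage linear_entry polyhedron_imp_convex)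
  show "closed (entrywise C)" unfolding eq
    using assms by (intro closed_INT ballI closed_vimage polyhedron_imp_closed continuous_on_entry)
qed

text \<open>Indicators are nonnegative, so one violated entry makes the whole sum infinite.\<close>

lemma hfun_eq_delta: "hfun C = delta (entrywise C)"
proof
  fix x
  show "hfun C x = delta (entrywise C) x"
  proof (cases "x \<in> entrywise C")
    case True
    then show ?thesis by (simp add: hfun_def delta_def entrywise_def)
  next
    case False
    then obtain i j where ij: "entry x i j \<notin> C i j" by (auto simp: entrywise_def)
    have nn: "0 \<le> delta (C i j) y" for i j y by (simp add: delta_def)
    have "delta (C i j) (entry x i j) \<le> (\<Sum>j\<in>UNIV. delta (C i j) (entry x i j))"
      using sum_mono2[of UNIV "{j}" "\<lambda>j. delta (C i j) (entry x i j)"] nn by simp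
    also have "\<dots> \<le> hfun C x"
      unfolding hfun_def
      using sum_mono2[of UNIV "{i}" "\<lambda>i. \<Sum>j\<in>UNIV. delta (C i j) (entry x i j)"] nn
      by (simp add: sum_nonneg)
    finally show ?thesis using ij False by (simp add: delta_def)
  qed
qed

section \<open>The problem in the form of the abstract saddle\<close>

definition coupling :: "('n::finite symmat \<Rightarrow> real^'m::finite) \<Rightarrow>
    'n symmat \<times> (real^'m) \<times> 'n symmat \<Rightarrow> (real^'m) \<times> 'n symmat" where
  "coupling A = (\<lambda>(x, u, q). (A x - u, x - q))"

definition feasible_set :: "('m::finite \<Rightarrow> real set) \<Rightarrow> ('n::finite \<Rightarrow> 'n \<Rightarrow> real set) \<Rightarrow>
    ('n symmat \<times> (real^'m) \<times> 'n symmat) set" where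
  "feasible_set Q C = psd_cone \<times> box Q \<times> entrywise C"

lemma linear_coupling: "linear A \<Longrightarrow> linear (coupling A)"
  by (rule linearI) (auto simp: coupling_def linear_add linear_cmul algebra_simps)

lemma adjoint_coupling:
  assumes "linear A"
  shows "adjoint (coupling A) = (\<lambda>(y, z). (adjoint A y + z, - y, - z))"
  by (rule adjoint_unique)
    (auto simp: coupling_def adjoint_clauses[OF assms] inner_diff_left inner_diff_right
      inner_add_left inner_add_right inner_commute algebra_simps)

lemma linear_adjoint_bounds:
  fixes A :: "'n::finite symmat \<Rightarrow> real^'m::finite"
  assumes "linear A"
  obtains a where "a \<ge> 1" "\<And>x. norm (A x) \<le> a * norm x" "\<And>y. norm (adjoint A y) \<le> a * norm y"
proof -
  obtain a1 where a1: "\<And>x. norm (A x) \<le> a1 * norm x"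
    using linear_bounded[OF assms] by blast
  obtain a2 where a2: "\<And>y. norm (adjoint A y) \<le> a2 * norm y"
    using linear_bounded[OF adjoint_linear[OF assms]] by blast
  let ?a = "max 1 (max a1 a2)"
  have "norm (A x) \<le> ?a * norm x" for x
    by (rule order_trans[OF a1 mult_right_mono]) auto
  moreover have "norm (adjoint A y) \<le> ?a * norm y" for y
    by (rule order_trans[OF a2 mult_right_mono]) auto
  ultimately show ?thesis by (intro that[of ?a]) auto
qed

lemma norm_adjoint_le:
  fixes f :: "'a::euclidean_space \<Rightarrow> 'b::euclidean_space"
  assumes "linear f" "\<And>x. norm (f x) \<le> a * norm x" "a \<ge> 0"
  shows "norm (adjoint f y) \<le> a * norm y"
proof (cases "adjoint f y = 0")
  case True
  then show ?thesis using assms(3) by simp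
next
  case False
  have "norm (adjoint f y) * norm (adjoint f y) = f (adjoint f y) \<bullet> y"
    using adjoint_works[OF assms(1), of "adjoint f y" y]
    by (simp add: power2_norm_eq_inner[symmetric] power2_eq_square inner_commute)
  also have "\<dots> \<le> norm (f (adjoint f y)) * norm y" by (rule norm_cauchy_schwarz)
  also have "\<dots> \<le> (a * norm (adjoint f y)) * norm y"
    by (intro mult_right_mono assms) auto
  finally show ?thesis using False by (simp add: mult.commute mult.left_commute)
qed

text \<open>Blockwise estimate; the transposed block inherits the bound of \<open>H2\<close> through
  \<open>norm_adjoint_le\<close>. The sum is a cubic in \<open>a\<close> with coefficients adding up
  to 24.\<close>

lemma jacobian_operator_bound:
  fixes A :: "'n::finite symmat \<Rightarrow> real^'m::finite"
    and DK Dh :: "'n symmat \<Rightarrow>\<^sub>L 'n symmat" and DQ :: "(real^'m) \<Rightarrow>\<^sub>L (real^'m)"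
  assumes A: "linear A" and a: "a \<ge> 1" "\<And>x. norm (A x) \<le> a * norm x" "\<And>y. norm (adjoint A y) \<le> a * norm y"
    and \<sigma>: "0 < \<sigma>" "\<sigma> \<le> a" "1 / \<sigma> \<le> a"
    and D: "\<And>v. norm (DK v) \<le> norm v" "\<And>v. norm (DQ v) \<le> norm v" "\<And>v. norm (Dh v) \<le> norm v"
  shows "norm (jacobian_operator A \<sigma> DK DQ Dh d) \<le> 30 * a ^ 3 * norm d"
proof -
  obtain y z x u q where d: "d = (y, z, x, u, q)" by (cases d)
  define n where "n = norm d"
  have n: "norm y \<le> n" "norm z \<le> n" "norm x \<le> n" "norm u \<le> n" "norm q \<le> n" "norm (y, z) \<le> 2 * n" "0 \<le> n"
  proof -
    have "norm (z, x, u, q) \<le> n" "norm y \<le> n" unfolding n_def d by (rule norm_snd_le norm_fst_le)+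
    moreover have "norm z \<le> norm (z, x, u, q)" "norm (x, u, q) \<le> norm (z, x, u, q)"
      by (rule norm_snd_le norm_fst_le)+
    moreover have "norm x \<le> norm (x, u, q)" "norm (u, q) \<le> norm (x, u, q)"
      by (rule norm_snd_le norm_fst_le)+
    moreover have "norm u \<le> norm (u, q)" "norm q \<le> norm (u, q)"
      by (rule norm_snd_le norm_fst_le)+
    moreover have "norm (y, z) \<le> norm y + norm z" by (rule norm_Pair_le)
    ultimately show "norm y \<le> n" "norm z \<le> n" "norm x \<le> n" "norm u \<le> n" "norm q \<le> n"
      "norm (y, z) \<le> 2 * n" by linarith+
    show "0 \<le> n" by (simp add: n_def)
  qed
  have K: "a \<le> a ^ 3" "a\<^sup>2 \<le> a ^ 3" "1 \<le> a ^ 3"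
    using a(1) power_increasing[of 1 3 a] power_increasing[of 2 3 a] by (auto intro: one_le_power)
  have An: "norm (A (DK v)) \<le> a * norm v" for v
    by (rule order_trans[OF a(2) mult_left_mono[OF D(1)]]) (use a in auto)
  have Ay: "norm (adjoint A y) \<le> a * n"
    by (rule order_trans[OF a(3) mult_left_mono[OF n(1)]]) (use a in auto)
  have sc: "norm (\<sigma> *\<^sub>R v) \<le> a * m" "norm ((1 / \<sigma>) *\<^sub>R v) \<le> a * m" if "norm v \<le> m" for m and v :: "'z::real_normed_vector"
    using that \<sigma> a(1) mult_mono[of \<sigma> a "norm v" m] mult_mono[of "1 / \<sigma>" a "norm v" m] by auto
  have sc': "norm (\<sigma> *\<^sub>R v) \<le> a * m" "norm ((1 / \<sigma>) *\<^sub>R v) \<le> a * m" if "norm v \<le> m" for m and v :: "real^'b"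
    using that \<sigma> a(1) mult_mono[of \<sigma> a "norm v" m] mult_mono[of "1 / \<sigma>" a "norm v" m] by auto
  have lin2: "linear (H2 A DK DQ Dh)"
    unfolding H2_def
    by (rule linearI) (auto simp: linear_add[OF A] linear_cmul[OF A] blinfun.add_right blinfun.scaleR_right algebra_simps)
  have H2: "norm (H2 A DK DQ Dh v) \<le> 4 * a * norm v" for v
  proof -
    obtain vx vu vq where v: "v = (vx, vu, vq)" by (cases v)
    have nv: "norm vx \<le> norm v" "norm vu \<le> norm v" "norm vq \<le> norm v"
      using norm_fst_le[of vx "(vu, vq)"] norm_snd_le[of "(vu, vq)" vx] norm_fst_le[of vu vq] norm_snd_le[of vq vu]
      unfolding v by linarith+
    have "norm (H2 A DK DQ Dh v) \<le> norm (A (DK vx) - DQ vu) + norm (DK vx - Dh vq)"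
      unfolding v H2_def by (simp add: norm_Pair_le)
    also have "\<dots> \<le> (norm (A (DK vx)) + norm (DQ vu)) + (norm (DK vx) + norm (Dh vq))"
      by (intro add_mono norm_triangle_ineq4)
    also have "\<dots> \<le> (a * norm v + norm v) + (norm v + norm v)"
      using nv D(2)[of vu] D(1)[of vx] D(3)[of vq] order_trans[OF An[of vx] mult_left_mono[OF nv(1)]] a(1)
      by (intro add_mono) auto
    also have "\<dots> \<le> 4 * a * norm v"
      using mult_right_mono[OF a(1), of "norm v"] by simp
    finally show ?thesis .
  qed
  define y' z' where "y' = \<sigma> *\<^sub>R (DQ y + A (DK (adjoint A y))) + \<sigma> *\<^sub>R A (DK z) + (A (DK x) - DQ u)"
    and "z' = \<sigma> *\<^sub>R DK (adjoint A y) + \<sigma> *\<^sub>R (Dh z + DK z) + (DK x - Dh q)"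
  define w1 w2 where "w1 = adjoint (H2 A DK DQ Dh) (y, z)"
    and "w2 = H3 \<sigma> DK DQ Dh (x, u, q)"
  have eq: "jacobian_operator A \<sigma> DK DQ Dh d = (y', z', - w1 + w2)"
    unfolding d jacobian_operator_def H1_def w1_def w2_def y'_def z'_def
    by (auto simp: H2_def split: prod.splits)
  have y': "norm y' \<le> a * (n + a * (a * n)) + a * (a * n) + (a * n + n)"
    unfolding y'_def
  proof (intro norm_triangle_mono)
    show "norm (\<sigma> *\<^sub>R (DQ y + A (DK (adjoint A y)))) \<le> a * (n + a * (a * n))"
      using D(2)[of y] n a(1) order_trans[OF An[of "adjoint A y"] mult_left_mono[OF Ay]]
      by (intro sc' norm_triangle_mono) auto
    show "norm (\<sigma> *\<^sub>R A (DK z)) \<le> a * (a * n)"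
      using order_trans[OF An[of z] mult_left_mono[OF n(2)]] a(1) by (intro sc') auto
    show "norm (A (DK x) - DQ u) \<le> a * n + n"
      using order_trans[OF An[of x] mult_left_mono[OF n(3)]] a(1) D(2)[of u] n
      by (intro order_trans[OF norm_triangle_ineq4] add_mono) auto
  qed
  have z': "norm z' \<le> a * (a * n) + a * (n + n) + (n + n)"
    unfolding z'_def
  proof (intro norm_triangle_mono)
    show "norm (\<sigma> *\<^sub>R DK (adjoint A y)) \<le> a * (a * n)"
      using D(1)[of "adjoint A y"] Ay by (intro sc) auto
    show "norm (\<sigma> *\<^sub>R (Dh z + DK z)) \<le> a * (n + n)"
      using D(1)[of z] D(3)[of z] n by (intro sc norm_triangle_mono) auto
    show "norm (DK x - Dh q) \<le> n + n"
      using D(1)[of x] D(3)[of q] n by (intro order_trans[OF norm_triangle_ineq4] add_mono) auto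
  qed
  have w1: "norm w1 \<le> 4 * a * (2 * n)"
    unfolding w1_def
    by (rule order_trans[OF norm_adjoint_le[OF lin2 H2] mult_left_mono[OF n(6)]]) (use a in auto)
  have w2: "norm w2 \<le> a * (n + n) + (a * (n + n) + a * (n + n))"
  proof -
    have "norm (x - DK x) \<le> n + n" "norm (u - DQ u) \<le> n + n" "norm (q - Dh q) \<le> n + n"
      using D(1)[of x] D(2)[of u] D(3)[of q] n
      by (intro order_trans[OF norm_triangle_ineq4] add_mono; simp)+
    then show ?thesis
      unfolding w2_def H3_def prod.case
      by (intro order_trans[OF norm_Pair_le] add_mono sc sc')
  qed
  have "norm (jacobian_operator A \<sigma> DK DQ Dh d) \<le> norm y' + (norm z' + (norm w1 + norm w2))"
    unfolding eq
    using norm_Pair_le[of y' "(z', - w1 + w2)"] norm_Pair_le[of z' "- w1 + w2"] norm_triangle_ineq[of "- w1" w2]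
    by simp
  also have "\<dots> \<le> (a ^ 3 * n + a\<^sup>2 * n + 2 * (a * n) + n) + (a\<^sup>2 * n + 2 * (a * n) + 2 * n + 14 * (a * n))"
    using y' z' w1 w2 by (simp add: power2_eq_square power3_eq_cube algebra_simps)
  also have "\<dots> \<le> 30 * (a ^ 3 * n)"
    using mult_right_mono[OF K(1) n(7)] mult_right_mono[OF K(2) n(7)] mult_right_mono[OF K(3) n(7)] n(7) by linarith
  finally show ?thesis by (simp add: n_def)
qed

lemma feasible_set_props:
  assumes "\<And>i. closed (Q i)" "\<And>i. is_interval (Q i)" "\<And>i. Q i \<noteq> {}"
    and "\<And>i j. polyhedron (C i j)" "\<exists>x :: 'n::finite symmat. \<forall>i j. entry x i j \<in> C i j"
  shows "convex (feasible_set Q C)" "closed (feasible_set Q C)" "feasible_set Q C \<noteq> {}"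
    "entrywise C \<noteq> {}"
proof -
  show ne: "entrywise C \<noteq> {}" using assms(5) by (auto simp: entrywise_def)
  note b = box_convex_closed[of Q, OF assms(1-3)] and e = entrywise_convex_closed[of C, OF assms(4)]
  show "convex (feasible_set Q C)" "closed (feasible_set Q C)"
    unfolding feasible_set_def
    by (intro convex_Times closed_Times b e convex_psd_cone closed_psd_cone)+
  show "feasible_set Q C \<noteq> {}"
    using b(3) ne zero_in_psd_cone by (auto simp: feasible_set_def)
qed

lemma projection_feasible_set:
  fixes A :: "'n::finite symmat \<Rightarrow> real^'m::finite"
  assumes A: "linear A" and Q: "\<And>i. closed (Q i)" "\<And>i. is_interval (Q i)" "\<And>i. Q i \<noteq> {}"
    and C: "\<And>i j. polyhedron (C i j)" "\<exists>x :: 'n symmat. \<forall>i j. entry x i j \<in> C i j" and \<sigma>: "\<sigma> > 0"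
  shows "closest_point (feasible_set Q C) ((x, u, q) + \<sigma> *\<^sub>R (adjoint (coupling A) (y, z) - (c, 0, 0)))
    = (closest_point psd_cone (x + \<sigma> *\<^sub>R (adjoint A y + z - c)),
       closest_point (box Q) (u - \<sigma> *\<^sub>R y), prox \<sigma> (hfun C) (q - \<sigma> *\<^sub>R z))"
proof -
  note b = box_convex_closed[of Q, OF Q] and e = entrywise_convex_closed[of C, OF C(1)]
    feasible_set_props(4)[of Q C, OF Q C]
  have psd: "psd_cone \<noteq> {}" using zero_in_psd_cone by blast
  have "(x, u, q) + \<sigma> *\<^sub>R (adjoint (coupling A) (y, z) - (c, 0, 0))
      = (x + \<sigma> *\<^sub>R (adjoint A y + z - c), u - \<sigma> *\<^sub>R y, q - \<sigma> *\<^sub>R z)"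
    by (simp add: adjoint_coupling[OF A])
  then show ?thesis
    unfolding feasible_set_def
    by (simp add: closest_point_Times convex_Times closed_Times b e psd convex_psd_cone closed_psd_cone
        hfun_eq_delta prox_delta \<sigma>)
qed

text \<open>Dual feasibility eliminates \<open>s\<close>:
  \<open>adjoint (coupling A) (y, z) - (c, 0, 0)\<close> is \<open>(- s, - y, - z)\<close>, so the
  dual objective is the support function of \<open>feasible_set Q C\<close> at this point. Barrier
  cone and relative interior respect products, so the three Slater conditions become the single one
  of \<open>dual_optimum_multiplier\<close>.\<close>

lemma kkt_point:
  fixes A :: "'n::finite symmat \<Rightarrow> real^'m::finite"
  assumes A: "linear A" and Q: "\<And>i. closed (Q i)" "\<And>i. is_interval (Q i)" "\<And>i. Q i \<noteq> {}"
    and C: "\<And>i j. polyhedron (C i j)" "\<exists>x :: 'n symmat. \<forall>i j. entry x i j \<in> C i j"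
    and opt: "\<exists>y z s. dual_optimal A c Q C y z s" and slater: "dual_slater A c Q C"
  obtains Y P where "P \<in> feasible_set Q C" "coupling A P = 0"
    "\<And>p. p \<in> feasible_set Q C \<Longrightarrow> (adjoint (coupling A) Y - (c, 0, 0)) \<bullet> (p - P) \<le> 0"
proof -
  note b = box_convex_closed[of Q, OF Q] and e = entrywise_convex_closed[of C, OF C(1)]
    feasible_set_props(4)[of Q C, OF Q C]
  have psd: "psd_cone \<noteq> {}" using zero_in_psd_cone by blast
  have adj: "adjoint (coupling A) (y, z) - (c, 0, 0) = (adjoint A y + z - c, - y, - z)" for y z
    by (simp add: adjoint_coupling[OF A])
  obtain y0 z0 s0 where 0: "adjoint A y0 + s0 + z0 = c"
     "- y0 \<in> rel_interior (barrier_cone (box Q))"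
     "- s0 \<in> rel_interior (barrier_cone (psd_cone :: 'n symmat set))"
     "- z0 \<in> rel_interior (barrier_cone (entrywise C))"
    using slater unfolding dual_slater_def dual_feasible_def hfun_eq_delta effective_domain_conjugate_delta
    by blast
  have "adjoint A y0 + z0 - c = - s0" using 0(1) by (simp add: algebra_simps eq_neg_iff_add_eq_0)
  then have ri: "adjoint (coupling A) (y0, z0) - (c, 0, 0) \<in> rel_interior (barrier_cone (feasible_set Q C))"
    using 0 unfolding adj feasible_set_def
    by (simp add: barrier_cone_Times psd b e rel_interior_Times convex_barrier_cone convex_Times)
  obtain y z s where "dual_optimal A c Q C y z s" using opt by blast
  then have s: "- s = adjoint A y + z - c"
    and min: "\<And>y' z' s'. adjoint A y' + s' + z' = c \<Longrightarrow> dual_objective Q C y z s \<le> dual_objective Q C y' z' s'"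
    unfolding dual_optimal_def dual_feasible_def by (auto simp: algebra_simps)
  \<comment> \<open>A bound for another dual point bounds its objective, hence the optimal
    objective, hence each pairing of the optimal point.\<close>
  have opt': "(adjoint (coupling A) (y, z) - (c, 0, 0)) \<bullet> p \<le> r"
    if r: "\<And>p. p \<in> feasible_set Q C \<Longrightarrow> (adjoint (coupling A) Y' - (c, 0, 0)) \<bullet> p \<le> r"
      and p: "p \<in> feasible_set Q C" for Y' r p
  proof -
    obtain y' z' where Y': "Y' = (y', z')" by (cases Y')
    define s' where "s' = c - adjoint A y' - z'"
    have r': "- z' \<bullet> x3 + - y' \<bullet> x2 + - s' \<bullet> x1 \<le> r"
      if "x1 \<in> psd_cone" "x2 \<in> box Q" "x3 \<in> entrywise C" for x1 x2 x3
      using r[of "(x1, x2, x3)"] that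
      by (simp add: Y' adj feasible_set_def s'_def inner_prod_def inner_diff_left inner_add_left)
    have "dual_objective Q C y' z' s' \<le> ereal r"
      unfolding dual_objective_def hfun_eq_delta
    proof (intro add_fenchel_conjugate_delta_le psd)
      show "fenchel_conjugate (delta (entrywise C)) (- z') + fenchel_conjugate (delta (box Q)) (- y') \<noteq> - \<infinity>"
        using fenchel_conjugate_delta_neq[OF e(3)] fenchel_conjugate_delta_neq[OF b(3)]
        by (simp add: ereal_plus_eq_MInfty)
      fix x1 :: "'n symmat" assume x1: "x1 \<in> psd_cone"
      have "ereal (- s' \<bullet> x1) + fenchel_conjugate (delta (entrywise C)) (- z')
          + fenchel_conjugate (delta (box Q)) (- y') \<le> ereal r"
      proof (rule add_fenchel_conjugate_delta_le[OF b(3)])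
        show "ereal (- s' \<bullet> x1) + fenchel_conjugate (delta (entrywise C)) (- z') \<noteq> - \<infinity>"
          using fenchel_conjugate_delta_neq[OF e(3)] by (simp add: ereal_plus_eq_MInfty)
        fix x2 assume x2: "x2 \<in> box Q"
        have "ereal (- s' \<bullet> x1 + - y' \<bullet> x2) + fenchel_conjugate (delta (entrywise C)) (- z') \<le> ereal r"
        proof (rule add_fenchel_conjugate_delta_le[OF e(3)])
          fix x3 assume "x3 \<in> entrywise C"
          from r'[OF x1 x2 this] show "ereal (- s' \<bullet> x1 + - y' \<bullet> x2) + ereal (- z' \<bullet> x3) \<le> ereal r"
            by simp
        qed simp
        then show "ereal (- s' \<bullet> x1) + fenchel_conjugate (delta (entrywise C)) (- z') + ereal (- y' \<bullet> x2) \<le> ereal r"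
          by (metis (no_types, lifting) add.assoc add.commute plus_ereal.simps(1))
      qed
      then show "fenchel_conjugate (delta (entrywise C)) (- z') + fenchel_conjugate (delta (box Q)) (- y')
          + ereal (- s' \<bullet> x1) \<le> ereal r"
        by (metis (no_types, lifting) add.assoc add.commute)
    qed
    then have le: "dual_objective Q C y z s \<le> ereal r"
      using min[of y' s' z'] by (simp add: s'_def order_trans)
    obtain x1 x2 x3 where p': "p = (x1, x2, x3)" "x1 \<in> psd_cone" "x2 \<in> box Q" "x3 \<in> entrywise C"
      using p unfolding feasible_set_def by auto
    have "ereal (- z \<bullet> x3) + ereal (- y \<bullet> x2) + ereal (- s \<bullet> x1) \<le> dual_objective Q C y z s"
      unfolding dual_objective_def hfun_eq_delta
      using p' by (intro add_mono fenchel_conjugate_delta_ge) auto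
    also note le
    finally show ?thesis
      unfolding adj p'(1) s[symmetric] by (simp add: inner_prod_def)
  qed
  show ?thesis
  proof (rule dual_optimum_multiplier[OF _ _ _ linear_coupling[OF A] ri])
    show "closed (feasible_set Q C)" "convex (feasible_set Q C)" "feasible_set Q C \<noteq> {}"
      by (rule feasible_set_props[of Q C, OF Q C])+
  qed (fact opt', fact that)
qed

text \<open>Take \<open>e = \<eta> - J d\<close>. Since \<open>2 * CJ \<le> \<tau>\<close>, the term
  \<open>J d\<close> uses at most half of \<open>\<tau> * norm d\<close>; thus \<open>norm d\<close>
  is at most \<open>2 * (C + norm F) / \<tau>\<close>, and \<open>J d\<close> is itself a
  perturbation of order \<open>(1 + norm F) / \<tau>\<close>.\<close>

lemma newton_step_is_euler_step:
  fixes J :: "'a::real_normed_vector \<Rightarrow> 'a"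
  assumes J: "norm (J d) \<le> CJ * norm d" and \<tau>: "\<tau> > 0" and CJ: "0 \<le> CJ" "2 * CJ \<le> \<tau>" and \<tau>1: "\<tau> \<ge> 1"
    and sol: "inexact_solution J \<tau> F (C / \<tau>) d" and C: "C \<ge> 0"
  obtains e where "d = (1 / \<tau>) *\<^sub>R (e - F)" "norm e \<le> (C + 2 * CJ * (1 + C)) * (1 / \<tau>) * (1 + norm F)"
proof -
  obtain \<eta> where \<eta>: "norm \<eta> \<le> C / \<tau>" "J d + \<tau> *\<^sub>R d = - F + \<eta>"
    using sol unfolding inexact_solution_def by blast
  have \<eta>C: "norm \<eta> \<le> C" using \<eta>(1) \<tau>1 C by (smt (verit) divide_le_eq_1 divide_self_if frac_le div_by_1)
  define e where "e = \<eta> - J d"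
  have \<tau>d: "\<tau> *\<^sub>R d = e - F" using \<eta>(2) by (simp add: e_def algebra_simps)
  then have "d = (1 / \<tau>) *\<^sub>R (e - F)" using \<tau> by (metis divide_inverse_commute div_by_1 inverse_eq_divide less_irrefl real_vector.scale_right_imp_eq scaleR_one vector_fraction_eq_iff divideR_right)
  have "\<tau> * norm d = norm (\<eta> - J d - F)"
    using \<tau>d \<tau> by (metis e_def abs_of_pos norm_scaleR)
  also have "\<dots> \<le> norm \<eta> + norm (J d) + norm F"
    by (rule order_trans[OF norm_triangle_ineq4 add_right_mono[OF norm_triangle_ineq4]])
  also have "\<dots> \<le> C + \<tau> / 2 * norm d + norm F"
    using \<eta>C J CJ mult_right_mono[of CJ "\<tau> / 2" "norm d"] by simp
  finally have "norm d \<le> 2 * (C + norm F) / \<tau>" using \<tau> by (simp add: field_simps)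
  then have "CJ * norm d \<le> CJ * (2 * (C + norm F) / \<tau>)" using CJ by (intro mult_left_mono)
  then have "norm e \<le> C / \<tau> + CJ * (2 * (C + norm F) / \<tau>)"
    using norm_triangle_ineq4[of \<eta> "J d"] \<eta>(1) J unfolding e_def by linarith
  also have "\<dots> = (C + 2 * CJ * (C + norm F)) * (1 / \<tau>)"
    by (simp add: divide_inverse algebra_simps)
  also have "\<dots> \<le> ((C + 2 * CJ * (1 + C)) * (1 + norm F)) * (1 / \<tau>)"
  proof (rule mult_right_mono)
    have "C + norm F \<le> (1 + C) * (1 + norm F)" using C by (simp add: algebra_simps)
    from mult_left_mono[OF this, of "2 * CJ"] have "2 * CJ * (C + norm F) \<le> 2 * CJ * (1 + C) * (1 + norm F)"
      using CJ by (simp add: mult.assoc)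
    moreover have "C \<le> C * (1 + norm F)" using C by (simp add: algebra_simps)
    ultimately show "C + 2 * CJ * (C + norm F) \<le> (C + 2 * CJ * (1 + C)) * (1 + norm F)"
      by (simp only: distrib_right)
  qed (use \<tau> in simp)
  finally have "norm e \<le> (C + 2 * CJ * (1 + C)) * (1 / \<tau>) * (1 + norm F)" by (simp add: ac_simps)
  with \<open>d = (1 / \<tau>) *\<^sub>R (e - F)\<close> show ?thesis by (rule that)
qed

text \<open>\<open>\<beta> > 1 / 3\<close> makes the cubes summable, \<open>\<beta> \<le> 1\<close>
  makes the total time infinite. \<open>max 1 k\<close> differs from \<open>k\<close> only at 0,
  where division by \<open>0 powr \<beta> = 0\<close> would give the length 0.\<close>

lemma step_lengths:
  fixes \<kappa> \<beta> :: real
  assumes \<kappa>: "\<kappa> > 0" and \<beta>: "1 / 3 < \<beta>" "\<beta> \<le> 1"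
  defines "t \<equiv> \<lambda>k::nat. 1 / (\<kappa> * real (max 1 k) powr \<beta>)"
  shows "t k > 0" "t \<longlonglongrightarrow> 0" "summable (\<lambda>k. t k ^ 3)" "\<not> summable t"
proof -
  show "t k > 0" using \<kappa> by (simp add: t_def)
  have eq: "t k = (1 / \<kappa>) * real k powr (- \<beta>)" if "k \<ge> 1" for k
    using that by (simp add: t_def powr_minus field_simps max_def)
  then have ev: "\<forall>\<^sub>F k in sequentially. t k = (1 / \<kappa>) * real k powr (- \<beta>)"
    unfolding eventually_sequentially by blast
  have "(\<lambda>k. (1 / \<kappa>) * real k powr (- \<beta>)) \<longlonglongrightarrow> (1 / \<kappa>) * 0"
    using \<beta> by (intro tendsto_mult tendsto_const tendsto_neg_powr filterlim_real_sequentially) auto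
  then show "t \<longlonglongrightarrow> 0" using tendsto_cong[OF ev] by simp
  have "summable t \<longleftrightarrow> summable (\<lambda>k. (1 / \<kappa>) * real k powr (- \<beta>))"
    by (rule summable_cong[OF ev])
  also have "\<dots> \<longleftrightarrow> summable (\<lambda>k. real k powr (- \<beta>))"
    using \<kappa> by (subst summable_cmult_iff) auto
  also have "\<dots> \<longleftrightarrow> - \<beta> < - 1" by (rule summable_real_powr_iff)
  finally show "\<not> summable t" using \<beta> by simp
  have "\<forall>\<^sub>F k in sequentially. t k ^ 3 = (1 / \<kappa>) ^ 3 * real k powr (- (3 * \<beta>))"
    using ev by eventually_elim (simp add: power_mult_distrib power_divide power3_eq_cube powr_add[symmetric])
  then have "summable (\<lambda>k. t k ^ 3) \<longleftrightarrow> summable (\<lambda>k. (1 / \<kappa>) ^ 3 * real k powr (- (3 * \<beta>)))"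
    by (rule summable_cong)
  also have "\<dots>"
    using \<beta> by (intro summable_mult) (auto simp: summable_real_powr_iff)
  finally show "summable (\<lambda>k. t k ^ 3)" .
qed

theorem theorem4:
  fixes A :: "'n::finite symmat \<Rightarrow> real^'m::finite"
    and c :: "'n symmat"
    and Q :: "'m \<Rightarrow> real set"
    and C :: "'n \<Rightarrow> 'n \<Rightarrow> real set"
    and \<sigma> \<kappa>\<^sub>1 \<gamma> \<nu> \<beta> \<kappa> C\<^sub>\<eta> :: real
    and \<zeta> imax :: nat
    and vs \<theta> l \<rho> :: "nat \<Rightarrow> real"
    and w :: "nat \<Rightarrow> ('m, 'n) state"
  assumes "linear A"
    and "\<And>i. closed (Q i)" and "\<And>i. is_interval (Q i)" and "\<And>i. Q i \<noteq> {}"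
    and "\<And>i j. polyhedron (C i j)" and "\<exists>x :: 'n symmat. \<forall>i j. entry x i j \<in> C i j"
    and "\<exists>y z s. dual_optimal A c Q C y z s"
    and "dual_slater A c Q C"
    and "\<sigma> > 0" and "\<kappa>\<^sub>1 \<ge> 1" and "\<gamma> > 1" and "0 < \<nu>" and "\<nu> < 1"
    and "1 / 3 < \<beta>" and "\<beta> \<le> 1" and "\<kappa> > 0" and "\<zeta> \<ge> 1" and "C\<^sub>\<eta> > 0"
    and "\<And>k. k \<ge> 1 \<Longrightarrow> vs k \<ge> 0" and "\<And>k. k \<ge> 1 \<Longrightarrow> \<theta> k \<ge> 0"
    and "\<And>k. k \<ge> 1 \<Longrightarrow> l k \<ge> 0" and "\<And>k. k \<ge> 1 \<Longrightarrow> \<rho> k \<ge> 0"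
    and "summable (\<lambda>k. (vs k)\<^sup>2)"
    and "ssncp_sequence A c Q C \<sigma> \<kappa>\<^sub>1 \<gamma> \<nu> \<beta> \<kappa> \<zeta> imax vs \<theta> l \<rho> C\<^sub>\<eta> w"
  shows "(\<lambda>k. residual A c Q C \<sigma> (w k)) \<longlonglongrightarrow> 0"
proof -
  note A = \<open>linear A\<close>
  note Q = assms(2-4) and C = assms(5,6)
  define F where "F = residual A c Q C \<sigma>"
  note S = feasible_set_props(1-3)[of Q C, OF Q C]
  obtain K0 where K0: "\<And>x. norm (coupling A x) \<le> K0 * norm x"
    using linear_bounded[OF linear_coupling[OF A]] by blast
  define K where "K = Max {1, K0, \<sigma>, 1 / \<sigma>}"
  have K: "1 \<le> K" "K0 \<le> K" "\<sigma> \<le> K" "1 / \<sigma> \<le> K" by (auto simp: K_def)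
  have KB: "norm (coupling A x) \<le> K * norm x" for x
    using order_trans[OF K0 mult_right_mono[OF K(2)]] by simp
  obtain a0 where a0: "a0 \<ge> 1" "\<And>x. norm (A x) \<le> a0 * norm x" "\<And>y. norm (adjoint A y) \<le> a0 * norm y"
    using linear_adjoint_bounds[OF A] by blast
  define a where "a = max a0 K"
  have a: "a \<ge> 1" "\<sigma> \<le> a" "1 / \<sigma> \<le> a" "\<And>x. norm (A x) \<le> a * norm x" "\<And>y. norm (adjoint A y) \<le> a * norm y"
    using a0(1) K order_trans[OF a0(2) mult_right_mono[of a0 a]] order_trans[OF a0(3) mult_right_mono[of a0 a]]
    by (auto simp: a_def)
  define CJ where "CJ = 30 * a ^ 3"
  have CJ: "CJ \<ge> 0" using a(1) by (simp add: CJ_def)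
  have J_bound: "norm (J d) \<le> CJ * norm d" if J: "J \<in> generalized_jacobian A c Q C \<sigma> v" for J v d
  proof -
    obtain y z x u q where v: "v = (y, z, x, u, q)" by (cases v)
    obtain DK DQ Dh where D: "J = jacobian_operator A \<sigma> DK DQ Dh"
      "DK \<in> clarke_subdifferential (closest_point psd_cone) (x + \<sigma> *\<^sub>R (adjoint A y + z - c))"
      "DQ \<in> clarke_subdifferential (closest_point (box Q)) (u - \<sigma> *\<^sub>R y)"
      "Dh \<in> clarke_subdifferential (prox \<sigma> (hfun C)) (q - \<sigma> *\<^sub>R z)"
      using J unfolding generalized_jacobian_def v by auto
    note b = box_convex_closed[of Q, OF Q] and e = entrywise_convex_closed[of C, OF C(1)]
      feasible_set_props(4)[of Q C, OF Q C]
    have psd: "(psd_cone :: 'n symmat set) \<noteq> {}" using zero_in_psd_cone by blast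
    have "norm (DK v) \<le> norm v" for v
      by (rule clarke_subdifferential_nonexpansive[OF closest_point_lipschitz[OF convex_psd_cone closed_psd_cone psd] D(2)])
    moreover have "norm (DQ v) \<le> norm v" for v
      by (rule clarke_subdifferential_nonexpansive[OF closest_point_lipschitz[OF b] D(3)])
    moreover have "norm (Dh v) \<le> norm v" for v
    proof -
      have "prox \<sigma> (hfun C) = closest_point (entrywise C)"
        unfolding hfun_eq_delta using prox_delta[OF e \<open>\<sigma> > 0\<close>] by blast
      then show ?thesis
        using clarke_subdifferential_nonexpansive[OF closest_point_lipschitz[OF e]] D(4) by metis
    qed
    ultimately show ?thesis
      unfolding D(1) CJ_def using jacobian_operator_bound[OF A a(1,4,5) \<open>\<sigma> > 0\<close> a(2,3)] by blast
  qed
  define t where "t k = 1 / (\<kappa>\<^sub>1 * real (max 1 k) powr \<beta>)" for k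
  have "\<kappa>\<^sub>1 > 0" using \<open>\<kappa>\<^sub>1 \<ge> 1\<close> by simp
  note t = step_lengths[OF this \<open>1 / 3 < \<beta>\<close> \<open>\<beta> \<le> 1\<close>, folded t_def]
  define C0 where "C0 = C\<^sub>\<eta> * \<kappa>\<^sub>1"
  have C0: "C0 \<ge> 0" using \<open>C\<^sub>\<eta> > 0\<close> \<open>\<kappa>\<^sub>1 \<ge> 1\<close> by (simp add: C0_def)
  define cN where "cN = max K (C0 + 2 * CJ * (1 + C0))"
  define Y where "Y k = (fst (w k), fst (snd (w k)))" for k
  define X where "X k = snd (snd (w k))" for k
  interpret perturbed_iteration "feasible_set Q C" "coupling A" "(c, 0, 0)" \<sigma> K Y X t cN
    by (intro perturbed_iteration.intro projected_saddle.intro perturbed_iteration_axioms.intro)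
      (use S linear_coupling[OF A] \<open>\<sigma> > 0\<close> K KB t in \<open>simp_all add: cN_def\<close>)
  have F_eq: "F (w k) = (let f = coupling A (P (Y k) (X k)) in (fst f, snd f, (1 / \<sigma>) *\<^sub>R R (Y k) (X k)))" for k
  proof -
    obtain y z x u q where v: "w k = (y, z, x, u, q)" by (cases "w k")
    have P: "P (y, z) (x, u, q) = (closest_point psd_cone (x + \<sigma> *\<^sub>R (adjoint A y + z - c)),
       closest_point (box Q) (u - \<sigma> *\<^sub>R y), prox \<sigma> (hfun C) (q - \<sigma> *\<^sub>R z))"
      unfolding P_def by (rule projection_feasible_set[OF A Q C \<open>\<sigma> > 0\<close>])
    have YX: "Y k = (y, z)" "X k = (x, u, q)" by (simp_all add: Y_def X_def v)
    show ?thesis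
      unfolding YX R_def P F_def residual_def v by (simp add: Let_def coupling_def)
  qed
  have norm_F: "norm (F (w k)) = sqrt (2 * energy (Y k) (X k))" for k
  proof -
    have "(norm (F (w k)))\<^sup>2 = (norm (coupling A (P (Y k) (X k))))\<^sup>2 + (norm ((1 / \<sigma>) *\<^sub>R R (Y k) (X k)))\<^sup>2"
      unfolding F_eq Let_def
      by (cases "coupling A (P (Y k) (X k))") (simp add: norm_Pair)
    also have "\<dots> = 2 * energy (Y k) (X k)"
      by (simp add: energy_def power_divide)
    finally show ?thesis by (metis norm_ge_zero real_sqrt_unique)
  qed
  obtain Ys Xs where sol: "Xs \<in> feasible_set Q C" "coupling A Xs = 0"
    "\<And>p. p \<in> feasible_set Q C \<Longrightarrow> (adjoint (coupling A) Ys - (c, 0, 0)) \<bullet> (p - Xs) \<le> 0"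
    using kkt_point[OF A Q C assms(7,8)] by metis
  \<comment> \<open>The argument of the projection is \<open>Xs\<close> plus a positive multiple of
    a normal vector at \<open>Xs\<close>.\<close>
  have "P Ys Xs = Xs"
    unfolding P_def
    by (rule closest_point_eqI[OF S(1,2) sol(1)]) (use sol(3) \<open>\<sigma> > 0\<close> in \<open>auto simp: mult_nonneg_nonpos\<close>)
  \<comment> \<open>From \<open>m\<close> on \<open>2 * CJ + 1 \<le> \<tau>\<close>, as
    \<open>newton_step_is_euler_step\<close> requires.\<close>
  obtain m where m: "\<And>k. k \<ge> m \<Longrightarrow> t k \<le> 1 / (2 * CJ + 1)"
    using small_steps[of "1 / (2 * CJ + 1)"] CJ by auto
  define m1 where "m1 = max 1 m"
  have alt: "sqrt (2 * energy (Y (Suc k)) (X (Suc k))) \<le> \<nu> * (MAX j\<in>{max 1 (k + 1 - \<zeta>)..k}. sqrt (2 * energy (Y j) (X j))) + vs k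
      \<or> euler_at k" if "k \<ge> m1" for k
  proof -
    have k: "k \<ge> 1" "k \<ge> m" using that by (auto simp: m1_def)
    \<comment> \<open>The algorithm becomes an alternative: the next iterate satisfies (D1), or it
      results from a (D2) step.\<close>
    obtain J where J: "J \<in> generalized_jacobian A c Q C \<sigma> (w k)"
      "norm (F (w (Suc k))) \<le> \<nu> * (MAX j\<in>{max 1 (k + 1 - \<zeta>)..k}. norm (F (w j))) + vs k
       \<or> (\<exists>d. inexact_solution J (\<kappa>\<^sub>1 * real k powr \<beta>) (F (w k)) (C\<^sub>\<eta> * real k powr (- \<beta>)) d \<and> w (Suc k) = w k + d)"
      using assms(24) k(1) unfolding ssncp_sequence_def Let_def F_def[symmetric] by metis
    have "euler_at k" if d: "inexact_solution J (\<kappa>\<^sub>1 * real k powr \<beta>) (F (w k)) (C\<^sub>\<eta> * real k powr (- \<beta>)) d"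
      "w (Suc k) = w k + d" for d
    proof -
      define \<tau> where "\<tau> = \<kappa>\<^sub>1 * real k powr \<beta>"
      have tk: "t k = 1 / \<tau>" using k by (simp add: t_def \<tau>_def max_def)
      have \<tau>: "\<tau> > 0" using k \<open>\<kappa>\<^sub>1 > 0\<close> by (simp add: \<tau>_def)
      have "1 / \<tau> \<le> 1 / (2 * CJ + 1)" using m[OF k(2)] tk by simp
      then have \<tau>2: "2 * CJ + 1 \<le> \<tau>" using \<tau> CJ by (simp add: field_simps)
      have eq: "C\<^sub>\<eta> * real k powr (- \<beta>) = C0 / \<tau>"
        using \<open>\<kappa>\<^sub>1 > 0\<close> by (simp add: C0_def \<tau>_def powr_minus divide_inverse)
      obtain e where e: "d = (1 / \<tau>) *\<^sub>R (e - F (w k))"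
        "norm e \<le> (C0 + 2 * CJ * (1 + C0)) * (1 / \<tau>) * (1 + norm (F (w k)))"
        by (rule newton_step_is_euler_step[where J = J and CJ = CJ and \<tau> = \<tau> and F = "F (w k)" and C = C0 and d = d])
          (use J_bound[OF J(1)] \<tau> CJ \<tau>2 C0 d(1) in \<open>auto simp: eq \<tau>_def[symmetric]\<close>)
      have e_le: "norm e \<le> cN * t k * (1 + sqrt (2 * energy (Y k) (X k)))"
      proof -
        have "(C0 + 2 * CJ * (1 + C0)) * (1 / \<tau>) * (1 + norm (F (w k))) \<le> cN * (1 / \<tau>) * (1 + norm (F (w k)))"
          using \<tau> by (intro mult_right_mono) (auto simp: cN_def)
        with e(2) show ?thesis unfolding norm_F tk by linarith
      qed
      define e1 where "e1 = (fst e, fst (snd e))"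
      define e2 where "e2 = snd (snd e)"
      have ne: "norm e1 \<le> norm e" "norm e2 \<le> norm e"
      proof -
        have "(norm e)\<^sup>2 = (norm e1)\<^sup>2 + (norm e2)\<^sup>2"
          by (cases e) (simp add: e1_def e2_def norm_Pair)
        then have "(norm e1)\<^sup>2 \<le> (norm e)\<^sup>2" "(norm e2)\<^sup>2 \<le> (norm e)\<^sup>2" by auto
        then show "norm e1 \<le> norm e" "norm e2 \<le> norm e" by (auto intro: power2_le_imp_le)
      qed
      have "Y (Suc k) = Y k + t k *\<^sub>R (e1 - coupling A (P (Y k) (X k)))"
        unfolding Y_def[of "Suc k"] d(2) e(1) F_eq
        by (cases "coupling A (P (Y k) (X k))") (simp add: Y_def e1_def tk Let_def)
      moreover have "X (Suc k) = X k + t k *\<^sub>R (e2 - (1 / \<sigma>) *\<^sub>R R (Y k) (X k))"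
        unfolding X_def[of "Suc k"] d(2) e(1) F_eq by (simp add: X_def e2_def tk Let_def)
      ultimately show ?thesis
        unfolding euler_at_def using e_le ne order_trans by blast
    qed
    then show ?thesis using J(2) unfolding norm_F by blast
  qed
  have "(\<lambda>k. sqrt ((vs k)\<^sup>2)) \<longlonglongrightarrow> sqrt 0"
    by (intro tendsto_real_sqrt summable_LIMSEQ_zero assms(23))
  then have vs: "vs \<longlonglongrightarrow> 0" by (simp add: tendsto_rabs_zero_iff)
  have "m1 \<ge> 1" by (simp add: m1_def)
  have "(\<lambda>k. sqrt (2 * energy (Y k) (X k))) \<longlonglongrightarrow> 0"
    by (rule energy_tendsto_0[OF \<open>P Ys Xs = Xs\<close> sol(2) \<open>0 < \<nu>\<close> \<open>\<nu> < 1\<close> \<open>\<zeta> \<ge> 1\<close> vs \<open>m1 \<ge> 1\<close> alt])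
  then have "(\<lambda>k. norm (F (w k))) \<longlonglongrightarrow> 0" unfolding norm_F .
  then show ?thesis unfolding F_def by (rule tendsto_norm_zero_cancel)
qed

end
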